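(* Fix integers $n,m\ge1$, $k_1,k_2\ge0$. As $\delta\to0^+$ and $\kappa\to+\infty$, \[p_{1,k_1,k_2}(x,t)=\frac{(-1)^{k_2}\pi^{k_1+k_2}}{4^n(\pi\delta)^{n+k_1-\frac{m+1}2}\sqrt{2\pi\kappa^m}}e^{-\frac14d(x,t)^2}\Big[1+O\Big(\delta+\frac1\kappa\Big)\Big].\]
   Context: For $(x,t)\in\mathbb{R}^{2n}\times\mathbb{R}^m$, $u_1$ the first standard basis vector of $\mathbb{R}^m$, \[p_{1,k_1,k_2}(x,t)=\frac{(-1)^{k_1}i^{k_2}}{(4\pi)^n(2\pi)^m}\int_{\mathbb{R}^m}e^{i|t|(\lambda,u_1)-\frac{|x|^2}{4}|\lambda|\coth|\lambda|}\frac{|\lambda|^{n+k_1}\cosh(|\lambda|)^{k_1}}{\sinh(|\lambda|)^{n+k_1}}(\lambda,u_1)^{k_2}\,d\lambda .\] $R=|x|^2/4$, $\omega=|t|/R$, $\delta=\sqrt{R/(\pi|t|)}$, $\kappa=2\sqrt{\pi|t|R}$. $\theta(\lambda)=\frac{2\lambda-\sin(2\lambda)}{2\sin^2\lambda}$ ($\theta(0)=0$) is a diffeomorphism $(-\pi,\pi)\to\mathbb{R}$, $y_\omega=\theta^{-1}(\omega)$; $d(x,t)=|x|y_\omega/\sin(y_\omega)$ if $x\ne0,t\ne0$, $d(x,0)=|x|$, $d(0,t)=\sqrt{4\pi|t|}$. *)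

theory Defs
  imports "HOL-Analysis.Analysis"
begin

definition theta :: "real \<Rightarrow> real" where
  "theta l = (if l = 0 then 0 else (2*l - sin (2*l)) / (2 * (sin l)^2))"

text \<open>The kernel p_{1,k1,k2}(x,t); u plays the role of the first standard basis vector u_1
  of R^m (m = DIM('b)); n is the half-dimension of the x-space.\<close>
definition p1 :: "nat \<Rightarrow> nat \<Rightarrow> nat \<Rightarrow> 'b::euclidean_space \<Rightarrow> 'a::real_normed_vector \<Rightarrow> 'b \<Rightarrow> complex" where
  "p1 n k1 k2 u x t =
     ((-1)^k1 * \<i>^k2 / complex_of_real ((4*pi)^n * (2*pi)^DIM('b))) *
     (LINT l|lborel.
        exp (\<i> * complex_of_real (norm t * (l \<bullet> u))
             - complex_of_real ((norm x)^2 / 4 * norm l * cosh (norm l) / sinh (norm l)))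
        * complex_of_real (norm l ^ (n+k1) * cosh (norm l) ^ k1 / sinh (norm l) ^ (n+k1))
        * complex_of_real ((l \<bullet> u) ^ k2))"

definition Rof :: "'a::real_normed_vector \<Rightarrow> real" where
  "Rof x = (norm x)^2 / 4"

definition deltaof :: "'a::real_normed_vector \<Rightarrow> 'b::real_normed_vector \<Rightarrow> real" where
  "deltaof x t = sqrt (Rof x / (pi * norm t))"

definition kappaof :: "'a::real_normed_vector \<Rightarrow> 'b::real_normed_vector \<Rightarrow> real" where
  "kappaof x t = 2 * sqrt (pi * norm t * Rof x)"

definition dCC :: "'a::real_normed_vector \<Rightarrow> 'b::real_normed_vector \<Rightarrow> real" where
  "dCC x t =
    (if x = 0 then sqrt (4 * pi * norm t)
     else if t = 0 then norm x
     else (let \<omega> = norm t / Rof x;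
               y = (THE y. -pi < y \<and> y < pi \<and> theta y = \<omega>)
           in norm x * y / sin y))"

definition mainterm :: "nat \<Rightarrow> nat \<Rightarrow> nat \<Rightarrow> 'a::real_normed_vector \<Rightarrow> 'b::euclidean_space \<Rightarrow> real" where
  "mainterm n k1 k2 x t =
     (-1)^k2 * pi^(k1+k2) /
       (4^n * (pi * deltaof x t) powr (real (n+k1) - (real DIM('b) + 1)/2)
            * sqrt (2*pi * kappaof x t ^ DIM('b)))
     * exp (- ((dCC x t)^2) / 4)"

end

theory Submission
  imports Defs "HOL-Complex_Analysis.Complex_Analysis" "HOL-Probability.Distributions" "HOL-Real_Asymp.Real_Asymp"
begin

text \<open>
  Write \<open>\<lambda> = r u + \<lambda>'\<close> with \<open>\<lambda>'\<close> orthogonal to \<open>u\<close>, and \<open>v = \<bar>\<lambda>'\<bar>^2\<close>. For fixed \<open>\<lambda>'\<close> the integrand is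
  meromorphic in \<open>r\<close> up to an essential singularity at \<open>r = i sqrt (\<pi>^2 + v)\<close>, the next one being at
  \<open>i sqrt (4 \<pi>^2 + v)\<close>. Moving the line of integration to \<open>Im r = sqrt ((3\<pi>/2)^2 + v)\<close> leaves an
  exponentially negligible integral, plus a loop around the first singularity. The substitution
  \<open>r = i sqrt (v + (\<pi> - z)^2)\<close> turns the loop into the circle \<open>\<bar>z\<bar> = h\<close>, and for \<open>h = \<pi> - y\<close> the
  phase on this circle is \<open>- d^2/4 - M (1 - cos \<phi>)\<close> with \<open>M = 2 \<pi> R / h \<sim> \<kappa>\<close>, up to an error of order
  \<open>h^3 M \<phi>^2\<close>, because \<open>h\<close> is an exact saddle point. Laplace's method in \<open>\<phi>\<close> and a Gaussian integral
  in \<open>\<lambda>'\<close> give the main term. Taking the residue, rather than integrating along a line through the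
  saddle point, avoids any restriction on \<open>m\<close> in terms of \<open>n + k_1\<close>.
\<close>

section \<open>Power series for sinh s / s and cosh s in the variable s^2\<close>

text \<open>All estimates must be uniform in \<open>R\<close>, \<open>h\<close> and
  \<open>v\<close>: \<open>R = kappa * delta / 2\<close> may be small or large, and \<open>v\<close>
  runs over a half-line. With \<open>T = |t|\<close> the relative error is collected as
  \<open>h + 1/T + 1/M\<close>: \<open>h\<close> comes from freezing the amplitude and from the
  regular part of the phase, \<open>1/T\<close> from the width of the Gaussian in the transverse
  variables, \<open>1/M\<close> from Laplace's method. Each is O(delta + 1/kappa), since
  \<open>h\<close> is comparable to pi * delta, \<open>M\<close> to kappa, and kappa = 2 pi T delta.
  The Gaussian exp(-T v / (2 pi)) describes only small \<open>v\<close>; for large \<open>v\<close>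
  the exponent grows merely like T sqrt(v). Errors are therefore majorised by exp(-sqrt(T v) / 4),
  which still depends only on sqrt T times the transverse variables and so integrates to the same
  power of \<open>T\<close>. The height sqrt((3 pi / 2)^2 + v) separates the first two singularities
  for every \<open>v\<close>. On it the integrand may grow like exp(D R), which is harmless because
  \<open>R <= T h^2 / 2\<close>; the decay in \<open>T\<close> wins because d^2 / 4 <= pi T.\<close>

text \<open>
  \<open>shc\<close> and \<open>chc\<close> are the entire functions with \<open>shc (s^2) = sinh s / s\<close> and \<open>chc (s^2) = cosh s\<close>;
  with them the radial integrand becomes a meromorphic function of the complexified \<open>\<bar>\<lambda>\<bar>^2\<close>,
  without any choice of a square root.
\<close>

definition shc :: "complex \<Rightarrow> complex" where
  "shc w = (\<Sum>j. w ^ j / fact (2 * j + 1))"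

definition chc :: "complex \<Rightarrow> complex" where
  "chc w = (\<Sum>j. w ^ j / fact (2 * j))"

lemma summable_div_fact:
  fixes w :: complex
  assumes "\<And>j. j \<le> g j"
  shows "summable (\<lambda>j. w ^ j / fact (g j))"
proof (rule summable_comparison_test')
  show "summable (\<lambda>j. inverse (fact j) * norm w ^ j)" by (rule summable_exp)
  fix j :: nat
  have "norm (w ^ j / fact (g j)) = norm w ^ j / fact (g j)"
    by (simp add: norm_divide norm_power)
  also have "\<dots> \<le> norm w ^ j / fact j"
    by (intro divide_left_mono fact_mono assms) auto
  finally show "norm (w ^ j / fact (g j)) \<le> inverse (fact j) * norm w ^ j"
    by (simp add: divide_inverse mult.commute)
qed

lemma shc_sums: "(\<lambda>j. w ^ j / fact (2 * j + 1)) sums shc w"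
  unfolding shc_def by (intro summable_sums summable_div_fact) auto

lemma chc_sums: "(\<lambda>j. w ^ j / fact (2 * j)) sums chc w"
  unfolding chc_def by (intro summable_sums summable_div_fact) auto

lemma entire_power_series:
  assumes "\<And>w. (\<lambda>j. a j * w ^ j) sums f w"
  shows "f holomorphic_on UNIV"
proof -
  have "f holomorphic_on ball 0 r" for r
    by (rule power_series_holomorphic[where a = a]) (use assms in simp)
  then have "f field_differentiable at w" for w
    by (rule holomorphic_on_imp_differentiable_at[of _ "ball 0 (norm w + 1)"]) auto
  then show ?thesis
    by (simp add: holomorphic_on_def)
qed

lemma holomorphic_shc: "shc holomorphic_on UNIV"
  by (rule entire_power_series[where a = "\<lambda>j. 1 / fact (2 * j + 1)"]) (use shc_sums in simp)

lemma holomorphic_chc: "chc holomorphic_on UNIV"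
  by (rule entire_power_series[where a = "\<lambda>j. 1 / fact (2 * j)"]) (use chc_sums in simp)

lemma shc_square: "s * shc (s\<^sup>2) = sinh s"
proof -
  have "(\<lambda>j. if even j then 0 else s ^ j /\<^sub>R fact j) sums sinh s"
    by (rule sinh_converges)
  then have "(\<lambda>j. if even (2 * j + 1) then 0 else s ^ (2 * j + 1) /\<^sub>R fact (2 * j + 1)) sums sinh s"
    by (subst sums_mono_reindex[where g = "\<lambda>j. 2 * j + 1"])
       (auto simp: strict_mono_def elim!: oddE)
  moreover have "(\<lambda>j. s * ((s\<^sup>2) ^ j / fact (2 * j + 1))) sums (s * shc (s\<^sup>2))"
    by (intro sums_mult shc_sums)
  moreover have "s * ((s\<^sup>2) ^ j / fact (2 * j + 1)) = s ^ (2 * j + 1) /\<^sub>R fact (2 * j + 1)" for j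
    by (simp add: scaleR_conv_of_real power_mult[symmetric] power_add field_simps)
  ultimately show ?thesis
    by (simp add: sums_iff)
qed

lemma chc_square: "chc (s\<^sup>2) = cosh s"
proof -
  have "(\<lambda>j. if even j then s ^ j /\<^sub>R fact j else 0) sums cosh s"
    by (rule cosh_converges)
  then have "(\<lambda>j. if even (2 * j) then s ^ (2 * j) /\<^sub>R fact (2 * j) else 0) sums cosh s"
    by (subst sums_mono_reindex[where g = "\<lambda>j. 2 * j"])
       (auto simp: strict_mono_def elim!: evenE)
  moreover have "(s\<^sup>2) ^ j / fact (2 * j) = s ^ (2 * j) /\<^sub>R fact (2 * j)" for j
    by (simp add: scaleR_conv_of_real power_mult[symmetric] power_add field_simps)
  ultimately show ?thesis
    using chc_sums[of "s\<^sup>2"] by (simp add: sums_iff)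
qed

lemma shc_0 [simp]: "shc 0 = 1"
  using shc_sums[of 0] sums_0 powser_sums_zero[of "\<lambda>j. 1 / fact (2 * j + 1) :: complex"]
  by (simp add: sums_iff)

lemma shc_neg_square: "z * shc (- (z\<^sup>2)) = sin z"
proof -
  have "\<i> * z * shc ((\<i> * z)\<^sup>2) = sinh (\<i> * z)" by (rule shc_square)
  then have "\<i> * (z * shc (- (z\<^sup>2))) = \<i> * sin z"
    by (simp add: sin_conv_sinh power_mult_distrib algebra_simps)
  then show ?thesis by simp
qed

lemma chc_neg_square: "chc (- (z\<^sup>2)) = cos z"
  using chc_square[of "\<i> * z"] by (simp add: cosh_conv_cos power_mult_distrib algebra_simps)

text \<open>With \<open>w = -(z^2)\<close> the zeros of \<open>shc\<close> come from those of
  \<open>sin\<close>, except that z = 0 drops out because \<open>shc 0 = 1\<close>. These zeros are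
  the only singularities of the radial factor.\<close>

lemma shc_eq_0D:
  assumes "shc w = 0"
  obtains k :: nat where "k \<ge> 1" "w = - of_real ((real k * pi)\<^sup>2)"
proof -
  define z where "z = csqrt (- w)"
  have w: "w = - (z\<^sup>2)" by (simp add: z_def)
  have "sin z = 0" using shc_neg_square[of z] assms w by simp
  then obtain m :: int where m: "z = of_real (of_int m * pi)"
    by (metis sin_eq_0 of_real_mult of_real_of_int_eq mult.commute)
  have "m \<noteq> 0" using assms w m by auto
  show thesis
  proof (rule that[of "nat \<bar>m\<bar>"])
    show "1 \<le> nat \<bar>m\<bar>" using \<open>m \<noteq> 0\<close> by linarith
    show "w = - complex_of_real ((real (nat \<bar>m\<bar>) * pi)\<^sup>2)"
      unfolding w m by (simp add: power_mult_distrib)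
  qed
qed

lemma shc_nonneg_real_nonzero:
  assumes "q \<ge> 0"
  shows "shc (of_real q) \<noteq> 0"
proof
  assume "shc (of_real q) = 0"
  then obtain j :: nat where j: "j \<ge> 1" "complex_of_real q = - of_real ((real j * pi)\<^sup>2)"
    by (rule shc_eq_0D)
  then have "complex_of_real q = of_real (- ((real j * pi)\<^sup>2))" by simp
  then have "q = - ((real j * pi)\<^sup>2)" unfolding of_real_eq_iff .
  moreover have "(real j * pi)\<^sup>2 > 0" using j by simp
  ultimately show False using assms by linarith
qed

lemma sinh_complex_of_real: "sinh (complex_of_real x) = of_real (sinh x)"
  by (simp add: sinh_def scaleR_conv_of_real exp_of_real flip: of_real_minus)

lemma cosh_complex_of_real: "cosh (complex_of_real x) = of_real (cosh x)"
  by (simp add: cosh_def scaleR_conv_of_real exp_of_real flip: of_real_minus)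

section \<open>Decay of the radial factor in the complexified squared length\<close>

lemma compact_norm_bound:
  fixes f :: "'a::topological_space \<Rightarrow> 'b::real_normed_vector"
  assumes "compact K" "continuous_on K f"
  obtains b where "b > 0" "\<And>x. x \<in> K \<Longrightarrow> norm (f x) \<le> b"
  using compact_imp_bounded[OF compact_continuous_image[OF assms(2,1)]] by (auto simp: bounded_pos)

text \<open>The radial factor of the integrand at w = |lambda|^2: for w = s^2 the quotient
  \<open>chc w / shc w\<close> is s coth s. It is used with \<open>N = n + k\<close>.\<close>

definition kerF :: "real \<Rightarrow> nat \<Rightarrow> nat \<Rightarrow> complex \<Rightarrow> complex" where
  "kerF R N k w = exp (- (of_real R * chc w / shc w)) * chc w ^ k / shc w ^ N"

lemma kerF_holomorphic:
  assumes "\<And>w. w \<in> S \<Longrightarrow> shc w \<noteq> 0"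
  shows "kerF R N k holomorphic_on S"
  unfolding kerF_def
  by (intro holomorphic_intros holomorphic_on_subset[OF holomorphic_shc]
        holomorphic_on_subset[OF holomorphic_chc]) (use assms in auto)

lemma continuous_shc [continuous_intros]: "continuous_on S f \<Longrightarrow> continuous_on S (\<lambda>x. shc (f x))"
  using continuous_on_compose2[OF holomorphic_on_imp_continuous_on[OF holomorphic_shc]] by blast
lemma continuous_chc [continuous_intros]: "continuous_on S f \<Longrightarrow> continuous_on S (\<lambda>x. chc (f x))"
  using continuous_on_compose2[OF holomorphic_on_imp_continuous_on[OF holomorphic_chc]] by blast

text \<open>Raise d x <= exp(d x) to the power j with d = c / (j + 1); taking j + 1 instead of j
  also covers j = 0.\<close>

lemma exp_ge_power:
  fixes x c :: real
  assumes "c > 0" "x \<ge> 0"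
  shows "x ^ j \<le> (real (Suc j) / c) ^ j * exp (c * x)"
proof -
  define d where "d = c / real (Suc j)"
  have d: "d > 0" using assms by (simp add: d_def)
  have "d * x \<le> exp (d * x)" using exp_ge_add_one_self[of "d * x"] by linarith
  then have "(d * x) ^ j \<le> exp (d * x) ^ j"
    using d assms by (intro power_mono) auto
  also have "\<dots> = exp (real j * (d * x))" by (simp add: exp_of_nat_mult)
  also have "\<dots> \<le> exp (c * x)"
  proof -
    have "real j * d \<le> c" using assms by (simp add: d_def field_simps)
    then show ?thesis using mult_right_mono[of "real j * d" c x] assms by (simp add: mult.assoc)
  qed
  finally have "d ^ j * x ^ j \<le> exp (c * x)" by (simp add: power_mult_distrib)
  then have "x ^ j \<le> (1 / d) ^ j * exp (c * x)"
    using d by (simp add: field_simps power_divide)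
  then show ?thesis by (simp add: d_def)
qed

lemma kerF_of_square:
  assumes "sinh s \<noteq> 0"
  shows "kerF R N k (s\<^sup>2) = exp (- (of_real R * (s * cosh s / sinh s))) * cosh s ^ k * s ^ N / sinh s ^ N"
proof -
  have "s \<noteq> 0" using assms by auto
  then have "shc (s\<^sup>2) = sinh s / s" using shc_square[of s] by (simp add: field_simps)
  then show ?thesis by (simp add: kerF_def chc_square power_divide field_simps)
qed

lemma norm_mult_mono:
  fixes a b :: "'a::real_normed_div_algebra"
  assumes "norm a \<le> A" "norm b \<le> B"
  shows "norm (a * b) \<le> A * B"
  unfolding norm_mult using assms by (intro mult_mono order_trans[OF norm_ge_zero assms(1)] norm_ge_zero)

lemma norm_exp_neg_le:
  assumes "R \<ge> 0" "Re z \<ge> - D"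
  shows "norm (exp (- (of_real R * z))) \<le> exp (D * R)"
proof -
  have "R * Re z \<ge> R * (- D)" using assms by (intro mult_left_mono)
  then show ?thesis by (simp add: mult.commute)
qed

lemma norm_sinh_ge:
  fixes s :: complex
  assumes "Re s \<ge> 5"
  shows "norm (sinh s) \<ge> exp (Re s) / 4"
proof -
  have "norm (exp s - exp (- s)) \<ge> norm (exp s) - norm (exp (- s))" by (rule norm_triangle_ineq2)
  moreover have "exp (- Re s) \<le> exp (Re s) / 2"
    using exp_ge_add_one_self[of "Re s"] assms
    by (smt (verit) exp_le_cancel_iff exp_minus exp_not_eq_zero inverse_eq_divide less_divide_eq_1_pos divide_le_eq_1_pos field_sum_of_halves)
  ultimately have "norm (exp s - exp (- s)) \<ge> exp (Re s) / 2" by (simp add: norm_exp_eq_Re)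
  then show ?thesis by (simp add: sinh_field_def norm_divide)
qed

text \<open>Since s coth s = s + s exp(-s) / sinh s and the correction is at most Re s, the real
  part is nonnegative and the bound does not depend on \<open>R\<close>. The \<open>k\<close>
  factors cosh s cancel \<open>k\<close> of the \<open>n + k\<close> factors sinh s, which leaves
  exp(-n Re s).\<close>

lemma norm_kerF_le_sector:
  assumes a: "Re s \<ge> 5" and b: "\<bar>Im s\<bar> \<le> Re s + 5" and n: "n \<ge> 1" and R: "R \<ge> 0"
  shows "norm (kerF R (n + k) k (s\<^sup>2)) \<le> (12 * Re s) ^ (n + k) * exp (- Re s)"
proof -
  let ?a = "Re s"
  have sh: "norm (sinh s) \<ge> exp ?a / 4" using norm_sinh_ge[OF a] .
  then have sh0: "sinh s \<noteq> 0" using exp_gt_zero[of ?a] by fastforce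
  have ns: "norm s \<le> 3 * ?a" using cmod_le[of s] a b by linarith
  have e: "exp ?a \<ge> 6" using exp_ge_add_one_self[of ?a] a by linarith
  have "exp ?a * exp ?a \<ge> 6 * 6" using e by (intro mult_mono) auto
  then have e2: "12 * exp (- ?a) \<le> exp ?a" by (simp add: exp_minus field_simps)
  have "s * cosh s / sinh s = s + s * exp (- s) / sinh s"
    using sh0 by (simp add: field_simps sinh_field_def cosh_field_def)
  moreover have "norm (s * exp (- s) / sinh s) \<le> ?a"
  proof -
    have "norm (s * exp (- s) / sinh s) = norm s * exp (- ?a) / norm (sinh s)"
      by (simp add: norm_mult norm_divide norm_exp_eq_Re)
    also have "\<dots> \<le> 3 * ?a * exp (- ?a) / (exp ?a / 4)"
      by (intro frac_le mult_right_mono ns sh) (use a in auto)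
    also have "\<dots> = ?a * (12 * exp (- ?a)) / exp ?a" by simp
    also have "\<dots> \<le> ?a * exp ?a / exp ?a"
      by (intro divide_right_mono mult_left_mono e2) (use a in auto)
    finally show ?thesis by simp
  qed
  ultimately have "Re (s * cosh s / sinh s) \<ge> 0"
    using abs_Re_le_cmod[of "s * exp (- s) / sinh s"] by simp
  then have "norm (exp (- (of_real R * (s * cosh s / sinh s)))) \<le> 1"
    using norm_exp_neg_le[OF R, of 0 "s * cosh s / sinh s"] by simp
  moreover have "norm (cosh s) \<le> exp ?a"
  proof -
    have "norm (exp s + exp (- s)) \<le> exp ?a + exp (- ?a)"
      using norm_triangle_ineq[of "exp s" "exp (- s)"] by (simp add: norm_exp_eq_Re)
    also have "\<dots> \<le> 2 * exp ?a" using a by simp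
    finally show ?thesis by (simp add: cosh_field_def norm_divide)
  qed
  moreover have "norm (s ^ (n + k) / sinh s ^ (n + k)) \<le> (12 * ?a * exp (- ?a)) ^ (n + k)"
  proof -
    have "norm (s / sinh s) \<le> 3 * ?a / (exp ?a / 4)"
      unfolding norm_divide by (intro frac_le ns sh) (use a in auto)
    then have "norm (s / sinh s) \<le> 12 * ?a * exp (- ?a)" by (simp add: exp_minus field_simps)
    then have "norm (s / sinh s) ^ (n + k) \<le> (12 * ?a * exp (- ?a)) ^ (n + k)" by (intro power_mono) auto
    then show ?thesis by (simp add: norm_divide norm_power power_divide)
  qed
  ultimately have "norm (exp (- (of_real R * (s * cosh s / sinh s)))) * norm (cosh s) ^ k * norm (s ^ (n + k) / sinh s ^ (n + k))
      \<le> 1 * exp ?a ^ k * (12 * ?a * exp (- ?a)) ^ (n + k)"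
    by (intro mult_mono power_mono) auto
  also have "\<dots> = (12 * ?a) ^ (n + k) * exp (- ?a) ^ n * (exp ?a * exp (- ?a)) ^ k"
    by (simp add: power_mult_distrib power_add mult_ac)
  also have "exp ?a * exp (- ?a) = 1" by (simp add: exp_minus)
  also have "(12 * ?a) ^ (n + k) * exp (- ?a) ^ n * 1 ^ k \<le> (12 * ?a) ^ (n + k) * exp (- ?a) ^ 1 * 1 ^ k"
    by (intro mult_right_mono mult_left_mono power_decreasing) (use a n in auto)
  finally show "norm (kerF R (n + k) k (s\<^sup>2)) \<le> (12 * Re s) ^ (n + k) * exp (- Re s)"
    by (simp add: kerF_of_square[OF sh0] norm_mult norm_divide norm_power)
qed

lemma norm_kerF_le_sector_exp:
  assumes "n \<ge> 1"
  obtains C where "C > 0" "\<And>R s. Re s \<ge> 5 \<Longrightarrow> \<bar>Im s\<bar> \<le> Re s + 5 \<Longrightarrow> R \<ge> 0 \<Longrightarrow>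
     norm (kerF R (n + k) k (s\<^sup>2)) \<le> C * exp (- Re s / 2)"
proof
  define C where "C = 12 ^ (n + k) * (real (Suc (n + k)) / (1/2)) ^ (n + k)"
  show "C > 0" by (simp add: C_def)
  fix R s assume s: "Re s \<ge> 5" "\<bar>Im s\<bar> \<le> Re s + 5" "(R :: real) \<ge> 0"
  have "norm (kerF R (n + k) k (s\<^sup>2)) \<le> 12 ^ (n + k) * Re s ^ (n + k) * exp (- Re s)"
    using norm_kerF_le_sector[OF s(1,2) assms s(3)] by (simp add: power_mult_distrib)
  also have "\<dots> \<le> 12 ^ (n + k) * ((real (Suc (n + k)) / (1/2)) ^ (n + k) * exp (1/2 * Re s)) * exp (- Re s)"
    by (intro mult_right_mono mult_left_mono exp_ge_power) (use s in auto)
  also have "\<dots> = C * exp (1/2 * Re s + - Re s)" unfolding C_def exp_add by simp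
  also have "1/2 * Re s + - Re s = - Re s / 2" by simp
  finally show "norm (kerF R (n + k) k (s\<^sup>2)) \<le> C * exp (- Re s / 2)" .
qed

lemma pi_three_halves: "(3 * pi / 2)\<^sup>2 \<le> 25"
proof -
  have "3 * pi / 2 \<le> 5" using pi_less_4 pi_approx by simp
  then have "(3 * pi / 2)\<^sup>2 \<le> 5\<^sup>2" by (intro power_mono) auto
  then show ?thesis by simp
qed

text \<open>The map l -> l^2 + v sends the strip |Im l| <= sqrt((3 pi / 2)^2 + v) into this region,
  with r = |Re l|. Writing the root as a + i b gives a^2 - b^2 >= r^2 - 25, so the root lies in the
  sector of the preceding bounds; the number 5 is an upper bound of 3 pi / 2.\<close>

lemma csqrt_parabola:
  assumes "Re w \<ge> r\<^sup>2 - (3 * pi / 2)\<^sup>2" "r \<ge> 0"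
  shows "Re (csqrt w) \<ge> r - 5" "\<bar>Im (csqrt w)\<bar> \<le> Re (csqrt w) + 5"
    "(Im (csqrt w))\<^sup>2 \<le> (Re (csqrt w))\<^sup>2 + 25"
proof -
  define a b where "a = Re (csqrt w)" and "b = Im (csqrt w)"
  have a: "a \<ge> 0" unfolding a_def using csqrt_principal[of w] by auto
  have "Re w = Re ((csqrt w)\<^sup>2)" by simp
  also have "\<dots> = a\<^sup>2 - b\<^sup>2" unfolding a_def b_def by (rule Re_power2)
  finally have ab: "a\<^sup>2 - b\<^sup>2 \<ge> r\<^sup>2 - 25" using assms pi_three_halves by linarith
  have "b\<^sup>2 \<le> a\<^sup>2 + 25" using ab zero_le_power2[of r] by linarith
  then show "(Im (csqrt w))\<^sup>2 \<le> (Re (csqrt w))\<^sup>2 + 25" by (simp add: a_def b_def)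
  from \<open>b\<^sup>2 \<le> a\<^sup>2 + 25\<close> have "b\<^sup>2 \<le> (a + 5)\<^sup>2" using a by (simp add: power2_sum)
  then have "\<bar>b\<bar> \<le> a + 5" using a abs_le_square_iff[of b "a + 5"] by simp
  then show "\<bar>Im (csqrt w)\<bar> \<le> Re (csqrt w) + 5" by (simp add: a_def b_def)
  have "r\<^sup>2 \<le> a\<^sup>2 + 25" using ab zero_le_power2[of b] by linarith
  then have "r\<^sup>2 \<le> (a + 5)\<^sup>2" using a by (simp add: power2_sum)
  then have "r \<le> a + 5" using a assms power2_le_imp_le by fastforce
  then show "Re (csqrt w) \<ge> r - 5" by (simp add: a_def)
qed

text \<open>\<open>r >= 10\<close> forces the root to have real part at least 5, away from all
  singularities. This controls the vertical sides of the rectangles in the contour shift.\<close>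

lemma norm_kerF_le_far:
  assumes "n \<ge> 1"
  obtains C where "C > 0" "\<And>R w r. r \<ge> 10 \<Longrightarrow> Re w \<ge> r\<^sup>2 - (3 * pi / 2)\<^sup>2 \<Longrightarrow> R \<ge> 0 \<Longrightarrow>
     norm (kerF R (n + k) k w) \<le> C * exp (- r / 2)"
proof (rule norm_kerF_le_sector_exp[OF assms, of k], goal_cases)
  case hyps: (1 C)
  note C = hyps(2-)
  show thesis
  proof (rule that[of "C * exp (5 / 2)"])
    show "C * exp (5 / 2) > 0" using C by simp
    fix R w r assume r: "r \<ge> 10" "Re w \<ge> r\<^sup>2 - (3 * pi / 2)\<^sup>2" "(R :: real) \<ge> 0"
    have s: "Re (csqrt w) \<ge> r - 5" "\<bar>Im (csqrt w)\<bar> \<le> Re (csqrt w) + 5"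
      using csqrt_parabola[OF r(2)] r by auto
    have "norm (kerF R (n + k) k w) \<le> C * exp (- Re (csqrt w) / 2)"
      using C(2)[of "csqrt w" R] s r by simp
    also have "\<dots> \<le> C * exp (5 / 2 + - r / 2)" using C s by simp
    finally show "norm (kerF R (n + k) k w) \<le> C * exp (5 / 2) * exp (- r / 2)" unfolding exp_add by simp
  qed
qed

text \<open>These \<open>w\<close> arise from the shifted line. Where the root has real part at
  least 5 the sector bound applies; the rest lies in a compact set, on which the sign of Re(s coth
  s) is not controlled, whence the factor \<open>exp (D * R)\<close>.\<close>

lemma norm_kerF_le_parabola:
  assumes "n \<ge> 1"
  obtains C D where "C > 0" "D > 0"
    "\<And>R w r. r \<ge> 0 \<Longrightarrow> Re w = r\<^sup>2 - (3 * pi / 2)\<^sup>2 \<Longrightarrow> \<bar>Im w\<bar> \<ge> 3 * pi * r \<Longrightarrow> R \<ge> 0 \<Longrightarrow>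
     norm (kerF R (n + k) k w) \<le> C * exp (D * R) * exp (- r / 2)"
proof (rule norm_kerF_le_sector_exp[OF assms, of k], goal_cases)
  case hyps: (1 C)
  note C = hyps(2-)
  \<comment> \<open>The condition on \<open>w\<close> with r eliminated through r^2 = Re w + (3 pi /
    2)^2. The radius 75 is a^2 + b^2 <= 25 + (25 + 25) for a root a + i b with a < 5 and b^2 <= a^2
    + 25.\<close>
  define K where "K = {w. norm w \<le> 75} \<inter> {w. Re w + (3 * pi / 2)\<^sup>2 \<ge> 0} \<inter>
     {w. (Im w)\<^sup>2 \<ge> (3 * pi)\<^sup>2 * (Re w + (3 * pi / 2)\<^sup>2)}"
  have "compact K" unfolding K_def
    by (intro compact_Int_closed closed_Collect_le continuous_intros)
       (use compact_cball[of "0::complex" 75] in \<open>simp add: cball_def\<close>)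
  \<comment> \<open>A zero is real, and the only real point of \<open>K\<close> that it could be is
    the vertex -(3 pi / 2)^2, which would need 2 j = 3.\<close>
  have K0: "shc w \<noteq> 0" if "w \<in> K" for w
  proof
    assume "shc w = 0"
    then obtain j :: nat where j: "j \<ge> 1" "w = - of_real ((real j * pi)\<^sup>2)" by (rule shc_eq_0D)
    then have "Im w = 0" "Re w = - (real j * pi)\<^sup>2" by simp_all
    with that have "(real j * pi)\<^sup>2 \<le> (3 * pi / 2)\<^sup>2" "(3 * pi)\<^sup>2 * ((3 * pi / 2)\<^sup>2 - (real j * pi)\<^sup>2) \<le> 0"
      by (auto simp: K_def algebra_simps)
    then have "(real j * pi)\<^sup>2 = (3 * pi / 2)\<^sup>2" by (simp add: mult_le_0_iff)
    then have "real j * pi = 3 * pi / 2" by simp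
    then have "2 * real j = 3" by (simp add: field_simps)
    then have "2 * j = 3" by linarith
    then show False by presburger
  qed
  have "continuous_on K (\<lambda>w. chc w / shc w)"
    by (intro continuous_intros) (use K0 in auto)
  from compact_norm_bound[OF \<open>compact K\<close> this] obtain D
    where D: "D > 0" "\<And>w. w \<in> K \<Longrightarrow> norm (chc w / shc w) \<le> D" by metis
  have "continuous_on K (\<lambda>w. chc w ^ k / shc w ^ (n + k))"
    by (intro continuous_intros) (use K0 in auto)
  from compact_norm_bound[OF \<open>compact K\<close> this] obtain C'
    where C': "C' > 0" "\<And>w. w \<in> K \<Longrightarrow> norm (chc w ^ k / shc w ^ (n + k)) \<le> C'" by metis
  show thesis
  proof (rule that[of "C * exp (5 / 2) + C' * exp 5" D])
    show "C * exp (5 / 2) + C' * exp 5 > 0" using C C' by (simp add: add_pos_pos)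
    show "D > 0" by fact
    fix R w r assume r: "r \<ge> 0" "Re w = r\<^sup>2 - (3 * pi / 2)\<^sup>2" "\<bar>Im w\<bar> \<ge> 3 * pi * r" "(R :: real) \<ge> 0"
    have s: "Re (csqrt w) \<ge> r - 5" "\<bar>Im (csqrt w)\<bar> \<le> Re (csqrt w) + 5" "(Im (csqrt w))\<^sup>2 \<le> (Re (csqrt w))\<^sup>2 + 25"
      using csqrt_parabola[of r w] r by auto
    show "norm (kerF R (n + k) k w) \<le> (C * exp (5 / 2) + C' * exp 5) * exp (D * R) * exp (- r / 2)"
    proof (cases "Re (csqrt w) \<ge> 5")
      case True
      have "norm (kerF R (n + k) k w) \<le> C * exp (- Re (csqrt w) / 2)"
        using C(2)[of "csqrt w" R] s r True by simp
      also have "\<dots> \<le> C * exp (5 / 2 + - r / 2)" using C s by simp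
      also have "\<dots> = (C * exp (5 / 2)) * 1 * exp (- r / 2)" unfolding exp_add by simp
      also have "\<dots> \<le> (C * exp (5 / 2) + C' * exp 5) * exp (D * R) * exp (- r / 2)"
        using C C' D r by (intro mult_right_mono mult_mono) auto
      finally show ?thesis .
    next
      case False
      have "Re (csqrt w) \<ge> 0" using csqrt_principal[of w] by auto
      then have a2: "(Re (csqrt w))\<^sup>2 \<le> 5\<^sup>2" using False by (intro power_mono) auto
      have "norm w = norm ((csqrt w)\<^sup>2)" by simp
      also have "\<dots> = (Re (csqrt w))\<^sup>2 + (Im (csqrt w))\<^sup>2"
        unfolding norm_power by (rule cmod_power2)
      finally have "norm w \<le> 75" using a2 s by simp
      moreover have "(Im w)\<^sup>2 \<ge> (3 * pi * r)\<^sup>2" using r by (metis abs_le_square_iff abs_of_nonneg mult_nonneg_nonneg pi_ge_zero zero_le_numeral)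
      ultimately have wK: "w \<in> K" using r by (simp add: K_def power_mult_distrib)
      have r10: "r \<le> 10" using s(1) False by linarith
      have "Re (chc w / shc w) \<ge> - D" using D(2)[OF wK] abs_Re_le_cmod[of "chc w / shc w"] by linarith
      then have "norm (exp (- (of_real R * (chc w / shc w)))) \<le> exp (D * R)"
        using r by (intro norm_exp_neg_le)
      moreover have "kerF R (n + k) k w = exp (- (of_real R * (chc w / shc w))) * (chc w ^ k / shc w ^ (n + k))"
        by (simp add: kerF_def)
      ultimately have "norm (kerF R (n + k) k w) \<le> exp (D * R) * C'"
        using norm_mult_mono[OF _ C'(2)[OF wK]] by metis
      also have "\<dots> = (C' * exp 5) * exp (D * R) * exp (- 5)" by (simp add: exp_minus)
      also have "\<dots> \<le> (C * exp (5 / 2) + C' * exp 5) * exp (D * R) * exp (- r / 2)"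
        using C C' r10 by (intro mult_mono) auto
      finally show ?thesis .
    qed
  qed
qed

text \<open>On the original domain x coth x is nonnegative, so the bound is uniform in
  \<open>R\<close>. It supplies the integrability needed for Fubini.\<close>

lemma norm_kerF_le_real:
  assumes "n \<ge> 1"
  obtains C where "C > 0" "\<And>R x. x \<ge> 0 \<Longrightarrow> R \<ge> 0 \<Longrightarrow> 
     norm (kerF R (n + k) k (of_real (x\<^sup>2))) \<le> C * exp (- x / 2)"
proof (rule norm_kerF_le_sector_exp[OF assms, of k], goal_cases)
  case hyps: (1 C)
  note C = hyps(2-)
  let ?A = "\<lambda>x::real. chc (of_real (x\<^sup>2)) ^ k / shc (of_real (x\<^sup>2)) ^ (n + k)"
  have nz: "shc (of_real (x\<^sup>2)) \<noteq> 0" for x :: real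
    by (rule shc_nonneg_real_nonzero) simp
  have "continuous_on {0..5} ?A"
    by (intro continuous_intros) (use nz in auto)
  from compact_norm_bound[OF compact_Icc this] obtain C'
    where C': "C' > 0" "\<And>x. x \<in> {0..5} \<Longrightarrow> norm (?A x) \<le> C'" by metis
  show thesis
  proof (rule that[of "C + C' * exp (5/2)"])
    show "C + C' * exp (5/2) > 0" using C C' by (simp add: add_pos_pos)
    fix R x :: real assume x: "x \<ge> 0" "R \<ge> 0"
    show "norm (kerF R (n + k) k (of_real (x\<^sup>2))) \<le> (C + C' * exp (5/2)) * exp (- x / 2)"
    proof (cases "x \<ge> 5")
      case True
      have "norm (kerF R (n + k) k ((of_real x)\<^sup>2)) \<le> C * exp (- Re (of_real x) / 2)"
        using True x by (intro C(2)) auto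
      also have "\<dots> \<le> (C + C' * exp (5/2)) * exp (- x / 2)"
        using C' by (simp add: mult_right_mono)
      finally show ?thesis by simp
    next
      case False
      have "Re (chc (of_real (x\<^sup>2)) / shc (of_real (x\<^sup>2))) \<ge> 0"
      proof (cases "x = 0")
        case True
        then show ?thesis using chc_square[of 0] by simp
      next
        case False
        have "shc (of_real (x\<^sup>2)) = of_real (sinh x / x)"
          using shc_square[of "of_real x"] False by (simp add: field_simps sinh_complex_of_real)
        moreover have "chc (of_real (x\<^sup>2)) = of_real (cosh x)"
          using chc_square[of "of_real x"] by (simp add: cosh_complex_of_real)
        ultimately have "chc (of_real (x\<^sup>2)) / shc (of_real (x\<^sup>2)) = of_real (cosh x / (sinh x / x))"
          by simp
        then show ?thesis using x by (simp del: of_real_divide)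
      qed
      then have "norm (exp (- (of_real R * (chc (of_real (x\<^sup>2)) / shc (of_real (x\<^sup>2)))))) \<le> 1"
        using norm_exp_neg_le[OF x(2), of 0 "chc (of_real (x\<^sup>2)) / shc (of_real (x\<^sup>2))"] by simp
      moreover have "kerF R (n + k) k (of_real (x\<^sup>2)) = exp (- (of_real R * (chc (of_real (x\<^sup>2)) / shc (of_real (x\<^sup>2)))))
           * (chc (of_real (x\<^sup>2)) ^ k / shc (of_real (x\<^sup>2)) ^ (n + k))"
        by (simp add: kerF_def)
      ultimately have "norm (kerF R (n + k) k (of_real (x\<^sup>2))) \<le> 1 * C'"
        using norm_mult_mono[OF _ C'(2)[of x]] x False by (metis atLeastAtMost_iff linorder_le_cases)
      also have "\<dots> = (C' * exp (5/2)) * exp (- 5/2)" by (simp add: exp_minus)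
      also have "\<dots> \<le> (C + C' * exp (5/2)) * exp (- x / 2)"
        using C C' False by (intro mult_mono) auto
      finally show ?thesis .
    qed
  qed
qed

section \<open>Integrals over the real line and contour shifts\<close>

lemma has_bochner_integral_exp_abs:
  fixes c :: real
  assumes "c > 0"
  shows "has_bochner_integral lborel (\<lambda>x. exp (- (c * \<bar>x\<bar>))) (2 / c)"
proof -
  have "has_bochner_integral lborel (\<lambda>x. x ^ 0 * exp (- x) * indicator {0..} x :: real) (fact 0)"
    using nn_intergal_power_times_exp_Ici[of 0]
    by (intro has_bochner_integral_nn_integral)
       (auto simp: nn_integral_set_ennreal split: split_indicator)
  moreover have "(\<lambda>x. x ^ 0 * exp (- x) * indicator {0..} x :: real) = (\<lambda>x. indicator {0..} x *\<^sub>R exp (- \<bar>x\<bar>))"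
    by (auto split: split_indicator)
  ultimately have "has_bochner_integral lborel (\<lambda>x. indicator {0..} x *\<^sub>R exp (- \<bar>x\<bar>) :: real) 1" by simp
  from has_bochner_integral_even_function[OF this]
  have "has_bochner_integral lborel (\<lambda>x. exp (- \<bar>x\<bar>) :: real) 2" by simp
  then show ?thesis
    using assms lborel_has_bochner_integral_real_affine_iff[of c "\<lambda>x. exp (- \<bar>x\<bar>) :: real" 2 0]
    by (simp add: abs_mult field_simps)
qed

lemma has_bochner_integral_gaussian:
  fixes a :: real
  assumes "a > 0"
  shows "has_bochner_integral lborel (\<lambda>x. exp (- (a * x\<^sup>2))) (sqrt (pi / a))"
proof -
  have "has_bochner_integral lborel (\<lambda>x. exp (- x\<^sup>2) :: real) (sqrt pi)"
    using has_bochner_integral_even_function[OF gaussian_moment_0] by simp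
  then show ?thesis
    using assms lborel_has_bochner_integral_real_affine_iff[of "sqrt a" "\<lambda>x. exp (- x\<^sup>2) :: real" "sqrt pi" 0]
    by (simp add: power_mult_distrib real_sqrt_divide field_simps)
qed

lemma contour_integral_linepath_same_Im:
  assumes "a < b"
  shows "contour_integral (linepath (Complex a c) (Complex b c)) f = integral {a..b} (\<lambda>x. f (Complex x c))"
proof -
  define g where "g z = f (z + Complex 0 c)" for z
  have "contour_integral (linepath (Complex a c) (Complex b c)) f = contour_integral (linepath (of_real a) (of_real b)) g"
    unfolding contour_integral_integral
  proof (rule integral_cong)
    fix x :: real assume "x \<in> {0..1}"
    have "linepath (Complex a c) (Complex b c) x = linepath (of_real a) (of_real b) x + Complex 0 c"
      by (simp add: linepath_def complex_eq_iff scaleR_conv_of_real algebra_simps)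
    moreover have ends: "Complex b c - Complex a c = of_real b - of_real a" by (simp add: complex_eq_iff)
    ultimately show "f (linepath (Complex a c) (Complex b c) x) * vector_derivative (linepath (Complex a c) (Complex b c)) (at x) =
        g (linepath (of_real a) (of_real b) x) * vector_derivative (linepath (of_real a) (of_real b)) (at x)"
      using ends by (simp add: g_def)
  qed
  also have "\<dots> = integral {a..b} (\<lambda>x. g (of_real x))"
    using contour_integral_linepath_Reals_eq[of "of_real a" "of_real b" g] assms by simp
  also have "(\<lambda>x. g (of_real x)) = (\<lambda>x. f (Complex x c))"
    by (simp add: g_def Complex_eq add.commute)
  finally show ?thesis .
qed

lemma integrable_exp_decay_line:
  fixes g :: "real \<Rightarrow> complex"
  assumes cont: "continuous_on UNIV g" and c: "c > 0"
    and dec: "\<And>x. \<bar>x\<bar> \<ge> X \<Longrightarrow> norm (g x) \<le> B * exp (- (c * \<bar>x\<bar>))"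
  shows "integrable lborel g"
proof -
  from compact_norm_bound[OF compact_Icc[of "- X" X] continuous_on_subset[OF cont subset_UNIV]]
  obtain b where b: "b > 0" "\<And>x. x \<in> {-X..X} \<Longrightarrow> norm (g x) \<le> b" by metis
  have bd: "norm (g x) \<le> (\<bar>B\<bar> + b * exp (c * \<bar>X\<bar>)) * exp (- (c * \<bar>x\<bar>))" for x
  proof (cases "\<bar>x\<bar> \<ge> X")
    case True
    have "norm (g x) \<le> B * exp (- (c * \<bar>x\<bar>))" by (rule dec[OF True])
    also have "\<dots> \<le> (\<bar>B\<bar> + b * exp (c * \<bar>X\<bar>)) * exp (- (c * \<bar>x\<bar>))"
      using b by (intro mult_right_mono) (auto intro: add_increasing2)
    finally show ?thesis .
  next
    case False
    have "norm (g x) \<le> b" using False by (intro b) auto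
    also have "\<dots> \<le> b * exp (c * \<bar>X\<bar> + - (c * \<bar>x\<bar>))"
      using False b c by simp
    also have "\<dots> = b * exp (c * \<bar>X\<bar>) * exp (- (c * \<bar>x\<bar>))" unfolding exp_add by simp
    also have "\<dots> \<le> (\<bar>B\<bar> + b * exp (c * \<bar>X\<bar>)) * exp (- (c * \<bar>x\<bar>))"
      by (intro mult_right_mono) auto
    finally show ?thesis .
  qed
  have nonneg: "\<bar>B\<bar> + b * exp (c * \<bar>X\<bar>) \<ge> 0" using b by (simp add: add_nonneg_nonneg)
  have "integrable lborel (\<lambda>x. (\<bar>B\<bar> + b * exp (c * \<bar>X\<bar>)) * exp (- (c * \<bar>x\<bar>)))"
    using has_bochner_integral_exp_abs[OF c] by (intro integrable_mult_right) (auto simp: has_bochner_integral_iff)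
  moreover have "g \<in> borel_measurable lborel" using borel_measurable_continuous_onI[OF cont] by simp
  moreover have "AE x in lborel. norm (g x) \<le> norm ((\<bar>B\<bar> + b * exp (c * \<bar>X\<bar>)) * exp (- (c * \<bar>x\<bar>)))"
    using bd nonneg by (auto simp: abs_mult)
  ultimately show ?thesis by (rule Bochner_Integration.integrable_bound)
qed

lemma integral_symmetric_interval_tendsto:
  fixes g :: "real \<Rightarrow> complex"
  assumes "integrable lborel g"
  shows "(\<lambda>j. integral {- real j..real j} g) \<longlonglongrightarrow> (LINT x|lborel. g x)"
proof -
  have "(\<lambda>j. LINT x|lborel. indicator {- real j..real j} x *\<^sub>R g x) \<longlonglongrightarrow> (LINT x|lborel. g x)"
  proof (rule integral_dominated_convergence)
    show "integrable lborel (\<lambda>x. norm (g x))" using assms by simp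
    show "AE x in lborel. (\<lambda>j. indicator {- real j..real j} x *\<^sub>R g x) \<longlonglongrightarrow> g x"
    proof (rule AE_I2)
      fix x :: real
      have "\<forall>\<^sub>F j in sequentially. indicator {- real j..real j} x *\<^sub>R g x = g x"
      proof -
        have "\<forall>\<^sub>F j in sequentially. j \<ge> nat \<lceil>\<bar>x\<bar>\<rceil>" by (rule eventually_ge_at_top)
        then show ?thesis
        proof eventually_elim
          case (elim j)
          then have "\<bar>x\<bar> \<le> real j" by linarith
          then show ?case by (auto simp: indicator_def)
        qed
      qed
      then show "(\<lambda>j. indicator {- real j..real j} x *\<^sub>R g x) \<longlonglongrightarrow> g x"
        by (rule tendsto_eventually)
    qed
  qed (use assms in \<open>auto simp: indicator_def\<close>)
  moreover have "(LINT x|lborel. indicator {- real j..real j} x *\<^sub>R g x) = integral {- real j..real j} g" for j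
  proof -
    have "set_integrable lborel {- real j..real j} g"
      unfolding set_integrable_def using assms by (intro integrable_mult_indicator) auto
    from set_borel_integral_eq_integral(2)[OF this] show ?thesis
      unfolding set_lebesgue_integral_def .
  qed
  ultimately show ?thesis by simp
qed

text \<open>\<open>f\<close> may have an essential singularity at \<open>p\<close>, and its residue
  is never evaluated: large rectangles and \<open>\<gamma>\<close> both have winding number 1 about
  \<open>p\<close>, so their integrals agree. The vertical sides tend to 0 by the exponential
  decay.\<close>

lemma contour_shift_simple_singularity:
  fixes f :: "complex \<Rightarrow> complex"
  assumes Y: "0 < Y" "Y < b" and a: "a < 0" and p: "0 < Im p" "Im p < Y"
    and hol: "f holomorphic_on {z. a < Im z \<and> Im z < b} - {p}"
    and \<gamma>: "valid_path \<gamma>" "pathfinish \<gamma> = pathstart \<gamma>" "winding_number \<gamma> p = 1"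
      "path_image \<gamma> \<subseteq> {z. a < Im z \<and> Im z < b} - {p}"
    and c: "c > 0"
    and dec: "\<And>z. \<bar>Re z\<bar> \<ge> X \<Longrightarrow> 0 \<le> Im z \<Longrightarrow> Im z \<le> Y \<Longrightarrow> norm (f z) \<le> B * exp (- (c * \<bar>Re z\<bar>))"
  shows "(LINT x|lborel. f (Complex x 0)) = (LINT x|lborel. f (Complex x Y)) + contour_integral \<gamma> f"
proof -
  define S where "S = {z. a < Im z \<and> Im z < b}"
  have S: "open S" "convex S"
  proof -
    have S_eq: "S = {z. a < Im z} \<inter> {z. Im z < b}" by (auto simp: S_def)
    show "open S" unfolding S_eq by (intro open_Int open_halfspace_Im_gt open_halfspace_Im_lt)
    show "convex S" unfolding S_eq by (intro convex_Int convex_halfspace_Im_gt convex_halfspace_Im_lt)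
  qed
  have contf: "continuous_on (S - {p}) f" using hol holomorphic_on_imp_continuous_on by (auto simp: S_def)
  have integ: "integrable lborel (\<lambda>x. f (Complex x y))" if "0 \<le> y" "y \<le> Y" "y \<noteq> Im p" for y
  proof (rule integrable_exp_decay_line[OF _ c, of _ X B])
    show "continuous_on UNIV (\<lambda>x. f (Complex x y))"
      by (rule continuous_on_compose2[OF contf])
         (use that Y a in \<open>auto simp: S_def Complex_eq intro!: continuous_intros\<close>)
    show "norm (f (Complex x y)) \<le> B * exp (- (c * \<bar>x\<bar>))" if "\<bar>x\<bar> \<ge> X" for x
      using dec[of "Complex x y"] that \<open>0 \<le> y\<close> \<open>y \<le> Y\<close> by simp
  qed
  have i0: "integrable lborel (\<lambda>x. f (Complex x 0))" and iY: "integrable lborel (\<lambda>x. f (Complex x Y))"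
    using integ[of 0] integ[of Y] Y p by auto
  have res: "contour_integral g f = 2 * pi * \<i> * residue f p"
    if "valid_path g" "pathfinish g = pathstart g" "winding_number g p = 1" "path_image g \<subseteq> S - {p}" for g
  proof -
    have "contour_integral g f = 2 * pi * \<i> * (\<Sum>q\<in>{p}. winding_number g q * residue f q)"
    proof (rule Residue_theorem[OF \<open>open S\<close> convex_connected[OF \<open>convex S\<close>]])
      show "\<forall>z. z \<notin> S \<longrightarrow> winding_number g z = 0"
        using winding_number_zero_outside[OF _ \<open>convex S\<close>] that valid_path_imp_path by blast
    qed (use that hol in \<open>auto simp: S_def\<close>)
    then show ?thesis using that by simp
  qed
  define side where "side x = contour_integral (linepath (Complex x 0) (Complex x Y)) f" for x
  have side_bd: "norm (side x) \<le> B * exp (- (c * \<bar>x\<bar>)) * Y" if "\<bar>x\<bar> \<ge> X" "x \<noteq> Re p" for x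
  proof -
    have seg: "Re z = x \<and> 0 \<le> Im z \<and> Im z \<le> Y" if "z \<in> closed_segment (Complex x 0) (Complex x Y)" for z
    proof -
      obtain u where u: "0 \<le> u" "u \<le> 1" "z = (1 - u) *\<^sub>R Complex x 0 + u *\<^sub>R Complex x Y"
        using \<open>z \<in> _\<close> by (auto simp: closed_segment_def)
      have z: "Re z = x" "Im z = u * Y" unfolding u(3) by (simp_all add: algebra_simps)
      have "0 \<le> u * Y" "u * Y \<le> Y" using u(1,2) Y by (simp_all add: mult_left_le_one_le)
      with z show ?thesis by simp
    qed
    have "norm (side x) \<le> B * exp (- (c * \<bar>x\<bar>)) * norm (Complex x Y - Complex x 0)"
      unfolding side_def
    proof (rule contour_integral_bound_linepath)
      show "f contour_integrable_on linepath (Complex x 0) (Complex x Y)"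
      proof (rule contour_integrable_continuous_linepath, rule continuous_on_subset[OF contf], rule subsetI)
        fix z assume "z \<in> closed_segment (Complex x 0) (Complex x Y)"
        from seg[OF this] show "z \<in> S - {p}" using Y a \<open>x \<noteq> Re p\<close> unfolding S_def by auto
      qed
      show "norm (f z) \<le> B * exp (- (c * \<bar>x\<bar>))" if "z \<in> closed_segment (Complex x 0) (Complex x Y)" for z
        using dec[of z] seg[OF that] \<open>\<bar>x\<bar> \<ge> X\<close> by auto
      show "0 \<le> B * exp (- (c * \<bar>x\<bar>))"
        using order_trans[OF norm_ge_zero dec[of "Complex x 0"]] that Y by simp
    qed
    moreover have "norm (Complex x Y - Complex x 0) = Y" using Y by (simp add: cmod_def)
    ultimately show ?thesis by simp
  qed
  have rect: "integral {- x..x} (\<lambda>t. f (Complex t 0)) + side x - integral {- x..x} (\<lambda>t. f (Complex t Y)) - side (- x)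
      = contour_integral \<gamma> f" if x: "x > \<bar>Re p\<bar>" for x
  proof -
    let ?g = "rectpath (Complex (- x) 0) (Complex x Y)"
    have img: "path_image ?g \<subseteq> S - {p}"
      using x Y a p by (subst path_image_rectpath) (auto simp: S_def)
    have "winding_number ?g p = 1"
      by (rule winding_number_rectpath) (use x p in \<open>auto simp: in_box_complex_iff\<close>)
    then have "contour_integral ?g f = contour_integral \<gamma> f"
      using res[of ?g] res[of \<gamma>] \<gamma> img by (simp add: S_def)
    moreover have "contour_integral ?g f = contour_integral (linepath (Complex (- x) 0) (Complex x 0)) f
        + contour_integral (linepath (Complex x 0) (Complex x Y)) f
        + contour_integral (linepath (Complex x Y) (Complex (- x) Y)) f
        + contour_integral (linepath (Complex (- x) Y) (Complex (- x) 0)) f"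
    proof -
      have "f contour_integrable_on ?g"
        by (rule contour_integrable_holomorphic_simple[where S = "S - {p}"])
           (use hol S img in \<open>auto simp: S_def open_delete\<close>)
      then show ?thesis
        by (simp add: rectpath_def Let_def)
    qed
    moreover have "contour_integral (linepath (Complex x Y) (Complex (- x) Y)) f =
        - contour_integral (linepath (Complex (- x) Y) (Complex x Y)) f"
      using contour_integral_reversepath[of "linepath (Complex (- x) Y) (Complex x Y)" f] by simp
    moreover have "contour_integral (linepath (Complex (- x) Y) (Complex (- x) 0)) f = - side (- x)"
      using contour_integral_reversepath[of "linepath (Complex (- x) 0) (Complex (- x) Y)" f]
      by (simp add: side_def)
    ultimately show ?thesis
      using x by (simp add: contour_integral_linepath_same_Im side_def)
  qed
  have side0: "((\<lambda>j. side (s * real j)) \<longlonglongrightarrow> 0)" if s: "\<bar>s\<bar> = 1" for s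
  proof (rule Lim_null_comparison)
    show "\<forall>\<^sub>F j in sequentially. norm (side (s * real j)) \<le> B * exp (- (c * real j)) * Y"
    proof -
      have "\<forall>\<^sub>F j in sequentially. j \<ge> nat \<lceil>max X (\<bar>Re p\<bar> + 1)\<rceil>" by (rule eventually_ge_at_top)
      then show ?thesis
      proof eventually_elim
        case (elim j)
        then have j: "real j \<ge> max X (\<bar>Re p\<bar> + 1)" by linarith
        have "\<bar>s * real j\<bar> = real j" using s by (simp add: abs_mult)
        moreover from this have "s * real j \<noteq> Re p" using j by auto
        ultimately show ?case using j side_bd[of "s * real j"] by simp
      qed
    qed
    have "(\<lambda>j. exp (- (c * real j))) \<longlonglongrightarrow> 0"
      using c by real_asymp
    then show "(\<lambda>j. B * exp (- (c * real j)) * Y) \<longlonglongrightarrow> 0"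
      by (intro tendsto_mult_left_zero tendsto_mult_right_zero)
  qed
  have "(\<lambda>j. integral {- real j..real j} (\<lambda>t. f (Complex t 0)) + side (1 * real j)
       - integral {- real j..real j} (\<lambda>t. f (Complex t Y)) - side ((- 1) * real j))
      \<longlonglongrightarrow> (LINT x|lborel. f (Complex x 0)) + 0 - (LINT x|lborel. f (Complex x Y)) - 0"
    by (rule tendsto_diff[OF tendsto_diff[OF tendsto_add[OF integral_symmetric_interval_tendsto[OF i0] side0]
          integral_symmetric_interval_tendsto[OF iY]] side0]) auto
  moreover have "\<forall>\<^sub>F j in sequentially. integral {- real j..real j} (\<lambda>t. f (Complex t 0)) + side (1 * real j)
       - integral {- real j..real j} (\<lambda>t. f (Complex t Y)) - side ((- 1) * real j) = contour_integral \<gamma> f"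
  proof -
    have "\<forall>\<^sub>F j in sequentially. j \<ge> nat \<lceil>\<bar>Re p\<bar> + 1\<rceil>" by (rule eventually_ge_at_top)
    then show ?thesis
    proof eventually_elim
      case (elim j)
      then have "real j > \<bar>Re p\<bar>" by linarith
      from rect[OF this] show ?case by simp
    qed
  qed
  ultimately have "(\<lambda>j. contour_integral \<gamma> f) \<longlonglongrightarrow> (LINT x|lborel. f (Complex x 0)) + 0 - (LINT x|lborel. f (Complex x Y)) - 0"
    by (rule Lim_transform_eventually)
  then have "contour_integral \<gamma> f = (LINT x|lborel. f (Complex x 0)) + 0 - (LINT x|lborel. f (Complex x Y)) - 0"
    by (rule LIMSEQ_unique[OF tendsto_const])
  then show "(LINT x|lborel. f (Complex x 0)) = (LINT x|lborel. f (Complex x Y)) + contour_integral \<gamma> f"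
    by simp
qed

section \<open>Shifting the contour past the first singularity\<close>

definition rt :: "real \<Rightarrow> complex \<Rightarrow> complex" where
  "rt v z = csqrt (of_real v + (of_real pi - z)\<^sup>2)"

lemma Re_square_pi_minus:
  assumes "norm z \<le> 1"
  shows "Re ((of_real pi - z)\<^sup>2) \<ge> 3"
proof -
  have x: "\<bar>Re z\<bar> \<le> 1" and y: "\<bar>Im z\<bar> \<le> 1"
    using assms abs_Re_le_cmod[of z] abs_Im_le_cmod[of z] by linarith+
  have "(pi - Re z)\<^sup>2 \<ge> 2\<^sup>2" using x pi_gt3 by (intro power_mono) auto
  moreover have "(Im z)\<^sup>2 \<le> 1\<^sup>2" using y abs_le_square_iff[of "Im z" 1] by simp
  ultimately show ?thesis unfolding Re_power2 by simp
qed

text \<open>For |z| <= 1 the real part of (pi - z)^2 is at least 2^2 - 1^2 = 3. This keeps the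
  radicand off the cut of \<open>csqrt\<close> for every \<open>v >= 0\<close>, so that
  \<open>rt v\<close> is holomorphic near the closed unit disc.\<close>

lemma
  assumes v: "v \<ge> 0" and z: "norm z \<le> 1"
  shows Re_rt_arg: "Re (of_real v + (of_real pi - z)\<^sup>2) \<ge> 3"
    and rt_arg: "of_real v + (of_real pi - z)\<^sup>2 \<notin> \<real>\<^sub>\<le>\<^sub>0"
    and rt_square: "(rt v z)\<^sup>2 = of_real v + (of_real pi - z)\<^sup>2"
    and Re_rt: "Re (rt v z) \<ge> 3 / 2"
    and Im_rt: "\<bar>Im (rt v z)\<bar> \<le> Re (rt v z)"
    and norm_rt: "(norm (rt v z))\<^sup>2 \<le> v + (norm (of_real pi - z))\<^sup>2"
proof -
  show 1: "Re (of_real v + (of_real pi - z)\<^sup>2) \<ge> 3"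
    using Re_square_pi_minus[OF z] v by simp
  then show "of_real v + (of_real pi - z)\<^sup>2 \<notin> \<real>\<^sub>\<le>\<^sub>0"
    by (auto simp: complex_nonpos_Reals_iff)
  show 2: "(rt v z)\<^sup>2 = of_real v + (of_real pi - z)\<^sup>2" by (simp add: rt_def)
  have pos: "Re (rt v z) \<ge> 0" unfolding rt_def
    using csqrt_principal[of "of_real v + (of_real pi - z)\<^sup>2"] by (auto simp del: csqrt.sel)
  have 3: "(Re (rt v z))\<^sup>2 - (Im (rt v z))\<^sup>2 \<ge> 3" using 1 unfolding 2[symmetric] Re_power2 .
  then have "(Im (rt v z))\<^sup>2 \<le> (Re (rt v z))\<^sup>2" by simp
  then show "\<bar>Im (rt v z)\<bar> \<le> Re (rt v z)" using pos by (simp add: abs_le_square_iff[symmetric])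
  have "3 \<le> (Re (rt v z))\<^sup>2" using 3 zero_le_power2[of "Im (rt v z)"] by linarith
  then have "(3 / 2)\<^sup>2 \<le> (Re (rt v z))\<^sup>2" by (simp add: power_divide)
  then show "Re (rt v z) \<ge> 3 / 2" using pos by (rule power2_le_imp_le)
  have "(norm (rt v z))\<^sup>2 = norm (of_real v + (of_real pi - z)\<^sup>2)" unfolding 2[symmetric] norm_power ..
  also have "\<dots> \<le> norm (complex_of_real v) + norm ((of_real pi - z)\<^sup>2)" by (rule norm_triangle_ineq)
  also have "\<dots> = v + (norm (of_real pi - z))\<^sup>2" using v by (simp add: norm_power)
  finally show "(norm (rt v z))\<^sup>2 \<le> v + (norm (of_real pi - z))\<^sup>2" .
qed

lemma has_field_derivative_rt:
  assumes "v \<ge> 0" "norm z \<le> 1"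
  shows "(rt v has_field_derivative - ((of_real pi - z) / rt v z)) (at z)"
  unfolding rt_def[abs_def]
  by (rule derivative_eq_intros refl rt_arg assms)+ (simp add: divide_simps; simp add: algebra_simps)

text \<open>
  The integrand as a function of the complexified coordinate \<open>l\<close> along \<open>u\<close>, where \<open>T = \<bar>t\<bar>\<close> and \<open>v\<close> is the
  squared length of the remaining coordinates; \<open>N\<close> stands for \<open>n + k_1\<close>.
\<close>

definition kerG :: "real \<Rightarrow> real \<Rightarrow> nat \<Rightarrow> nat \<Rightarrow> nat \<Rightarrow> real \<Rightarrow> complex \<Rightarrow> complex" where
  "kerG T R N k j v l = exp (\<i> * of_real T * l) * kerF R N k (l\<^sup>2 + of_real v) * l ^ j"

text \<open>The zeros are the points i q and -i q with q = sqrt((j pi)^2 + v), j >= 1. The lower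
  bound on Im l removes -i q since q >= j pi >= 1, and the upper bound removes j >= 2.\<close>

lemma shc_eq_0_strip:
  assumes v: "v \<ge> 0" and l: "- 1 < Im l" "Im l < sqrt (4 * pi\<^sup>2 + v)" and 0: "shc (l\<^sup>2 + of_real v) = 0"
  shows "l = \<i> * of_real (sqrt (pi\<^sup>2 + v))"
proof -
  obtain j :: nat where j: "j \<ge> 1" "l\<^sup>2 + of_real v = - of_real ((real j * pi)\<^sup>2)"
    using shc_eq_0D[OF 0] .
  define q where "q = sqrt ((real j * pi)\<^sup>2 + v)"
  have q: "q\<^sup>2 = (real j * pi)\<^sup>2 + v" using v by (simp add: q_def)
  have qpi: "q \<ge> real j * pi" unfolding q_def using v j by (intro real_le_rsqrt) auto
  have "l\<^sup>2 = - of_real ((real j * pi)\<^sup>2) - of_real v" using j(2) by (metis add_diff_cancel_right')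
  then have "l\<^sup>2 = - of_real (q\<^sup>2)" unfolding q by simp
  also have "\<dots> = (\<i> * of_real q)\<^sup>2" by (simp add: power_mult_distrib)
  finally have "l = \<i> * of_real q \<or> l = - (\<i> * of_real q)" by (simp add: power2_eq_iff)
  moreover have "real j * pi \<ge> 1" using j pi_gt3 mult_mono[of 1 "real j" 1 pi] by simp
  ultimately have lq: "l = \<i> * of_real q" using l(1) qpi by auto
  have "j = 1"
  proof (rule ccontr)
    assume "j \<noteq> 1"
    then have "real j * pi \<ge> 2 * pi" using j by simp
    then have "(real j * pi)\<^sup>2 \<ge> (2 * pi)\<^sup>2" by (intro power_mono) auto
    then have "q \<ge> sqrt (4 * pi\<^sup>2 + v)" unfolding q_def by (simp add: power_mult_distrib)
    then show False using l(2) lq by simp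
  qed
  then show ?thesis using lq by (simp add: q_def)
qed

text \<open>The full circle is parametrised over [-pi, pi] so that the saddle, at angle 0, is an
  interior point of the parameter interval.\<close>

lemma winding_number_part_circlepath_full:
  assumes "h > 0"
  shows "winding_number (part_circlepath 0 h (- pi) pi) 0 = 1"
proof -
  have "0 \<notin> path_image (part_circlepath 0 h (- pi) pi)"
    using path_image_part_circlepath_subset'[of h 0 "- pi" pi] assms by auto
  then have "winding_number (part_circlepath 0 h (- pi) pi) 0 =
      1 / (2 * pi * \<i>) * contour_integral (part_circlepath 0 h (- pi) pi) (\<lambda>w. 1 / (w - 0))"
    by (intro winding_number_valid_path) auto
  also have "contour_integral (part_circlepath 0 h (- pi) pi) (\<lambda>w. 1 / (w - 0)) = integral {-pi..pi} (\<lambda>t. \<i>)"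
    using assms by (subst contour_integral_part_circlepath_eq) (auto intro!: integral_cong simp: field_simps)
  also have "\<dots> = 2 * pi * \<i>" by (simp add: scaleR_conv_of_real)
  finally show ?thesis by simp
qed

text \<open>The radius \<open>h\<close> is arbitrary in (0, 1) here; only later is it tied to the
  saddle. The loop is the image of the circle under \<open>i * rt v\<close>, which sends 0 to the
  singularity.\<close>

lemma kerG_shift:
  fixes k j :: nat and h :: real
  assumes n: "n \<ge> 1" and T: "T \<ge> 0" and R: "R \<ge> 0" and v: "v \<ge> 0" and h: "0 < h" "h < 1"
  defines "G \<equiv> kerG T R (n + k) k j v"
  defines "Y \<equiv> sqrt ((3 * pi / 2)\<^sup>2 + v)"
  shows "(LINT x|lborel. G (Complex x 0)) = (LINT x|lborel. G (Complex x Y)) +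
       integral {-pi..pi} (\<lambda>t. G (\<i> * rt v (h * cis t)) * (of_real pi - h * cis t) / rt v (h * cis t) * (h * cis t))"
proof -
  define b where "b = sqrt (4 * pi\<^sup>2 + v)"
  define p where "p = \<i> * of_real (sqrt (pi\<^sup>2 + v))"
  define S where "S = {z. - 1 < Im z \<and> Im z < b}"
  define \<psi> where "\<psi> z = \<i> * rt v z" for z
  let ?c = "part_circlepath 0 h (- pi) pi"
  have Y: "Y > 0" unfolding Y_def using v by (simp add: add_pos_nonneg)
  have Yb: "Y < b" unfolding Y_def b_def by (simp add: power_divide power_mult_distrib)
  have p: "0 < Im p" "Im p < Y"
  proof -
    show "0 < Im p" using v by (simp add: p_def add_pos_nonneg)
    have "pi\<^sup>2 < (3 * pi / 2)\<^sup>2" by (simp add: power_divide power_mult_distrib)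
    then show "Im p < Y" unfolding p_def Y_def by simp
  qed
  have pb: "Im p < b" using p Yb by simp
  have holG: "G holomorphic_on S - {p}"
  proof -
    have "kerF R (n + k) k holomorphic_on (\<lambda>l. l\<^sup>2 + of_real v) ` (S - {p})"
      by (rule kerF_holomorphic) (use shc_eq_0_strip[OF v] in \<open>auto simp: S_def b_def p_def\<close>)
    then have "(kerF R (n + k) k \<circ> (\<lambda>l. l\<^sup>2 + of_real v)) holomorphic_on (S - {p})"
      by (intro holomorphic_on_compose holomorphic_intros)
    then show ?thesis unfolding G_def kerG_def[abs_def] o_def by (intro holomorphic_intros)
  qed
  have psi_der: "(\<psi> has_field_derivative - \<i> * (of_real pi - z) / rt v z) (at z)" if "norm z \<le> 1" for z
    unfolding \<psi>_def by (rule derivative_eq_intros has_field_derivative_rt v that refl)+ simp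
  have psi_an: "\<psi> analytic_on ball 0 1"
    by (subst analytic_on_open) (auto simp: holomorphic_on_open intro!: exI psi_der)
  have psi_sq: "(\<psi> z)\<^sup>2 = - (of_real v + (of_real pi - z)\<^sup>2)" if "norm z \<le> 1" for z
    using rt_square[OF v that] by (simp add: \<psi>_def power_mult_distrib)
  have Im_psi: "Im (\<psi> z) > 0" if "norm z \<le> 1" for z
    using Re_rt[OF v that] by (simp add: \<psi>_def)
  have p_sq: "p\<^sup>2 = - (of_real v + (of_real pi)\<^sup>2)"
    using v by (simp add: p_def power_mult_distrib flip: of_real_power)
  have psi0: "\<psi> 0 = p"
  proof -
    have "(\<psi> 0)\<^sup>2 = p\<^sup>2" using psi_sq[of 0] p_sq by simp
    then have "\<psi> 0 = p \<or> \<psi> 0 = - p" by (simp add: power2_eq_iff)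
    then show ?thesis using Im_psi[of 0] p by auto
  qed
  \<comment> \<open>This factorisation shows that \<open>\<psi> z = p\<close> only at z = 0 in the
    unit disc, and it isolates the simple zero of \<open>\<psi> z - p\<close> there.\<close>
  have psi_p: "(\<psi> z - p) * (\<psi> z + p) = z * (2 * of_real pi - z)" if "norm z \<le> 1" for z
  proof -
    have "(\<psi> z - p) * (\<psi> z + p) = (\<psi> z)\<^sup>2 - p\<^sup>2" by (simp add: power2_eq_square algebra_simps)
    then show ?thesis unfolding psi_sq[OF that] p_sq by (simp add: power2_eq_square algebra_simps)
  qed
  have two_pi: "2 * of_real pi - z \<noteq> 0" if "norm z \<le> 1" for z :: complex
  proof
    assume "2 * of_real pi - z = 0"
    then have "z = of_real (2 * pi)" by simp
    then have "norm z = 2 * pi" by (simp only: norm_of_real) simp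
    then show False using that pi_gt3 by linarith
  qed
  have cimg: "path_image ?c \<subseteq> sphere 0 h"
    using h by (intro path_image_part_circlepath_subset') auto
  have vp: "valid_path (\<psi> \<circ> ?c)"
    by (rule valid_path_compose_analytic[OF _ psi_an]) (use cimg h in auto)
  have closed: "pathfinish (\<psi> \<circ> ?c) = pathstart (\<psi> \<circ> ?c)"
    by (simp add: pathfinish_compose pathstart_compose exp_minus flip: cis_conv_exp)
  have img: "path_image (\<psi> \<circ> ?c) \<subseteq> S - {p}"
  proof -
    have "\<psi> z \<in> S - {p}" if z: "norm z = h" for z
    proof -
      have z1: "norm z \<le> 1" using z h by simp
      have "(norm (rt v z))\<^sup>2 < b\<^sup>2"
      proof -
        have "norm (of_real pi - z) < 2 * pi"
          using norm_triangle_ineq4[of "of_real pi" z] z1 pi_gt3 by simp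
        then have "(norm (of_real pi - z))\<^sup>2 < (2 * pi)\<^sup>2" by (intro power_strict_mono) auto
        moreover have "b\<^sup>2 = (2 * pi)\<^sup>2 + v" using v by (simp add: b_def power_mult_distrib)
        ultimately show ?thesis using norm_rt[OF v z1] by linarith
      qed
      moreover have "b \<ge> 0" using v by (simp add: b_def)
      ultimately have "norm (rt v z) < b" by (rule power2_less_imp_less)
      moreover have "Im (\<psi> z) = Re (rt v z)" by (simp add: \<psi>_def)
      ultimately have "Im (\<psi> z) < b" using abs_Re_le_cmod[of "rt v z"] by linarith
      moreover have "\<psi> z \<noteq> p" using psi_p[OF z1] two_pi[OF z1] z h by auto
      ultimately show ?thesis using Im_psi[OF z1] by (simp add: S_def)
    qed
    then show ?thesis using cimg unfolding path_image_compose by (auto simp: subset_iff)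
  qed
  have wind: "winding_number (\<psi> \<circ> ?c) p = 1"
  proof -
    \<comment> \<open>Chosen so that the logarithmic derivative
      \<open>\<psi>' / (\<psi> - p)\<close> equals q(z) / z. As q is holomorphic with q(0) = 1,
      Cauchy's formula yields winding number 1.\<close>
    define q where "q z = (of_real pi - z) * (\<psi> z + p) / (\<psi> z * (2 * of_real pi - z))" for z
    have psi_nz: "\<psi> z \<noteq> 0" "\<psi> z + p \<noteq> 0" if "norm z \<le> 1" for z
      using Im_psi[OF that] p by (auto simp: complex_eq_iff)
    have psi_hol: "\<psi> holomorphic_on ball 0 1" using psi_an by (rule analytic_imp_holomorphic)
    have "q holomorphic_on ball 0 1" unfolding q_def[abs_def]
      by (intro holomorphic_intros psi_hol) (use psi_nz two_pi in auto)
    then have "((\<lambda>z. q z / (z - 0)) has_contour_integral (2 * pi * \<i> * winding_number ?c 0 * q 0)) ?c"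
      by (intro Cauchy_integral_formula_convex_simple[where S = "ball 0 1"]) (use cimg h in \<open>auto simp: exp_minus simp flip: cis_conv_exp\<close>)
    moreover have "q 0 = 1" using psi_nz[of 0] by (simp add: q_def psi0 field_simps)
    ultimately have q: "contour_integral ?c (\<lambda>z. q z / (z - 0)) = 2 * pi * \<i>"
      using winding_number_part_circlepath_full[OF h(1)] by (simp add: contour_integral_unique)
    have "winding_number (\<psi> \<circ> ?c) p = 1 / (2 * pi * \<i>) * contour_integral (\<psi> \<circ> ?c) (\<lambda>w. 1 / (w - p))"
      by (rule winding_number_valid_path[OF vp]) (use img in auto)
    also have "contour_integral (\<psi> \<circ> ?c) (\<lambda>w. 1 / (w - p)) = contour_integral ?c (\<lambda>z. deriv \<psi> z * (1 / (\<psi> z - p)))"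
      by (rule contour_integral_comp_analyticW[OF psi_an]) (use cimg h in auto)
    also have "\<dots> = contour_integral ?c (\<lambda>z. q z / (z - 0))"
    proof (rule contour_integral_cong[OF refl])
      fix z assume "z \<in> path_image ?c"
      then have z: "norm z = h" using cimg by auto
      then have z1: "norm z \<le> 1" "z \<noteq> 0" using h by auto
      have e1: "deriv \<psi> z = (of_real pi - z) / \<psi> z"
        unfolding DERIV_imp_deriv[OF psi_der[OF z1(1)]]
        using psi_nz[OF z1(1)] by (simp add: \<psi>_def divide_simps) (simp add: algebra_simps)
      have e2: "\<psi> z - p = z * (2 * of_real pi - z) / (\<psi> z + p)"
        using psi_p[OF z1(1)] psi_nz[OF z1(1)] by (simp add: field_simps)
      show "deriv \<psi> z * (1 / (\<psi> z - p)) = q z / (z - 0)"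
        unfolding e1 e2 q_def using psi_nz[OF z1(1)] two_pi[OF z1(1)] z1(2) by (simp add: divide_simps)
    qed
    also have "1 / (2 * pi * \<i>) * \<dots> = 1" unfolding q by simp
    finally show ?thesis .
  qed
  obtain C where C: "C > 0" "\<And>R w r. r \<ge> 10 \<Longrightarrow> Re w \<ge> r\<^sup>2 - (3 * pi / 2)\<^sup>2 \<Longrightarrow> R \<ge> 0 \<Longrightarrow>
     norm (kerF R (n + k) k w) \<le> C * exp (- r / 2)"
    using norm_kerF_le_far[OF n] by metis
  \<comment> \<open>Half of the decay exp(-|Re z| / 2) is spent on z^j, using |z| <= |Re z| + Y;
    this leaves the rate 1/4 and the factor exp(Y / 4).\<close>
  define B where "B = C * (real (Suc j) / (1/4)) ^ j * exp (Y / 4)"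
  have dec: "norm (G z) \<le> B * exp (- (1/4 * \<bar>Re z\<bar>))" if z: "\<bar>Re z\<bar> \<ge> 10" "0 \<le> Im z" "Im z \<le> Y" for z
  proof -
    have "(Im z)\<^sup>2 \<le> Y\<^sup>2" using z by (intro power_mono) auto
    then have "(Im z)\<^sup>2 \<le> (3 * pi / 2)\<^sup>2 + v" unfolding Y_def using v by simp
    then have "Re (z\<^sup>2 + of_real v) \<ge> \<bar>Re z\<bar>\<^sup>2 - (3 * pi / 2)\<^sup>2" by (simp add: Re_power2)
    then have 1: "norm (kerF R (n + k) k (z\<^sup>2 + of_real v)) \<le> C * exp (- \<bar>Re z\<bar> / 2)" using z R by (intro C)
    have 2: "norm (exp (\<i> * of_real T * z)) \<le> 1" using T z by (simp add: norm_exp_eq_Re)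
    have "norm z \<le> \<bar>Re z\<bar> + Y" using cmod_le[of z] z by linarith
    then have "norm (z ^ j) \<le> (\<bar>Re z\<bar> + Y) ^ j" by (simp add: norm_power power_mono)
    also have "\<dots> \<le> (real (Suc j) / (1/4)) ^ j * exp (1/4 * (\<bar>Re z\<bar> + Y))"
      using Y by (intro exp_ge_power) auto
    finally have "norm (G z) \<le> (1 * (C * exp (- \<bar>Re z\<bar> / 2))) * ((real (Suc j) / (1/4)) ^ j * exp (1/4 * (\<bar>Re z\<bar> + Y)))"
      unfolding G_def kerG_def by (intro norm_mult_mono 1 2)
    also have "\<dots> = C * (real (Suc j) / (1/4)) ^ j * (exp (- \<bar>Re z\<bar> / 2) * exp (1/4 * (\<bar>Re z\<bar> + Y)))" by simp
    also have "exp (- \<bar>Re z\<bar> / 2) * exp (1/4 * (\<bar>Re z\<bar> + Y)) = exp (Y / 4) * exp (- (1/4 * \<bar>Re z\<bar>))"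
      unfolding exp_add[symmetric] by (simp add: field_simps)
    finally show ?thesis by (simp add: B_def mult_ac)
  qed
  note shift = contour_shift_simple_singularity[of Y b "-1" p G "\<psi> \<circ> ?c" "1/4" 10 B,
      OF Y Yb _ p holG[unfolded S_def] vp closed wind img[unfolded S_def] _ dec]
  have "contour_integral (\<psi> \<circ> ?c) G = contour_integral ?c (\<lambda>z. deriv \<psi> z * G (\<psi> z))"
    by (rule contour_integral_comp_analyticW[OF psi_an]) (use cimg h in auto)
  also have "\<dots> = integral {-pi..pi} (\<lambda>t. deriv \<psi> (0 + h * cis t) * G (\<psi> (0 + h * cis t)) * h * \<i> * cis t)"
    by (rule contour_integral_part_circlepath_eq) simp
  \<comment> \<open>The factor -i in the derivative of \<open>\<psi>\<close> cancels the i of dz = i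
    h cis t dt.\<close>
  also have "\<dots> = integral {-pi..pi} (\<lambda>t. G (\<i> * rt v (h * cis t)) * (of_real pi - h * cis t) / rt v (h * cis t) * (h * cis t))"
  proof (rule integral_cong)
    fix t :: real
    have "norm (h * cis t) \<le> 1" using h by (simp add: norm_mult)
    from DERIV_imp_deriv[OF psi_der[OF this]]
    show "deriv \<psi> (0 + h * cis t) * G (\<psi> (0 + h * cis t)) * h * \<i> * cis t =
      G (\<i> * rt v (h * cis t)) * (of_real pi - h * cis t) / rt v (h * cis t) * (h * cis t)"
      by (simp add: \<psi>_def algebra_simps)
  qed
  finally show "(LINT x|lborel. G (Complex x 0)) = (LINT x|lborel. G (Complex x Y)) +
       integral {-pi..pi} (\<lambda>t. G (\<i> * rt v (h * cis t)) * (of_real pi - h * cis t) / rt v (h * cis t) * (h * cis t))"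
    using shift by simp
qed

section \<open>A uniform Laplace estimate on the circle\<close>

lemma norm_exp_diff_le:
  fixes a b :: complex
  assumes "Re a \<le> m" "Re b \<le> m"
  shows "norm (exp a - exp b) \<le> exp m * norm (a - b)"
proof (rule field_differentiable_bound[of "{z. Re z \<le> m}"])
  show "convex {z. Re z \<le> m}" by (rule convex_halfspace_Re_le)
  show "(exp has_field_derivative exp z) (at z within {z. Re z \<le> m})" for z :: complex
    by (auto intro!: derivative_eq_intros)
qed (use assms in auto)

lemma abs_exp_diff_le:
  fixes a b :: real
  assumes "a \<le> m" "b \<le> m"
  shows "\<bar>exp a - exp b\<bar> \<le> exp m * \<bar>a - b\<bar>"
proof -
  have "norm (exp a - exp b) \<le> exp m * norm (a - b)"
  proof (rule field_differentiable_bound[of "{..m}"])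
    show "(exp has_field_derivative exp z) (at z within {..m})" for z :: real
      by (auto intro!: derivative_eq_intros)
  qed (use assms in auto)
  then show ?thesis by simp
qed

lemma cos_quartic_bound: "\<bar>1 - cos t - t\<^sup>2 / 2\<bar> \<le> t ^ 4 / 24" for t :: real
proof -
  obtain s where s: "cos t = (\<Sum>m<4. cos_coeff m * t ^ m) + (cos (s + 1/2 * real 4 * pi) / fact 4) * t ^ 4"
    using Maclaurin_cos_expansion[of t 4] by auto
  have "(\<Sum>m<4. cos_coeff m * t ^ m) = 1 - t\<^sup>2 / 2"
  proof -
    have "{..<4} = {0, 1, 2, 3::nat}" by auto
    then show ?thesis by (simp add: cos_coeff_def)
  qed
  then have "1 - cos t - t\<^sup>2 / 2 = - (cos (s + 1/2 * real 4 * pi) / 24 * t ^ 4)"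
    using s by (simp add: fact_numeral)
  then have "\<bar>1 - cos t - t\<^sup>2 / 2\<bar> = \<bar>cos (s + 1/2 * real 4 * pi)\<bar> / 24 * t ^ 4"
    by (simp only: abs_minus_cancel abs_mult abs_divide) simp
  also have "\<dots> \<le> 1 / 24 * t ^ 4"
    by (intro mult_right_mono divide_right_mono abs_cos_le_one) auto
  finally show ?thesis by simp
qed

lemma cos_quadratic_bound: "\<bar>cos t - 1\<bar> \<le> t\<^sup>2 / 2" for t :: real
proof -
  have "\<bar>sin (t / 2)\<bar> \<le> \<bar>t / 2\<bar>" by (rule abs_sin_x_le_abs_x)
  then have "(sin (t / 2))\<^sup>2 \<le> (t / 2)\<^sup>2" by (rule abs_le_square_iff[THEN iffD1])
  then show ?thesis using cos_double_sin[of "t / 2"] by (simp add: power_divide)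
qed

lemma pi_squared_le: "pi\<^sup>2 \<le> 10"
proof -
  have "pi\<^sup>2 \<le> 3.15\<^sup>2" using pi_approx by (intro power_mono) auto
  then show ?thesis by (simp add: power2_eq_square)
qed

text \<open>By pi^2 <= 10 the quartic term is at most 10 t^2 / 24, and 1/2 - 10/24 = 1/12.\<close>

lemma one_minus_cos_ge:
  assumes "\<bar>t\<bar> \<le> pi"
  shows "1 - cos t \<ge> t\<^sup>2 / 12"
proof -
  have "t\<^sup>2 \<le> pi\<^sup>2" using assms by (metis abs_le_square_iff abs_of_nonneg pi_ge_zero)
  then have "t\<^sup>2 \<le> 10" using pi_squared_le by linarith
  then have "t\<^sup>2 * t\<^sup>2 \<le> t\<^sup>2 * 10" by (intro mult_left_mono) auto
  moreover have "t ^ 4 = t\<^sup>2 * t\<^sup>2" by (simp add: power2_eq_square power4_eq_xxxx)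
  moreover have "1 - cos t - t\<^sup>2 / 2 \<ge> - (t ^ 4 / 24)" using cos_quartic_bound[of t] by linarith
  ultimately show ?thesis by linarith
qed

lemma odd_integral_symmetric_eq_0:
  fixes f :: "real \<Rightarrow> 'a::{banach,second_countable_topology}"
  assumes "\<And>x. f (- x) = - f x"
  shows "(LINT x|lborel. f x) = 0"
proof -
  have "(LINT x|lborel. f x) = (LINT x|lborel. f (- x))"
    using lborel_integral_real_affine[of "-1" f 0] by simp
  also have "\<dots> = - (LINT x|lborel. f x)" using assms by simp
  finally have "(LINT x|lborel. f x) + (LINT x|lborel. f x) = 0" by (simp only: eq_neg_iff_add_eq_0)
  then have "2 *\<^sub>R (LINT x|lborel. f x) = 0" by (simp only: scaleR_2)
  then show ?thesis by simp
qed

lemma exp_neg_mult_le: "x \<ge> 0 \<Longrightarrow> c > 0 \<Longrightarrow> x \<le> (1 / c) * exp (c * x)" for x c :: real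
proof -
  assume "x \<ge> 0" "c > 0"
  moreover have "c * x \<le> exp (c * x)" using exp_ge_add_one_self[of "c * x"] by linarith
  ultimately show ?thesis by (simp add: field_simps)
qed

text \<open>For \<open>w = 0\<close> and \<open>F = 1\<close> the integral is 2 pi exp(-M) I_p(M)
  with a modified Bessel function. Since 1 - cos t >= t^2 / 12 and \<open>\<eta> <= 1/24\<close>,
  the perturbation \<open>w\<close> uses at most half of the decay exp(-M t^2 / 12); half of what
  remains absorbs powers of M t^2, which leaves the majorant exp(-M t^2 / 48).\<close>

lemma laplace_circle:
  fixes F w :: "real \<Rightarrow> complex" and F0 :: complex
  assumes M: "M > 0" and \<eta>: "0 \<le> \<eta>" "\<eta> \<le> 1 / 24" and \<delta>: "0 \<le> \<delta>"
    and w: "\<And>t. \<bar>t\<bar> \<le> pi \<Longrightarrow> norm (w t) \<le> \<eta> * M * t\<^sup>2"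
    and F: "\<And>t. \<bar>t\<bar> \<le> pi \<Longrightarrow> norm (F t - F0) \<le> \<delta> * B" "\<And>t. \<bar>t\<bar> \<le> pi \<Longrightarrow> norm (F t) \<le> B"
      "norm F0 \<le> B"
    and cont: "continuous_on {-pi..pi} w" "continuous_on {-pi..pi} F"
  shows "norm (integral {-pi..pi} (\<lambda>t. of_real (exp (- (M * (1 - cos t)))) * exp (w t) * F t * cis (- (real p * t)))
      - F0 * of_real (sqrt (2 * pi / M)))
    \<le> (48 * \<eta> + \<delta> + (24 * (real p)\<^sup>2 + 97) / M) * B * sqrt (48 * pi / M)"
proof -
  define X where "X t = of_real (exp (- (M * (1 - cos t)))) * exp (w t) * F t * cis (- (real p * t))" for t
  \<comment> \<open>The sine part of \<open>cis\<close> is only of first order in t and would cost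
    M^(-1/2). Its leading part is odd, so it can be cancelled by adding \<open>S\<close>, whose
    integral is 0; then cos(p t) - 1 is quadratic in t and costs 1/M.\<close>
  define S where "S t = indicator {-pi..pi} t *\<^sub>R (of_real (exp (- (M * (1 - cos t))) * sin (real p * t)) * (\<i> * F0))" for t
  define Q where "Q t = F0 * of_real (exp (- (M / 2 * t\<^sup>2)))" for t
  \<comment> \<open>In 97 = 96 + 1, the 96 comes from replacing 1 - cos t by t^2 / 2, and the 1 pays
    for the Gaussian tail outside [-pi, pi].\<close>
  define K where "K = (48 * \<eta> + \<delta> + (24 * (real p)\<^sup>2 + 97) / M) * B"
  have B: "B \<ge> 0" using F(3) norm_ge_zero order_trans by blast
  have set_int: "set_integrable lborel {-pi..pi} f" if "continuous_on {-pi..pi} f" for f :: "real \<Rightarrow> complex"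
    by (rule borel_integrable_atLeastAtMost') (rule that)
  have Xc: "continuous_on {-pi..pi} X" unfolding X_def by (intro continuous_intros cont)
  have iX: "integrable lborel (\<lambda>t. indicator {-pi..pi} t *\<^sub>R X t)"
    using set_int[OF Xc] unfolding set_integrable_def .
  have iS: "integrable lborel S"
    unfolding S_def set_integrable_def[symmetric] by (intro set_int continuous_intros)
  have S0: "(LINT t|lborel. S t) = 0"
  proof (rule odd_integral_symmetric_eq_0)
    fix t :: real
    have "indicator {-pi..pi} (- t) = (indicator {-pi..pi} t :: real)" by (auto simp: indicator_def)
    then show "S (- t) = - S t" unfolding S_def by simp
  qed
  have gauss: "has_bochner_integral lborel (\<lambda>t. exp (- (M / 2 * t\<^sup>2))) (sqrt (pi / (M / 2)))"
    using M by (intro has_bochner_integral_gaussian) auto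
  have iQ: "integrable lborel Q"
    using gauss unfolding Q_def has_bochner_integral_iff by (intro integrable_mult_right integrable_of_real) auto
  have Q: "(LINT t|lborel. Q t) = F0 * of_real (sqrt (2 * pi / M))"
    using gauss unfolding Q_def has_bochner_integral_iff by (simp add: field_simps)
  have gauss': "has_bochner_integral lborel (\<lambda>t. exp (- (M / 48 * t\<^sup>2))) (sqrt (pi / (M / 48)))"
    using M by (intro has_bochner_integral_gaussian) auto
  have pt: "norm (indicator {-pi..pi} t *\<^sub>R X t + S t - Q t) \<le> K * exp (- (M / 48 * t\<^sup>2))" for t
  proof (cases "\<bar>t\<bar> \<le> pi")
    case False
    then have "t\<^sup>2 \<ge> 3\<^sup>2" using pi_gt3 abs_le_square_iff[of 3 t] by auto
    then have "M * t\<^sup>2 \<ge> M * 9" using M by (intro mult_left_mono) auto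
    have "norm (Q t) = norm F0 * exp (- (M / 2 * t\<^sup>2))"
      by (simp add: Q_def norm_mult del: of_real_exp)
    also have "\<dots> \<le> B * exp (- (M / 2 * t\<^sup>2))" using F by (intro mult_right_mono) auto
    \<comment> \<open>Here 23/48 = 1/2 - 1/48: beyond pi the surplus of the Gaussian over the
      majorant is already at most 1/M.\<close>
    also have "exp (- (M / 2 * t\<^sup>2)) = exp (- (M / 48 * t\<^sup>2)) * exp (- (23 / 48 * (M * t\<^sup>2)))"
      unfolding exp_add[symmetric] by simp
    also have "B * \<dots> \<le> B * (exp (- (M / 48 * t\<^sup>2)) * (1 / M))"
    proof (intro mult_left_mono B)
      have "M \<le> 23 / 48 * (M * t\<^sup>2)" using \<open>M * t\<^sup>2 \<ge> M * 9\<close> M by linarith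
      also have "\<dots> \<le> exp (23 / 48 * (M * t\<^sup>2))"
        using exp_ge_add_one_self[of "23 / 48 * (M * t\<^sup>2)"] by linarith
      finally show "exp (- (23 / 48 * (M * t\<^sup>2))) \<le> 1 / M"
        using M unfolding exp_minus inverse_eq_divide by (intro divide_left_mono mult_pos_pos) auto
    qed auto
    also have "\<dots> = (1 / M * B) * exp (- (M / 48 * t\<^sup>2))" by simp
    also have "\<dots> \<le> K * exp (- (M / 48 * t\<^sup>2))" unfolding K_def
    proof (intro mult_right_mono B)
      have "1 / M \<le> (24 * (real p)\<^sup>2 + 97) / M" using M by (intro divide_right_mono) auto
      then show "1 / M \<le> 48 * \<eta> + \<delta> + (24 * (real p)\<^sup>2 + 97) / M" using \<eta> \<delta> by linarith
    qed auto
    finally have "norm (Q t) \<le> K * exp (- (M / 48 * t\<^sup>2))" .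
    moreover have "t \<notin> {-pi..pi}" using False by auto
    ultimately show ?thesis by (simp add: S_def)
  next
    case True
    define c where "c = 1 - cos t"
    let ?a = "complex_of_real (exp (- (M * c)))" and ?s = "cis (- (real p * t))"
    define E where "E = exp (- (M / 48 * t\<^sup>2))"
    define x where "x = M * t\<^sup>2"
    have x: "x \<ge> 0" using M by (simp add: x_def)
    have E: "E = exp (- (x / 48))" by (simp add: E_def x_def)
    have E01: "0 \<le> E" "E \<le> 1" using x by (simp_all add: E)
    have cge: "M * c \<ge> x / 12" using one_minus_cos_ge[OF True] M mult_left_mono[of "t\<^sup>2 / 12" c M]
      by (simp add: c_def x_def)
    then have ec: "exp (- (M * c)) \<le> exp (- (x / 12))" by simp
    have x48: "x \<le> 48 * exp (x / 48)" using exp_neg_mult_le[of x "1/48"] x by simp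
    have xE: "x * exp (- (x / 24)) \<le> 48 * E"
    proof -
      have "x * exp (- (x / 24)) \<le> 48 * exp (x / 48) * exp (- (x / 24))" using x48 by (intro mult_right_mono) auto
      also have "\<dots> = 48 * E" unfolding E by (simp add: mult.assoc exp_add[symmetric])
      finally show ?thesis .
    qed
    have e12: "exp (- (x / 12)) \<le> exp (- (x / 24))" "exp (- (x / 12)) \<le> E" using x by (auto simp: E)
    have ec24: "exp (- (M * c)) \<le> exp (- (x / 24))" and ecE: "exp (- (M * c)) \<le> E"
      by (rule order_trans[OF ec e12(1)], rule order_trans[OF ec e12(2)])
    have wx: "norm (w t) \<le> \<eta> * x" using w[OF True] by (simp add: x_def mult.assoc)
    have wx': "norm (w t) \<le> x / 24" using wx mult_right_mono[OF \<eta>(2) x] by simp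
    have t1: "norm (?a * ((exp (w t) - 1) * F t * ?s)) \<le> 48 * \<eta> * B * E"
    proof -
      have "norm (exp (w t) - exp 0) \<le> exp (x / 24) * norm (w t - 0)"
        using complex_Re_le_cmod[of "w t"] wx' x by (intro norm_exp_diff_le) auto
      also have "\<dots> \<le> exp (x / 24) * (\<eta> * x)" using wx by (intro mult_left_mono) auto
      finally have 1: "norm (exp (w t) - 1) \<le> exp (x / 24) * (\<eta> * x)" by simp
      have "norm (?a * ((exp (w t) - 1) * F t * ?s))
          \<le> exp (- (x / 12)) * (exp (x / 24) * (\<eta> * x) * B * 1)"
        by (intro norm_mult_mono 1 F True) (use ec in auto)
      also have "\<dots> = \<eta> * B * (x * (exp (- (x / 12)) * exp (x / 24)))" by simp
      also have "exp (- (x / 12)) * exp (x / 24) = exp (- (x / 24))" unfolding exp_add[symmetric] by simp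
      also have "\<eta> * B * (x * exp (- (x / 24))) \<le> \<eta> * B * (48 * E)" using \<eta> B xE by (intro mult_left_mono) auto
      finally show ?thesis by simp
    qed
    have t2: "norm (?a * ((F t - F0) * ?s)) \<le> \<delta> * B * E"
    proof -
      have "norm (?a * ((F t - F0) * ?s)) \<le> E * (\<delta> * B * 1)"
        by (intro norm_mult_mono F True) (use ecE in auto)
      then show ?thesis by (simp add: mult_ac)
    qed
    have t3: "norm (?a * (F0 * of_real (cos (real p * t) - 1))) \<le> 24 * (real p)\<^sup>2 / M * B * E"
    proof -
      have "\<bar>cos (real p * t) - 1\<bar> \<le> (real p * t)\<^sup>2 / 2"
        using cos_quadratic_bound[of "real p * t"] by simp
      then have "norm (complex_of_real (cos (real p * t) - 1)) \<le> (real p * t)\<^sup>2 / 2"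
        unfolding norm_of_real .
      then have "norm (?a * (F0 * of_real (cos (real p * t) - 1))) \<le> exp (- (x / 24)) * (B * ((real p * t)\<^sup>2 / 2))"
        by (intro norm_mult_mono F) (use ec24 in auto)
      also have "\<dots> = (real p)\<^sup>2 / (2 * M) * B * (x * exp (- (x / 24)))"
        using M by (simp add: x_def power_mult_distrib)
      also have "\<dots> \<le> (real p)\<^sup>2 / (2 * M) * B * (48 * E)"
        using xE M B by (intro mult_left_mono) auto
      also have "\<dots> = 24 * (real p)\<^sup>2 / M * B * E" by simp
      finally show ?thesis .
    qed
    have t4: "norm (F0 * of_real (exp (- (M * c)) - exp (- (M / 2 * t\<^sup>2)))) \<le> 96 / M * B * E"
    proof -
      have "\<bar>exp (- (M * c)) - exp (- (x / 2))\<bar> \<le> exp (- (x / 12)) * \<bar>- (M * c) - - (x / 2)\<bar>"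
        using cge x by (intro abs_exp_diff_le) auto
      also have "- (M * c) - - (x / 2) = x / 2 - M * c" by simp
      also have "\<bar>x / 2 - M * c\<bar> = M * \<bar>1 - cos t - t\<^sup>2 / 2\<bar>"
      proof -
        have "x / 2 - M * c = - (M * (1 - cos t - t\<^sup>2 / 2))" by (simp add: x_def c_def algebra_simps)
        then show ?thesis using M by (simp add: abs_mult)
      qed
      also have "exp (- (x / 12)) * (M * \<bar>1 - cos t - t\<^sup>2 / 2\<bar>) \<le> exp (- (x / 12)) * (M * (t ^ 4 / 24))"
        using M cos_quartic_bound[of t] by (intro mult_left_mono) auto
      \<comment> \<open>M t^4 = x^2 / M, and each of the two factors x takes one factor exp(-x /
        24).\<close>
      also have "\<dots> = (x * exp (- (x / 24))) * (x * exp (- (x / 24))) / (24 * M)"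
      proof -
        have "exp (- (x / 12)) = exp (- (x / 24)) * exp (- (x / 24))" unfolding exp_add[symmetric] by simp
        then show ?thesis using M by (simp add: x_def power2_eq_square power4_eq_xxxx)
      qed
      also have "\<dots> \<le> (48 * E) * (48 * E) / (24 * M)"
        using x M E01 by (intro divide_right_mono mult_mono[OF xE xE]) auto
      also have "\<dots> = 96 / M * (E * E)" by simp
      also have "\<dots> \<le> 96 / M * (E * 1)"
        using M E01 by (intro mult_left_mono) auto
      finally have "\<bar>exp (- (M * c)) - exp (- (x / 2))\<bar> \<le> 96 / M * E" by simp
      then have "norm (complex_of_real (exp (- (M * c)) - exp (- (M / 2 * t\<^sup>2)))) \<le> 96 / M * E"
        unfolding norm_of_real by (simp add: x_def)
      then have "norm (F0 * of_real (exp (- (M * c)) - exp (- (M / 2 * t\<^sup>2)))) \<le> B * (96 / M * E)"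
        using F by (intro norm_mult_mono)
      then show ?thesis by (simp add: mult_ac)
    qed
    have cis: "?s = of_real (cos (real p * t)) - \<i> * of_real (sin (real p * t))"
      by (simp add: complex_eq_iff)
    have "indicator {-pi..pi} t *\<^sub>R X t + S t - Q t =
        ?a * ((exp (w t) - 1) * F t * ?s)
      + ?a * ((F t - F0) * ?s)
      + ?a * (F0 * of_real (cos (real p * t) - 1))
      + F0 * of_real (exp (- (M * c)) - exp (- (M / 2 * t\<^sup>2)))"
    proof -
      have alg: "a * e * f * z + a * s * (\<i> * g) - g * q = a * ((e - 1) * f * z) + a * ((f - g) * z) + a * (g * (d - 1)) + g * (a - q)"
        if "z = d - \<i> * s" for a d e f g q s z :: complex
        unfolding that by (simp add: algebra_simps)
      have "indicator {-pi..pi} t = (1 :: real)" using True by (auto simp: indicator_def)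
      then show ?thesis
        unfolding X_def S_def Q_def c_def[symmetric] scaleR_one of_real_mult of_real_diff of_real_1
        using alg[OF cis] by simp
    qed
    also have "norm \<dots> \<le> 48 * \<eta> * B * E + \<delta> * B * E + 24 * (real p)\<^sup>2 / M * B * E + 96 / M * B * E"
      by (intro norm_triangle_le add_mono t1 t2 t3 t4)
    also have "\<dots> \<le> K * E"
    proof -
      have "0 \<le> 1 / M * B * E" using M B E01 by simp
      moreover have "K * E = 48 * \<eta> * B * E + \<delta> * B * E + 24 * (real p)\<^sup>2 / M * B * E + 96 / M * B * E + 1 / M * B * E"
        unfolding K_def by (simp add: add_divide_distrib algebra_simps)
      ultimately show ?thesis by linarith
    qed
    finally show ?thesis unfolding E_def .
  qed
  have "integral {-pi..pi} X = (LINT t|lborel. indicator {-pi..pi} t *\<^sub>R X t)"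
    using set_borel_integral_eq_integral(2)[OF set_int[OF Xc]] unfolding set_lebesgue_integral_def by (rule sym)
  then have "integral {-pi..pi} X - F0 * of_real (sqrt (2 * pi / M)) =
      (LINT t|lborel. indicator {-pi..pi} t *\<^sub>R X t + S t - Q t)"
    unfolding Bochner_Integration.integral_diff[OF Bochner_Integration.integrable_add[OF iX iS] iQ]
      Bochner_Integration.integral_add[OF iX iS] S0 Q by simp
  also have "norm \<dots> \<le> (LINT t|lborel. K * exp (- (M / 48 * t\<^sup>2)))"
  proof (rule order_trans[OF integral_norm_bound integral_mono])
    show "integrable lborel (\<lambda>t. norm (indicator {-pi..pi} t *\<^sub>R X t + S t - Q t))"
      by (intro integrable_norm Bochner_Integration.integrable_diff Bochner_Integration.integrable_add iX iS iQ)
    show "integrable lborel (\<lambda>t. K * exp (- (M / 48 * t\<^sup>2)))"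
      using gauss' unfolding has_bochner_integral_iff by (intro integrable_mult_right) auto
  qed (rule pt)
  also have "\<dots> = K * sqrt (48 * pi / M)"
    using gauss' unfolding has_bochner_integral_iff by (simp add: field_simps)
  finally show ?thesis unfolding X_def K_def .
qed

section \<open>The saddle point on the circle around the singularity\<close>

text \<open>The first and second derivatives are bounded on the compact unit disc. The radius 3 is
  below pi, the modulus of the nonzero zeros of \<open>sin\<close> closest to 0, which suits both
  \<open>cotk\<close> and \<open>camp\<close>.\<close>

lemma holomorphic_taylor_bounds:
  assumes "f holomorphic_on ball 0 3"
  obtains C where "C > 0"
    "\<And>z w. norm z \<le> 1 \<Longrightarrow> norm w \<le> 1 \<Longrightarrow> norm (f z - f w) \<le> C * norm (z - w)"
    "\<And>z w. norm z \<le> 1 \<Longrightarrow> norm w \<le> 1 \<Longrightarrow> norm (f z - f w - deriv f w * (z - w)) \<le> C * (norm (z - w))\<^sup>2"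
proof -
  define g where "g i = (deriv ^^ i) f" for i
  have hol: "g i holomorphic_on ball 0 3" for i
    unfolding g_def by (rule holomorphic_higher_deriv[OF assms]) auto
  have sub: "cball 0 1 \<subseteq> ball (0::complex) 3" by auto
  have der: "(g i has_field_derivative g (Suc i) x) (at x within cball 0 1)" if "x \<in> cball 0 1" for i x
  proof -
    have "(g i has_field_derivative deriv (g i) x) (at x)"
      by (rule holomorphic_derivI[OF hol]) (use that sub in auto)
    then show ?thesis by (simp add: g_def has_field_derivative_at_within)
  qed
  have "\<exists>b>0. \<forall>x\<in>cball 0 1. norm (g i x) \<le> b" for i
    using compact_norm_bound[OF compact_cball holomorphic_on_imp_continuous_on[OF holomorphic_on_subset[OF hol[of i] sub]]] by metis
  then obtain b1 b2 where b: "b1 > 0" "\<And>x. x \<in> cball 0 1 \<Longrightarrow> norm (g 1 x) \<le> b1"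
    "b2 > 0" "\<And>x. x \<in> cball 0 1 \<Longrightarrow> norm (g 2 x) \<le> b2" by metis
  show thesis
  proof (rule that[of "b1 + b2"])
    show "b1 + b2 > 0" using b by simp
    fix z w :: complex assume zw: "norm z \<le> 1" "norm w \<le> 1"
    have "norm (g 0 z - (\<Sum>i\<le>0. g i w * (z - w) ^ i / fact i)) \<le> b1 * norm (z - w) ^ Suc 0 / fact 0"
      by (rule complex_Taylor[of "cball 0 1"]) (use der b zw in auto)
    then have "norm (f z - f w) \<le> b1 * norm (z - w)" by (simp add: g_def)
    also have "\<dots> \<le> (b1 + b2) * norm (z - w)" using b by (intro mult_right_mono) auto
    finally show "norm (f z - f w) \<le> (b1 + b2) * norm (z - w)" .
    have "norm (g 0 z - (\<Sum>i\<le>1. g i w * (z - w) ^ i / fact i)) \<le> b2 * norm (z - w) ^ Suc 1 / fact 1"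
      by (rule complex_Taylor[of "cball 0 1"]) (use der b zw in \<open>auto simp: numeral_2_eq_2\<close>)
    then have "norm (f z - f w - deriv f w * (z - w)) \<le> b2 * (norm (z - w))\<^sup>2"
      by (simp add: g_def numeral_2_eq_2 diff_diff_eq)
    also have "\<dots> \<le> (b1 + b2) * (norm (z - w))\<^sup>2" using b by (intro mult_right_mono) auto
    finally show "norm (f z - f w - deriv f w * (z - w)) \<le> (b1 + b2) * (norm (z - w))\<^sup>2" .
  qed
qed

lemma shc_neg_square_nonzero:
  assumes "norm z < 3"
  shows "shc (- (z\<^sup>2)) \<noteq> 0"
proof
  assume "shc (- (z\<^sup>2)) = 0"
  then obtain j :: nat where j: "j \<ge> 1" "- (z\<^sup>2) = - of_real ((real j * pi)\<^sup>2)" by (rule shc_eq_0D)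
  then have "z\<^sup>2 = of_real ((real j * pi)\<^sup>2)" by simp
  then have "norm (z\<^sup>2) = norm (complex_of_real ((real j * pi)\<^sup>2))" by (rule arg_cong)
  then have "(norm z)\<^sup>2 = (real j * pi)\<^sup>2" unfolding norm_power norm_of_real by simp
  then have "norm z = real j * pi" by (simp add: power2_eq_iff_nonneg)
  moreover have "1 * pi \<le> real j * pi" using j by (intro mult_right_mono) auto
  ultimately show False using assms pi_gt3 by linarith
qed

text \<open>
  \<open>zcot z = z cot z\<close>, and \<open>cotk\<close> is the regular part of \<open>(\<pi> - z) cot z\<close> at \<open>0\<close>, i.e. \<open>(\<pi> - z) cot z = \<pi> / z + cotk z\<close>.
\<close>

definition zcot :: "complex \<Rightarrow> complex" where
  "zcot z = chc (- (z\<^sup>2)) / shc (- (z\<^sup>2))"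

definition cotk :: "complex \<Rightarrow> complex" where
  "cotk z = of_real pi * (if z = 0 then deriv zcot 0 else (zcot z - zcot 0) / (z - 0)) - zcot z"

text \<open>The amplitude without its pole. With s = i (pi - z), the factor s^N / sinh(s)^N gives
  \<open>N\<close> powers of pi - z and the derivative of the substitution gives one more;
  \<open>shc (-(z^2))\<close> is sin z / z.\<close>

definition camp :: "nat \<Rightarrow> nat \<Rightarrow> complex \<Rightarrow> complex" where
  "camp N k z = cos z ^ k * (of_real pi - z) ^ (N + 1) / shc (- (z\<^sup>2)) ^ N"

lemma zcot_0 [simp]: "zcot 0 = 1"
  using chc_neg_square[of 0] by (simp add: zcot_def)

lemma camp_0 [simp]: "camp N k 0 = of_real pi ^ (N + 1)"
  by (simp add: camp_def)

lemma zcot_holomorphic: "zcot holomorphic_on ball 0 3"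
  unfolding zcot_def[abs_def] using shc_neg_square_nonzero
  by (intro holomorphic_intros holomorphic_on_compose_gen[OF _ holomorphic_shc, unfolded o_def]
        holomorphic_on_compose_gen[OF _ holomorphic_chc, unfolded o_def]) auto

lemma cotk_holomorphic: "cotk holomorphic_on ball 0 3"
  unfolding cotk_def[abs_def]
  by (intro holomorphic_intros pole_lemma_open zcot_holomorphic) auto

lemma camp_holomorphic: "camp N k holomorphic_on ball 0 3"
  unfolding camp_def[abs_def] using shc_neg_square_nonzero
  by (intro holomorphic_intros holomorphic_on_compose_gen[OF _ holomorphic_shc, unfolded o_def]) auto

lemma sin_complex_nonzero:
  fixes z :: complex
  assumes "norm z < 3" "z \<noteq> 0"
  shows "sin z \<noteq> 0"
  using shc_neg_square[of z] shc_neg_square_nonzero[OF assms(1)] assms(2) by auto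

lemma pole_plus_cotk:
  assumes "norm z < 3" "z \<noteq> 0"
  shows "of_real pi / z + cotk z = (of_real pi - z) * cos z / sin z"
proof -
  have "shc (- (z\<^sup>2)) = sin z / z" using shc_neg_square[of z] assms(2) by (simp add: field_simps)
  then have "zcot z = z * cos z / sin z" by (simp add: zcot_def chc_neg_square)
  then show ?thesis using assms sin_complex_nonzero[OF assms]
    by (simp add: cotk_def field_simps)
qed

text \<open>The substitution makes l^2 + v equal to -((pi - z)^2), so the radial factor no longer
  depends on \<open>v\<close>, which survives only in \<open>rt\<close>. The sign (-1)^k is cos(pi -
  z) = -cos z.\<close>

lemma kerG_on_circle:
  assumes n: "n \<ge> 1" and v: "v \<ge> 0" and z: "norm z \<le> 1" "z \<noteq> 0"
  shows "kerG T R (n + k) k j v (\<i> * rt v z) * (of_real pi - z) / rt v z * z =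
    (- 1) ^ k * \<i> ^ j * exp (- (of_real T * rt v z) + of_real R * (of_real pi / z + cotk z)) *
      camp (n + k) k z * (rt v z ^ j / rt v z) / z ^ (n + k - 1)"
proof -
  define \<sigma> where "\<sigma> = of_real pi - z"
  have z3: "norm z < 3" using z by simp
  have w: "(\<i> * rt v z)\<^sup>2 + of_real v = - (\<sigma>\<^sup>2)"
    using rt_square[OF v z(1)] by (simp add: power_mult_distrib \<sigma>_def)
  have \<sigma>0: "\<sigma> \<noteq> 0"
  proof
    assume "\<sigma> = 0"
    then have "z = of_real pi" by (simp add: \<sigma>_def)
    then show False using z pi_gt3 by simp
  qed
  have s0: "sin z \<noteq> 0" using sin_complex_nonzero[OF z3 z(2)] .
  have ch: "chc (- (\<sigma>\<^sup>2)) = - cos z" unfolding chc_neg_square by (simp add: \<sigma>_def cos_diff)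
  have sh: "shc (- (\<sigma>\<^sup>2)) = sin z / \<sigma>"
    using shc_neg_square[of \<sigma>] \<sigma>0 by (simp add: field_simps) (simp add: \<sigma>_def sin_diff)
  have shz: "shc (- (z\<^sup>2)) = sin z / z" using shc_neg_square[of z] z by (simp add: field_simps)
  have "chc (- (\<sigma>\<^sup>2)) / shc (- (\<sigma>\<^sup>2)) = - (of_real pi / z + cotk z)"
    unfolding pole_plus_cotk[OF z3 z(2)] ch sh by (simp add: \<sigma>_def)
  then have e: "- (of_real R * chc (- (\<sigma>\<^sup>2)) / shc (- (\<sigma>\<^sup>2))) = of_real R * (of_real pi / z + cotk z)"
    unfolding times_divide_eq_right[symmetric] by (simp only: mult_minus_right minus_minus)
  have "kerF R (n + k) k (- (\<sigma>\<^sup>2)) = exp (of_real R * (of_real pi / z + cotk z)) * ((- 1) ^ k * cos z ^ k) / (sin z / \<sigma>) ^ (n + k)"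
    unfolding kerF_def e unfolding ch sh power_mult_distrib[symmetric] by simp
  moreover have "exp (\<i> * of_real T * (\<i> * rt v z)) = exp (- (of_real T * rt v z))"
    by (simp add: algebra_simps)
  ultimately have "kerG T R (n + k) k j v (\<i> * rt v z) * (of_real pi - z) / rt v z * z =
     (exp (- (of_real T * rt v z)) * exp (of_real R * (of_real pi / z + cotk z))) * ((- 1) ^ k * cos z ^ k) * \<sigma> ^ (n + k) / sin z ^ (n + k) * (\<i> ^ j * rt v z ^ j) * \<sigma> / rt v z * z"
    unfolding kerG_def w unfolding power_mult_distrib by (simp add: \<sigma>_def power_divide)
  also have "exp (- (of_real T * rt v z)) * exp (of_real R * (of_real pi / z + cotk z)) = exp (- (of_real T * rt v z) + of_real R * (of_real pi / z + cotk z))"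
    by (rule exp_add[symmetric])
  also have "exp (- (of_real T * rt v z) + of_real R * (of_real pi / z + cotk z)) * ((- 1) ^ k * cos z ^ k) * \<sigma> ^ (n + k) / sin z ^ (n + k) * (\<i> ^ j * rt v z ^ j) * \<sigma> / rt v z * z
    = (- 1) ^ k * \<i> ^ j * exp (- (of_real T * rt v z) + of_real R * (of_real pi / z + cotk z)) *
      camp (n + k) k z * (rt v z ^ j / rt v z) / z ^ (n + k - 1)"
  proof -
    have "camp (n + k) k z / z ^ (n + k - 1) = cos z ^ k * \<sigma> ^ (n + k) * \<sigma> / sin z ^ (n + k) * (z ^ (n + k) / z ^ (n + k - 1))"
      unfolding camp_def shz by (simp add: \<sigma>_def power_divide)
    \<comment> \<open>\<open>n >= 1\<close> guarantees that the subtraction in the exponent is not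
      truncated.\<close>
    also have "z ^ (n + k) / z ^ (n + k - 1) = z"
      using z n by (cases "n + k") auto
    finally have c: "camp (n + k) k z / z ^ (n + k - 1) = cos z ^ k * \<sigma> ^ (n + k) * \<sigma> / sin z ^ (n + k) * z" .
    have r: "(- 1) ^ k * \<i> ^ j * exp (- (of_real T * rt v z) + of_real R * (of_real pi / z + cotk z)) *
      camp (n + k) k z * (rt v z ^ j / rt v z) / z ^ (n + k - 1) =
      (- 1) ^ k * \<i> ^ j * exp (- (of_real T * rt v z) + of_real R * (of_real pi / z + cotk z)) * (rt v z ^ j / rt v z) *
        (camp (n + k) k z / z ^ (n + k - 1))" by simp
    show ?thesis unfolding r c by (simp only: divide_inverse mult_ac)
  qed
  finally show ?thesis .
qed

text \<open>
  The value \<open>h = \<pi> - y\<close> corresponds to \<open>\<omega> = saddle_omega h\<close>, i.e. \<open>\<theta>(\<pi> - h) = saddle_omega h\<close>, and then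
  \<open>d^2 / 4 = saddle_action R h\<close>.
\<close>

abbreviation saddle_omega :: "real \<Rightarrow> real" where
  "saddle_omega h \<equiv> (pi - h) / (sin h)\<^sup>2 + cos h / sin h"

abbreviation saddle_action :: "real \<Rightarrow> real \<Rightarrow> real" where
  "saddle_action R h \<equiv> R * (pi - h)\<^sup>2 / (sin h)\<^sup>2"

lemma saddle_identity:
  fixes h R :: real
  assumes h: "0 < h" "h < 1"
  defines "T \<equiv> R * saddle_omega h"
  shows "of_real T = of_real R * (of_real pi / (of_real h)\<^sup>2 - deriv cotk (of_real h))"
    "- (of_real T * (of_real pi - of_real h)) + of_real R * (of_real pi / of_real h + cotk (of_real h))
       = - of_real (saddle_action R h)"
proof -
  let ?e = "complex_of_real h"
  have e: "norm ?e < 3" "?e \<noteq> 0" using h by auto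
  have s: "sin h > 0" using h pi_gt3 by (intro sin_gt_zero) auto
  have sc: "sin ?e = of_real (sin h)" "cos ?e = of_real (cos h)" by (simp_all add: sin_of_real cos_of_real)
  have s0: "sin ?e \<noteq> 0" using s by (simp add: sc)
  have 1: "((\<lambda>z. of_real pi / z + cotk z) has_field_derivative (- of_real pi / ?e\<^sup>2 + deriv cotk ?e)) (at ?e)"
  proof -
    have "(cotk has_field_derivative deriv cotk ?e) (at ?e)"
      by (rule holomorphic_derivI[OF cotk_holomorphic]) (use e in auto)
    then show ?thesis using e by (auto intro!: derivative_eq_intros simp: power2_eq_square)
  qed
  have 2: "((\<lambda>z. (of_real pi - z) * cos z / sin z) has_field_derivative
      (- (cos ?e / sin ?e) - (of_real pi - ?e) / (sin ?e)\<^sup>2)) (at ?e)"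
  proof -
    have "((\<lambda>z. (of_real pi - z) * cos z / sin z) has_field_derivative
      (((- 1) * cos ?e + (of_real pi - ?e) * (- sin ?e)) * sin ?e - (of_real pi - ?e) * cos ?e * cos ?e) / (sin ?e * sin ?e)) (at ?e)"
      using s0 by (auto intro!: derivative_eq_intros)
    moreover have "(((- 1) * cos ?e + (of_real pi - ?e) * (- sin ?e)) * sin ?e - (of_real pi - ?e) * cos ?e * cos ?e) / (sin ?e * sin ?e)
       = - (cos ?e / sin ?e) - (of_real pi - ?e) / (sin ?e)\<^sup>2"
    proof -
      have alg: "((- 1) * c + a * (- s)) * s - a * c * c = - c * s - a * (s\<^sup>2 + c\<^sup>2)" for a c s :: complex
        by (simp add: algebra_simps power2_eq_square)
      show ?thesis unfolding alg sin_cos_squared_add using s0 by (simp add: diff_divide_distrib power2_eq_square)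
    qed
    ultimately show ?thesis by (simp only:)
  qed
  have "((\<lambda>z. of_real pi / z + cotk z) has_field_derivative (- (cos ?e / sin ?e) - (of_real pi - ?e) / (sin ?e)\<^sup>2)) (at ?e)"
  proof (rule has_field_derivative_transform_within_open[OF 2])
    show "open (ball 0 3 - {0::complex})" by (simp add: open_delete)
  qed (use e pole_plus_cotk in auto)
  from DERIV_unique[OF 1 this]
  have d: "- of_real pi / ?e\<^sup>2 + deriv cotk ?e = - (cos ?e / sin ?e) - (of_real pi - ?e) / (sin ?e)\<^sup>2" .
  have "of_real T = of_real R * ((of_real pi - ?e) / (sin ?e)\<^sup>2 + cos ?e / sin ?e)"
    by (simp add: T_def sc)
  also have "(of_real pi - ?e) / (sin ?e)\<^sup>2 + cos ?e / sin ?e = - (- of_real pi / ?e\<^sup>2 + deriv cotk ?e)"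
    unfolding d by simp
  finally show "of_real T = of_real R * (of_real pi / ?e\<^sup>2 - deriv cotk ?e)" by simp
  have "- (T * (pi - h)) + R * ((pi - h) * cos h / sin h) = - (saddle_action R h)"
    unfolding T_def using s by (simp add: field_simps power2_eq_square)
  then have "complex_of_real (- (T * (pi - h)) + R * ((pi - h) * cos h / sin h)) = of_real (- saddle_action R h)"
    by (rule arg_cong)
  then show "- (of_real T * (of_real pi - ?e)) + of_real R * (of_real pi / ?e + cotk ?e)
       = - of_real (saddle_action R h)"
    unfolding pole_plus_cotk[OF e] sc by simp
qed

text \<open>On |z| = h the pole contributes exactly (z - h) / h^2 + 1/z - 1/h = -2 (1 - cos t) / h,
  which is real. Criticality removes the linear term of the regular part, so only a second-order
  Taylor remainder of \<open>cotk\<close> is left.\<close>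

lemma saddle_exponent:
  fixes h R t :: real
  assumes h: "0 < h" "h < 1"
  defines "T \<equiv> R * saddle_omega h"
  defines "z \<equiv> of_real h * cis t"
  shows "- (of_real T * (of_real pi - z)) + of_real R * (of_real pi / z + cotk z) =
    - of_real (saddle_action R h) - of_real (2 * pi * R / h * (1 - cos t))
    + of_real R * (cotk z - cotk (of_real h) - deriv cotk (of_real h) * (z - of_real h))"
proof -
  let ?e = "complex_of_real h"
  have e0: "?e \<noteq> 0" using h by simp
  have zi: "1 / z = cis (- t) / ?e" by (simp add: z_def cis_inverse[symmetric] field_simps)
  have cc: "cis t + cis (- t) = of_real (2 * cos t)" by (simp add: complex_eq_iff)
  have "- (of_real T * (of_real pi - z)) + of_real R * (of_real pi / z + cotk z) =
     (- (of_real T * (of_real pi - ?e)) + of_real R * (of_real pi / ?e + cotk ?e))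
     + (of_real T * (z - ?e) + of_real R * of_real pi * (1 / z - 1 / ?e) + of_real R * (cotk z - cotk ?e))"
    by (simp add: algebra_simps)
  also have "- (of_real T * (of_real pi - ?e)) + of_real R * (of_real pi / ?e + cotk ?e) = - of_real (saddle_action R h)"
    unfolding T_def by (rule saddle_identity(2)[OF h])
  also have "of_real T * (z - ?e) + of_real R * of_real pi * (1 / z - 1 / ?e) + of_real R * (cotk z - cotk ?e)
    = of_real R * of_real pi * ((z - ?e) / ?e\<^sup>2 + (1 / z - 1 / ?e)) + of_real R * (cotk z - cotk ?e - deriv cotk ?e * (z - ?e))"
    unfolding T_def saddle_identity(1)[OF h] by (simp add: algebra_simps)
  also have "(z - ?e) / ?e\<^sup>2 + (1 / z - 1 / ?e) = (cis t + cis (- t) - 2) / ?e"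
    unfolding zi using e0 by (simp add: z_def field_simps power2_eq_square)
  also have "cis t + cis (- t) - 2 = - of_real (2 * (1 - cos t))" unfolding cc by simp
  also have "of_real R * of_real pi * (- of_real (2 * (1 - cos t)) / ?e) = - complex_of_real (2 * pi * R / h * (1 - cos t))"
    using e0 by (simp add: field_simps)
  finally show ?thesis by simp
qed

section \<open>Dependence on the transverse length, uniformly on the circle\<close>

lemma norm_power_diff_le:
  fixes x y :: "'a::real_normed_field"
  assumes "norm x \<le> B" "norm y \<le> B" "B \<ge> 1"
  shows "norm (x ^ j - y ^ j) \<le> real j * B ^ j * norm (x - y)"
proof (induction j)
  case (Suc j)
  have "x ^ Suc j - y ^ Suc j = x * (x ^ j - y ^ j) + y ^ j * (x - y)" by (simp add: algebra_simps)
  also have "norm \<dots> \<le> B * (real j * B ^ j * norm (x - y)) + B ^ j * norm (x - y)"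
    using assms Suc.IH
    by (intro norm_triangle_le add_mono norm_mult_mono) (auto simp: norm_power intro: power_mono)
  also have "B ^ j * norm (x - y) \<le> B ^ Suc j * norm (x - y)"
    using assms by (intro mult_right_mono power_increasing) auto
  finally show ?case by (simp add: algebra_simps)
qed simp

text \<open>The transverse exponent is -T v / D. For small \<open>v\<close> and \<open>z\<close>, D
  is near 2 pi, which gives the Gaussian; for large \<open>v\<close>, D grows like sqrt v. The two
  exponent bounds cover both regimes at once in terms of tau = sqrt(T v), where
  \<open>T >= 1\<close> yields sqrt v <= tau.\<close>

lemma rt_facts:
  assumes T: "T \<ge> 1" and v: "v \<ge> 0" and z: "norm z \<le> 1"
  defines "\<tau> \<equiv> sqrt (T * v)" and "D \<equiv> rt v z + (of_real pi - z)"
  shows "rt v z - (of_real pi - z) = of_real v / D"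
    and "norm (rt v z) \<le> \<tau> + 5"
    and "norm (rt v z) \<ge> 1"
    and "norm (rt v z - of_real pi) \<le> v + 8 * norm z"
    and "norm (1 / D - 1 / of_real (2 * pi)) \<le> v + 9 * norm z"
    and "Re (- (of_real T * (of_real v / D))) \<le> 5 - \<tau> / 2"
    and "- (T * v / (2 * pi)) \<le> 5 - \<tau> / 2"
proof -
  let ?S = "rt v z" and ?\<sigma> = "of_real pi - z"
  have \<tau>: "\<tau> \<ge> 0" "\<tau>\<^sup>2 = T * v" using T v by (simp_all add: \<tau>_def)
  have x: "\<bar>Re z\<bar> \<le> 1" and y: "\<bar>Im z\<bar> \<le> 1"
    using z abs_Re_le_cmod[of z] abs_Im_le_cmod[of z] by linarith+
  have Re\<sigma>: "Re ?\<sigma> \<ge> 2" using x pi_gt3 by simp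
  have Im\<sigma>: "\<bar>Im ?\<sigma>\<bar> \<le> 1" using y by simp
  have n\<sigma>: "norm ?\<sigma> \<le> 5" using norm_triangle_ineq4[of "of_real pi" z] z pi_less_4 by simp
  have ReS: "Re ?S \<ge> 3 / 2" using Re_rt[OF v z] .
  show S1: "norm ?S \<ge> 1" using ReS complex_Re_le_cmod[of ?S] by linarith
  have ReD: "Re D \<ge> 3" using Re\<sigma> ReS by (simp add: D_def)
  have D1: "norm D \<ge> 1" using ReD complex_Re_le_cmod[of D] by linarith
  then have D0: "D \<noteq> 0" by auto
  have "(?S - ?\<sigma>) * D = of_real v"
    using rt_square[OF v z] by (simp add: D_def algebra_simps power2_eq_square)
  then show "?S - ?\<sigma> = of_real v / D" using D0 by (simp add: field_simps)
  have sv: "sqrt v \<le> \<tau>" using T v mult_right_mono[of 1 T v] by (simp add: \<tau>_def)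
  have nS: "norm ?S \<le> sqrt v + norm ?\<sigma>"
  proof (rule power2_le_imp_le)
    have "0 \<le> 2 * sqrt v * norm ?\<sigma>" using v by simp
    then show "(norm ?S)\<^sup>2 \<le> (sqrt v + norm ?\<sigma>)\<^sup>2"
      using norm_rt[OF v z] unfolding power2_sum real_sqrt_pow2[OF v] by linarith
  qed (use v in auto)
  then show "norm ?S \<le> \<tau> + 5" using sv n\<sigma> by linarith
  show Spi: "norm (?S - of_real pi) \<le> v + 8 * norm z"
  proof -
    have "norm (?S - of_real pi) * 1 \<le> norm (?S - of_real pi) * norm (?S + of_real pi)"
    proof (rule mult_left_mono)
      show "1 \<le> norm (?S + of_real pi)" using complex_Re_le_cmod[of "?S + of_real pi"] ReS pi_gt3 by simp
    qed auto
    also have "\<dots> = norm (?S\<^sup>2 - (of_real pi)\<^sup>2)"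
      unfolding norm_mult[symmetric] by (simp add: power2_eq_square algebra_simps)
    also have "?S\<^sup>2 - (of_real pi)\<^sup>2 = of_real v + z * (z - of_real (2 * pi))"
      unfolding rt_square[OF v z] by (simp add: power2_eq_square algebra_simps)
    also have "norm \<dots> \<le> v + norm z * 8"
    proof (intro norm_triangle_le add_mono norm_mult_mono)
      show "norm (z - of_real (2 * pi)) \<le> 8"
      proof -
        have "norm (z - of_real (2 * pi)) \<le> norm z + norm (complex_of_real (2 * pi))" by (rule norm_triangle_ineq4)
        also have "norm (complex_of_real (2 * pi)) = 2 * pi" unfolding norm_of_real by simp
        finally show ?thesis using z pi_approx by simp
      qed
    qed (use v in auto)
    finally show ?thesis by simp
  qed
  show "norm (1 / D - 1 / of_real (2 * pi)) \<le> v + 9 * norm z"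
  proof -
    have "norm (1 / D - 1 / of_real (2 * pi)) = norm (of_real (2 * pi) - D) / (norm D * (2 * pi))"
      using D0 by (subst diff_frac_eq) (auto simp: norm_divide norm_mult)
    also have "\<dots> \<le> norm (of_real (2 * pi) - D) / 1"
    proof (rule divide_left_mono)
      show "1 \<le> norm D * (2 * pi)" using mult_mono[of 1 "norm D" 1 "2 * pi"] D1 pi_gt3 by simp
    qed (use D0 in auto)
    also have "of_real (2 * pi) - D = z - (?S - of_real pi)" by (simp add: D_def)
    also have "norm \<dots> / 1 \<le> norm z + norm (?S - of_real pi)" using norm_triangle_ineq4 by simp
    also have "\<dots> \<le> v + 9 * norm z" using Spi by simp
    finally show ?thesis .
  qed
  have nD: "norm D \<le> \<tau> + 10"
    using norm_triangle_ineq[of ?S ?\<sigma>] nS sv n\<sigma> by (simp add: D_def)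
  \<comment> \<open>\<open>D\<close> stays in the sector |Im D| <= Re D, which gives Re(1 / D) >= 1
    / (2 |D|).\<close>
  have nD2: "norm D \<le> 2 * Re D"
  proof -
    have "\<bar>Im D\<bar> \<le> Re D" using Im_rt[OF v z] Im\<sigma> Re\<sigma> by (simp add: D_def)
    then show ?thesis using cmod_le[of D] ReD by linarith
  qed
  \<comment> \<open>This is (tau - 10) (tau + 10) <= tau^2.\<close>
  have key: "\<tau>\<^sup>2 / (2 * (\<tau> + 10)) \<ge> \<tau> / 2 - 5"
    using \<tau>(1) by (simp add: field_simps power2_eq_square)
  have "Re (1 / D) = Re D / (norm D)\<^sup>2" by (simp add: Re_divide cmod_power2)
  also have "\<dots> \<ge> (norm D / 2) / (norm D)\<^sup>2" using nD2 by (intro divide_right_mono) auto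
  also have "(norm D / 2) / (norm D)\<^sup>2 = 1 / (2 * norm D)" using D1 by (simp add: power2_eq_square field_simps)
  also have "\<dots> \<ge> 1 / (2 * (\<tau> + 10))"
    using nD D1 by (intro divide_left_mono mult_pos_pos) auto
  finally have "\<tau>\<^sup>2 * (1 / (2 * (\<tau> + 10))) \<le> \<tau>\<^sup>2 * Re (1 / D)" by (intro mult_left_mono) auto
  moreover have "Re (- (of_real T * (of_real v / D))) = - (\<tau>\<^sup>2 * Re (1 / D))"
    unfolding \<tau>(2) by (simp add: Re_divide)
  ultimately show "Re (- (of_real T * (of_real v / D))) \<le> 5 - \<tau> / 2" using key by simp
  have "\<tau>\<^sup>2 / (2 * (\<tau> + 10)) \<le> \<tau>\<^sup>2 / (2 * pi)"
    using \<tau>(1) pi_less_4 by (intro divide_left_mono) auto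
  then show "- (T * v / (2 * pi)) \<le> 5 - \<tau> / 2" using key unfolding \<tau>(2) by linarith
qed

text \<open>The part of the integrand that depends on \<open>v\<close>, with its phase normalised to
  0 at v = 0. The quotient \<open>rt^j / rt\<close> stands for the power j - 1, which is -1 when j =
  0.\<close>

definition gg :: "real \<Rightarrow> nat \<Rightarrow> real \<Rightarrow> complex \<Rightarrow> complex" where
  "gg T j v z = exp (- (of_real T * (rt v z - (of_real pi - z)))) * (rt v z ^ j / rt v z)"

text \<open>Products are bounded by powers of P = tau + 5 times exp(5 - tau / 2), and half of that
  decay absorbs them. The difference of the exponentials costs P^2 for T v and another P^2 for v
  relative to 1/T; with P^j from \<open>rt^j\<close> this makes the exponent j + 4.\<close>

lemma gg_estimate:
  obtains C where "C > 0"
    "\<And>T v z. T \<ge> 1 \<Longrightarrow> v \<ge> 0 \<Longrightarrow> norm z \<le> 1 \<Longrightarrow> norm (gg T j v z) \<le> C * exp (- (sqrt (T * v) / 4))"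
    "\<And>T v z. T \<ge> 1 \<Longrightarrow> v \<ge> 0 \<Longrightarrow> norm z \<le> 1 \<Longrightarrow>
       norm (gg T j v z - of_real (pi ^ j / pi * exp (- (T * v / (2 * pi)))))
        \<le> C * (norm z + 1 / T) * exp (- (sqrt (T * v) / 4))"
proof -
  define K where "K = (real (Suc (j + 4)) / (1/4)) ^ (j + 4)"
  define C where "C = 9 * real (j + 2) * exp (25/4) * K"
  have K: "K > 0" by (simp add: K_def)
  have absorb: "a * P ^ (j + 4) * exp (5 - \<tau> / 2) \<le> a * exp (25/4) * K * exp (- (\<tau> / 4))"
    if "a \<ge> 0" "\<tau> \<ge> 0" "P = \<tau> + 5" for a P \<tau> :: real
  proof -
    have "P ^ (j + 4) \<le> K * exp (1/4 * P)" unfolding K_def using that by (intro exp_ge_power) auto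
    then have "a * P ^ (j + 4) * exp (5 - \<tau> / 2) \<le> a * (K * exp (1/4 * P)) * exp (5 - \<tau> / 2)"
      using that by (intro mult_right_mono mult_left_mono) auto
    also have "\<dots> = a * K * exp (1/4 * P + (5 - \<tau> / 2))" unfolding exp_add by simp
    also have "1/4 * P + (5 - \<tau> / 2) = 25/4 + - (\<tau> / 4)" using that by (simp add: field_simps)
    also have "a * K * exp (25/4 + - (\<tau> / 4)) = a * exp (25/4) * K * exp (- (\<tau> / 4))"
      unfolding exp_add by simp
    finally show ?thesis .
  qed
  show thesis
  proof (rule that[of C])
    show "C > 0" using K by (simp add: C_def)
    fix T v :: real and z :: complex assume *: "T \<ge> 1" "v \<ge> 0" "norm z \<le> 1"
    define \<tau> where "\<tau> = sqrt (T * v)"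
    define P where "P = \<tau> + 5"
    define D where "D = rt v z + (of_real pi - z)"
    define \<Delta> where "\<Delta> = norm z + 1 / T"
    note f = rt_facts[OF *, folded \<tau>_def D_def]
    have \<tau>: "\<tau> \<ge> 0" "\<tau>\<^sup>2 = T * v" using * by (simp_all add: \<tau>_def)
    have P: "P \<ge> 1" using \<tau> by (simp add: P_def)
    have \<tau>P: "\<tau>\<^sup>2 \<le> P\<^sup>2" using \<tau> by (intro power_mono) (auto simp: P_def)
    have \<Delta>: "\<Delta> \<ge> 0" using * by (simp add: \<Delta>_def)
    \<comment> \<open>Here 1/T enters the error: v = tau^2 / T is at most P^2 / T.\<close>
    have v9: "v + 9 * norm z \<le> 9 * P\<^sup>2 * \<Delta>"
    proof -
      have "v = \<tau>\<^sup>2 * (1 / T)" using * \<tau> by simp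
      also have "\<dots> \<le> P\<^sup>2 * (1 / T)" using \<tau>P * by (intro mult_right_mono) auto
      also have "\<dots> \<le> 9 * P\<^sup>2 * (1 / T)" using * by (intro mult_right_mono) auto
      finally have "v \<le> 9 * P\<^sup>2 * (1 / T)" .
      moreover have "1 * (9 * norm z) \<le> P\<^sup>2 * (9 * norm z)"
        using P by (intro mult_right_mono one_le_power) auto
      ultimately show ?thesis by (simp add: \<Delta>_def algebra_simps)
    qed
    define e where "e = exp (- (of_real T * (of_real v / D)))"
    define e0 where "e0 = complex_of_real (exp (- (T * v / (2 * pi))))"
    define q where "q = rt v z ^ j / rt v z"
    define q0 where "q0 = complex_of_real (pi ^ j / pi)"
    have gg: "gg T j v z = e * q" unfolding gg_def f(1) e_def q_def ..
    have ne: "norm e \<le> exp (5 - \<tau> / 2)" unfolding e_def norm_exp_eq_Re using f(6) by simp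
    have ne0: "norm e0 \<le> exp (5 - \<tau> / 2)" unfolding e0_def norm_of_real using f(7) by simp
    have nq: "norm q \<le> P ^ j"
    proof -
      have "norm q = norm (rt v z) ^ j / norm (rt v z)" by (simp add: q_def norm_divide norm_power)
      also have "\<dots> \<le> norm (rt v z) ^ j / 1" using f(3) by (intro divide_left_mono) auto
      also have "\<dots> \<le> P ^ j" using f(2) by (simp add: P_def power_mono)
      finally show ?thesis .
    qed
    have "norm (gg T j v z) \<le> exp (5 - \<tau> / 2) * P ^ j" unfolding gg by (intro norm_mult_mono ne nq)
    also have "\<dots> \<le> exp (5 - \<tau> / 2) * P ^ (j + 4)" using P by (intro mult_left_mono power_increasing) auto
    also have "\<dots> \<le> 1 * exp (25/4) * K * exp (- (\<tau> / 4))" using absorb[of 1 \<tau> P] \<tau> by (simp add: P_def mult_ac)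
    also have "\<dots> \<le> 9 * real (j + 2) * exp (25/4) * K * exp (- (\<tau> / 4))" using K by (intro mult_right_mono) auto
    finally show "norm (gg T j v z) \<le> C * exp (- (sqrt (T * v) / 4))" by (simp add: C_def \<tau>_def)
    have ediff: "norm (e - e0) \<le> exp (5 - \<tau> / 2) * (P\<^sup>2 * (9 * P\<^sup>2 * \<Delta>))"
    proof -
      have e0': "e0 = exp (of_real (- (T * v / (2 * pi))))" unfolding e0_def exp_of_real ..
      have "norm (e - e0) \<le> exp (5 - \<tau> / 2) * norm (- (of_real T * (of_real v / D)) - of_real (- (T * v / (2 * pi))))"
        unfolding e_def e0' using f(6,7) by (intro norm_exp_diff_le) auto
      also have "- (of_real T * (of_real v / D)) - of_real (- (T * v / (2 * pi))) = of_real (T * v) * - (1 / D - 1 / of_real (2 * pi))"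
        by (simp add: algebra_simps)
      also have "norm \<dots> = T * v * norm (1 / D - 1 / of_real (2 * pi))"
        unfolding norm_mult norm_minus_cancel norm_of_real using * by simp
      also have "\<dots> \<le> P\<^sup>2 * (9 * P\<^sup>2 * \<Delta>)"
        unfolding \<tau>(2)[symmetric] using f(5) v9 \<tau>P by (intro mult_mono) (auto intro: order_trans)
      finally show ?thesis by simp
    qed
    have qdiff: "norm (q - q0) \<le> real (j + 1) * P ^ j * (9 * P\<^sup>2 * \<Delta>)"
    proof -
      let ?S = "rt v z" and ?p = "complex_of_real pi"
      have S0: "?S \<noteq> 0" using f(3) by auto
      have "q - q0 = (?S ^ j - ?p ^ j) / ?S + ?p ^ j * ((?p - ?S) / (?S * ?p))"
        using S0 by (simp add: q_def q0_def field_simps)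
      also have "norm \<dots> \<le> real j * P ^ j * norm (?S - ?p) + P ^ j * norm (?S - ?p)"
      proof (intro norm_triangle_le add_mono norm_mult_mono)
        have "norm (?S ^ j - ?p ^ j) \<le> real j * P ^ j * norm (?S - ?p)"
          using f(2) P pi_less_4 \<tau> by (intro norm_power_diff_le) (auto simp: P_def)
        moreover have "norm ((?S ^ j - ?p ^ j) / ?S) \<le> norm (?S ^ j - ?p ^ j) / 1"
          unfolding norm_divide using f(3) by (intro divide_left_mono) auto
        ultimately show "norm ((?S ^ j - ?p ^ j) / ?S) \<le> real j * P ^ j * norm (?S - ?p)" by simp
        show "norm (?p ^ j) \<le> P ^ j" unfolding norm_power
          using pi_less_4 \<tau> by (intro power_mono) (auto simp: P_def)
        have "1 \<le> norm ?S * pi" using mult_mono[of 1 "norm ?S" 1 pi] f(3) pi_gt3 by simp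
        then have "norm (?p - ?S) / (norm ?S * pi) \<le> norm (?p - ?S) / 1" using S0 by (intro divide_left_mono) auto
        then show "norm ((?p - ?S) / (?S * ?p)) \<le> norm (?S - ?p)"
          by (simp add: norm_divide norm_mult norm_minus_commute)
      qed
      also have "\<dots> = real (j + 1) * P ^ j * norm (?S - ?p)" by (simp add: algebra_simps)
      also have "\<dots> \<le> real (j + 1) * P ^ j * (9 * P\<^sup>2 * \<Delta>)"
      proof (rule mult_left_mono)
        show "norm (?S - ?p) \<le> 9 * P\<^sup>2 * \<Delta>" using f(4) v9 norm_ge_zero[of z] by linarith
      qed (use P in auto)
      finally show ?thesis .
    qed
    have "gg T j v z - of_real (pi ^ j / pi * exp (- (T * v / (2 * pi)))) = (e - e0) * q + e0 * (q - q0)"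
      unfolding gg by (simp add: e0_def q0_def algebra_simps)
    also have "norm \<dots> \<le> exp (5 - \<tau> / 2) * (P\<^sup>2 * (9 * P\<^sup>2 * \<Delta>)) * P ^ j + exp (5 - \<tau> / 2) * (real (j + 1) * P ^ j * (9 * P\<^sup>2 * \<Delta>))"
      by (intro norm_triangle_le add_mono norm_mult_mono ediff nq ne0 qdiff)
    also have "\<dots> = 9 * \<Delta> * P ^ (j + 4) * exp (5 - \<tau> / 2) + 9 * real (j + 1) * \<Delta> * P ^ (j + 2) * exp (5 - \<tau> / 2)"
      by (simp add: power_add eval_nat_numeral mult_ac)
    also have "\<dots> \<le> 9 * \<Delta> * P ^ (j + 4) * exp (5 - \<tau> / 2) + 9 * real (j + 1) * \<Delta> * P ^ (j + 4) * exp (5 - \<tau> / 2)"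
      using \<Delta> P by (intro add_left_mono mult_right_mono mult_left_mono power_increasing) auto
    also have "\<dots> = (9 * real (j + 2) * \<Delta>) * P ^ (j + 4) * exp (5 - \<tau> / 2)" by (simp add: algebra_simps)
    also have "\<dots> \<le> (9 * real (j + 2) * \<Delta>) * exp (25/4) * K * exp (- (\<tau> / 4))"
      using \<Delta> \<tau> by (intro absorb) (auto simp: P_def)
    finally show "norm (gg T j v z - of_real (pi ^ j / pi * exp (- (T * v / (2 * pi)))))
        \<le> C * (norm z + 1 / T) * exp (- (sqrt (T * v) / 4))"
      by (simp add: C_def \<tau>_def \<Delta>_def mult_ac)
  qed
qed

section \<open>The loop integral as a Laplace integral\<close>

lemma norm_cis_minus_1_le: "norm (cis t - 1) \<le> \<bar>t\<bar>"
proof -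
  have "norm (exp (\<i> * of_real t) - exp 0) \<le> exp 0 * norm (\<i> * of_real t - 0)"
    by (intro norm_exp_diff_le) auto
  then show ?thesis by (simp add: cis_conv_exp norm_mult)
qed

text \<open>This is the shape required by \<open>laplace_circle\<close>: the pole z^(-p) with p = n
  + k - 1 splits into h^(-p) and the oscillation cis(-p t).\<close>

lemma circle_integrand_eq:
  fixes h R t :: real
  assumes n: "n \<ge> 1" and v: "v \<ge> 0" and h: "0 < h" "h < 1"
  defines "T \<equiv> R * saddle_omega h"
  defines "z \<equiv> of_real h * cis t"
  shows "kerG T R (n + k) k j v (\<i> * rt v z) * (of_real pi - z) / rt v z * z =
    (- 1) ^ k * \<i> ^ j * of_real (exp (- saddle_action R h) / h ^ (n + k - 1)) *
    (of_real (exp (- (2 * pi * R / h * (1 - cos t)))) *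
     exp (of_real R * (cotk z - cotk (of_real h) - deriv cotk (of_real h) * (z - of_real h))) *
     (camp (n + k) k z * gg T j v z) * cis (- (real (n + k - 1) * t)))"
proof -
  let ?d = "saddle_action R h" and ?m = "2 * pi * R / h * (1 - cos t)"
  let ?w = "of_real R * (cotk z - cotk (of_real h) - deriv cotk (of_real h) * (z - of_real h))"
  have z: "norm z \<le> 1" "z \<noteq> 0" using h by (auto simp: z_def norm_mult)
  have "- (of_real T * rt v z) + of_real R * (of_real pi / z + cotk z) =
    (- (of_real T * (of_real pi - z)) + of_real R * (of_real pi / z + cotk z)) + - (of_real T * (rt v z - (of_real pi - z)))"
    by (simp add: algebra_simps)
  also have "- (of_real T * (of_real pi - z)) + of_real R * (of_real pi / z + cotk z) = - of_real ?d - of_real ?m + ?w"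
    unfolding T_def z_def by (rule saddle_exponent[OF h])
  also have "exp (- complex_of_real ?d - of_real ?m + ?w + - (of_real T * (rt v z - (of_real pi - z))))
     = of_real (exp (- ?d)) * of_real (exp (- ?m)) * exp ?w * exp (- (of_real T * (rt v z - (of_real pi - z))))"
  proof -
    have "exp (- complex_of_real ?d - of_real ?m + ?w + - (of_real T * (rt v z - (of_real pi - z))))
      = exp (of_real (- ?d)) * exp (of_real (- ?m)) * exp ?w * exp (- (of_real T * (rt v z - (of_real pi - z))))"
      unfolding exp_add[symmetric] by simp
    then show ?thesis unfolding exp_of_real .
  qed
  finally have e: "exp (- (of_real T * rt v z) + of_real R * (of_real pi / z + cotk z)) =
     of_real (exp (- ?d)) * of_real (exp (- ?m)) * exp ?w * exp (- (of_real T * (rt v z - (of_real pi - z))))" .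
  have zp: "1 / z ^ p = cis (- (real p * t)) / of_real (h ^ p)" for p
  proof -
    have 1: "z ^ p = of_real (h ^ p) * cis (real p * t)" 
      unfolding z_def power_mult_distrib Complex.DeMoivre of_real_power ..
    have 2: "1 / cis (real p * t) = cis (- (real p * t))" by (metis cis_inverse inverse_eq_divide)
    have 3: "1 / (a * b) = (1 / b) / a" for a b :: complex by simp
    show ?thesis unfolding 1 3 2 ..
  qed
  have alg1: "a / b = a * (1 / b)" for a b :: complex by simp
  have alg2: "a * b * (d * m * w * x) * c * q * (s / y) = a * b * (d / y) * (m * w * (c * (x * q)) * s)"
    for a b c d m q s w x y :: complex by (simp add: mult_ac)
  have "kerG T R (n + k) k j v (\<i> * rt v z) * (of_real pi - z) / rt v z * z =
     (- 1) ^ k * \<i> ^ j * (of_real (exp (- ?d)) * of_real (exp (- ?m)) * exp ?w * exp (- (of_real T * (rt v z - (of_real pi - z))))) *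
      camp (n + k) k z * (rt v z ^ j / rt v z) * (1 / z ^ (n + k - 1))"
    unfolding kerG_on_circle[OF n v z] e by (rule alg1)
  also have "\<dots> = (- 1) ^ k * \<i> ^ j * (of_real (exp (- ?d)) / of_real (h ^ (n + k - 1))) *
    (of_real (exp (- ?m)) * exp ?w *
     (camp (n + k) k z * (exp (- (of_real T * (rt v z - (of_real pi - z)))) * (rt v z ^ j / rt v z))) * cis (- (real (n + k - 1) * t)))"
    unfolding zp by (rule alg2)
  finally show ?thesis unfolding gg_def of_real_divide .
qed

abbreviation loop_integral :: "nat \<Rightarrow> nat \<Rightarrow> nat \<Rightarrow> real \<Rightarrow> real \<Rightarrow> real \<Rightarrow> real \<Rightarrow> complex" where
  "loop_integral n k j R T h v \<equiv> integral {-pi..pi} (\<lambda>t. kerG T R (n + k) k j v (\<i> * rt v (h * cis t)) *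
     (of_real pi - h * cis t) / rt v (h * cis t) * (h * cis t))"

text \<open>\<open>pi ^ (n + k + 1)\<close> is the amplitude \<open>camp\<close> at z = 0, and
  \<open>pi ^ j / pi\<close> is \<open>rt^j / rt\<close> at z = 0, v = 0.\<close>

abbreviation inner_main :: "nat \<Rightarrow> nat \<Rightarrow> nat \<Rightarrow> real \<Rightarrow> real \<Rightarrow> real \<Rightarrow> real \<Rightarrow> real \<Rightarrow> complex" where
  "inner_main n k j R T M h v \<equiv> (- 1) ^ k * \<i> ^ j * of_real (exp (- saddle_action R h) / h ^ (n + k - 1)) *
     of_real (pi ^ (n + k + 1) * (pi ^ j / pi) * exp (- (T * v / (2 * pi))) * sqrt (2 * pi / M))"

abbreviation inner_err :: "nat \<Rightarrow> nat \<Rightarrow> real \<Rightarrow> real \<Rightarrow> real \<Rightarrow> real \<Rightarrow> real \<Rightarrow> real \<Rightarrow> real" where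
  "inner_err n k C R T M h v \<equiv> C * (exp (- saddle_action R h) / h ^ (n + k - 1)) * (h + 1 / T + 1 / M) * exp (- (sqrt (T * v) / 4)) / sqrt M"

lemma circle_estimate:
  assumes n: "n \<ge> 1"
  obtains C h0 where "C > 0" "0 < h0" "h0 < 1"
    "\<And>R h T M v. R > 0 \<Longrightarrow> 0 < h \<Longrightarrow> h < h0 \<Longrightarrow>
      T = R * saddle_omega h \<Longrightarrow> M = 2 * pi * R / h \<Longrightarrow> T \<ge> 1 \<Longrightarrow> v \<ge> 0 \<Longrightarrow>
      norm (loop_integral n k j R T h v
        - inner_main n k j R T M h v)
      \<le> inner_err n k C R T M h v"
proof (rule holomorphic_taylor_bounds[OF cotk_holomorphic],
    rule holomorphic_taylor_bounds[OF camp_holomorphic[of "n + k" k]], rule gg_estimate[of j], goal_cases)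
  case hyps: (1 Ck Ca Cg)
  note Ck = hyps(2,4) and Ca = hyps(5,6) and Cg = hyps(8-10)
  define A where "A = pi ^ (n + k + 1)"
  have A: "A > 0" by (simp add: A_def)
  define p where "p = n + k - 1"
  \<comment> \<open>The first two summands bound \<open>F\<close> and its deviation from
    \<open>F0\<close>; the last bounds \<open>F0\<close>, with \<open>exp 5\<close> from comparing
    the Gaussian with exp(-sqrt(T v) / 4).\<close>
  define CB where "CB = Ca * Cg + A * Cg + A * (pi ^ j / pi * exp 5)"
  have CB: "CB > 0" using Ca Cg A by (simp add: CB_def add_pos_nonneg)
  \<comment> \<open>Ensures Ck h <= 1/24, the smallness that \<open>laplace_circle\<close> demands
    of the phase perturbation.\<close>
  define h0 where "h0 = min (1/2) (1 / (24 * Ck))"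
  have h0: "0 < h0" "h0 < 1" using Ck by (auto simp: h0_def)
  define L where "L = 48 * Ck + 1 + (24 * (real p)\<^sup>2 + 97)"
  have L: "L > 0" using Ck by (simp add: L_def add_pos_nonneg)
  define C where "C = L * CB * sqrt (48 * pi)"
  show thesis
  proof (rule that[of C h0])
    show "C > 0" using L CB by (simp add: C_def)
    show "0 < h0" "h0 < 1" by fact+
    fix R h T M v :: real
    assume R: "R > 0" and h: "0 < h" "h < h0" and T_def: "T = R * saddle_omega h"
      and M_def: "M = 2 * pi * R / h" and T: "T \<ge> 1" and v: "v \<ge> 0"
    have h1: "h < 1" using h h0 by simp
    have M: "M > 0" using R h by (simp add: M_def)
    define z where "z t = complex_of_real h * cis t" for t
    have nz: "norm (z t) = h" for t using h by (simp add: z_def norm_mult)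
    have z1: "norm (z t) \<le> 1" for t using nz h1 by simp
    define w where "w t = of_real R * (cotk (z t) - cotk (of_real h) - deriv cotk (of_real h) * (z t - of_real h))" for t
    define F where "F t = camp (n + k) k (z t) * gg T j v (z t)" for t
    define E where "E = exp (- (sqrt (T * v) / 4))"
    define g0 where "g0 = pi ^ j / pi * exp (- (T * v / (2 * pi)))"
    define F0 where "F0 = complex_of_real (A * g0)"
    define \<eta> where "\<eta> = Ck * h"
    define \<delta> where "\<delta> = h + 1 / T"
    define B where "B = CB * E"
    have \<eta>: "0 \<le> \<eta>" "\<eta> \<le> 1 / 24"
    proof -
      have "h \<le> 1 / (24 * Ck)" using h by (simp add: h0_def)
      then show "\<eta> \<le> 1 / 24" using Ck(1) by (simp add: \<eta>_def field_simps)
    qed (use Ck h in \<open>simp add: \<eta>_def\<close>)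
    have \<delta>: "0 \<le> \<delta>" using h T by (simp add: \<delta>_def)
    have E: "E > 0" by (simp add: E_def)
    have camp_near: "norm (camp (n + k) k (z t) - of_real A) \<le> Ca * h" for t
      using Ca(2)[of "z t" 0] z1 nz by (simp add: A_def)
    have camp_bd: "norm (camp (n + k) k (z t)) \<le> Ca + A" for t
    proof -
      have "norm (camp (n + k) k (z t)) \<le> norm (camp (n + k) k (z t) - of_real A) + norm (complex_of_real A)"
        using norm_triangle_sub[of "camp (n + k) k (z t)" "complex_of_real A"] by linarith
      also have "norm (complex_of_real A) = A" using A by simp
      also have "norm (camp (n + k) k (z t) - of_real A) \<le> Ca * 1"
        using camp_near[of t] mult_left_mono[of h 1 Ca] h1 Ca by linarith
      finally show ?thesis by simp
    qed
    have gb: "norm (gg T j v (z t)) \<le> Cg * E" for t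
      unfolding E_def using T v z1 by (intro Cg)
    have gn: "norm (gg T j v (z t) - of_real g0) \<le> Cg * \<delta> * E" for t
      using Cg(3)[OF T v z1[of t]] unfolding nz by (simp add: g0_def \<delta>_def E_def)
    have w_bd: "norm (w t) \<le> \<eta> * M * t\<^sup>2" for t
    proof -
      have "norm (z t - of_real h) = h * norm (cis t - 1)"
      proof -
        have "z t - of_real h = of_real h * (cis t - 1)" by (simp add: z_def algebra_simps)
        then show ?thesis using h by (simp add: norm_mult)
      qed
      also have "\<dots> \<le> h * \<bar>t\<bar>" using norm_cis_minus_1_le h by (intro mult_left_mono) auto
      finally have "(norm (z t - of_real h))\<^sup>2 \<le> (h * \<bar>t\<bar>)\<^sup>2" by (intro power_mono) auto
      then have zt: "Ck * (norm (z t - of_real h))\<^sup>2 \<le> Ck * (h\<^sup>2 * t\<^sup>2)"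
        using Ck by (intro mult_left_mono) (auto simp: power_mult_distrib)
      have "norm (w t) \<le> R * (Ck * (norm (z t - of_real h))\<^sup>2)"
        unfolding w_def using R z1 h h1 by (intro norm_mult_mono Ck) auto
      also have "\<dots> \<le> R * (Ck * (h\<^sup>2 * t\<^sup>2))" by (rule mult_left_mono[OF zt]) (use R in simp)
      also have "\<dots> = (Ck * h * t\<^sup>2) * (R * h)" by (simp add: power2_eq_square)
      also have "\<dots> \<le> (Ck * h * t\<^sup>2) * M"
      proof (rule mult_left_mono)
        have "R * h * h \<le> R * 1 * 1" using R h h1 by (intro mult_mono) auto
        also have "\<dots> \<le> 2 * pi * R" using R pi_gt3 by simp
        finally show "R * h \<le> M" using h by (simp add: M_def field_simps)
      qed (use Ck h in auto)
      finally show ?thesis by (simp add: \<eta>_def mult_ac)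
    qed
    have F_near: "norm (F t - F0) \<le> \<delta> * B" for t
    proof -
      have "F t - F0 = (camp (n + k) k (z t) - of_real A) * gg T j v (z t) + of_real A * (gg T j v (z t) - of_real g0)"
        by (simp add: F_def F0_def algebra_simps)
      also have "norm \<dots> \<le> Ca * h * (Cg * E) + A * (Cg * \<delta> * E)"
        using A by (intro norm_triangle_le add_mono norm_mult_mono camp_near gb gn) simp_all
      also have "\<dots> \<le> Ca * \<delta> * (Cg * E) + A * (Cg * \<delta> * E)"
        using Ca Cg E T by (intro add_right_mono mult_right_mono mult_left_mono) (auto simp: \<delta>_def)
      also have "\<dots> = \<delta> * ((Ca * Cg + A * Cg) * E)" by (simp add: algebra_simps)
      also have "\<dots> \<le> \<delta> * (CB * E)"
        using Ca Cg A E \<delta> by (intro mult_left_mono mult_right_mono) (auto simp: CB_def)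
      finally show ?thesis by (simp add: B_def)
    qed
    have F_bd: "norm (F t) \<le> B" for t
    proof -
      have "norm (F t) \<le> (Ca + A) * (Cg * E)" unfolding F_def by (intro norm_mult_mono camp_bd gb)
      also have "\<dots> = (Ca * Cg + A * Cg) * E" by (simp add: algebra_simps)
      also have "\<dots> \<le> CB * E"
        using Ca Cg A E by (intro mult_right_mono) (auto simp: CB_def)
      finally show ?thesis by (simp add: B_def)
    qed
    have F0_bd: "norm F0 \<le> B"
    proof -
      have "norm F0 = A * (pi ^ j / pi) * exp (- (T * v / (2 * pi)))"
        unfolding F0_def norm_of_real g0_def using A by (simp add: abs_mult)
      also have "\<dots> \<le> A * (pi ^ j / pi) * exp (5 + - (sqrt (T * v) / 4))"
      proof (intro mult_left_mono)
        have "sqrt (T * v) \<ge> 0" using T v by simp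
        then have "- (T * v / (2 * pi)) \<le> 5 + - (sqrt (T * v) / 4)"
          using rt_facts(7)[OF T v z1[of 0]] by linarith
        then show "exp (- (T * v / (2 * pi))) \<le> exp (5 + - (sqrt (T * v) / 4))" unfolding exp_le_cancel_iff .
      qed (use A in auto)
      also have "\<dots> = A * (pi ^ j / pi * exp 5) * E" unfolding exp_add E_def by simp
      also have "\<dots> \<le> CB * E" using Ca Cg A E by (intro mult_right_mono) (auto simp: CB_def)
      finally show ?thesis by (simp add: B_def)
    qed
    have contz: "continuous_on {-pi..pi} z" unfolding z_def[abs_def] by (intro continuous_intros)
    have zball: "z ` {-pi..pi} \<subseteq> ball 0 3" using nz h1 by auto
    have cont_w: "continuous_on {-pi..pi} w"
      unfolding w_def[abs_def]
      by (intro continuous_intros contz continuous_on_compose2[OF holomorphic_on_imp_continuous_on[OF cotk_holomorphic] contz zball])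
    have cont_F: "continuous_on {-pi..pi} F"
    proof -
      have "continuous_on (cball 0 1) (rt v)"
        by (rule continuous_at_imp_continuous_on) (auto intro!: DERIV_isCont has_field_derivative_rt v)
      then have "continuous_on {-pi..pi} (\<lambda>t. rt v (z t))"
        by (rule continuous_on_compose2[OF _ contz]) (use z1 in auto)
      moreover have "rt v (z t) \<noteq> 0" for t using Re_rt[OF v z1[of t]] by auto
      ultimately show ?thesis unfolding F_def[abs_def] gg_def
        by (intro continuous_intros contz continuous_on_compose2[OF holomorphic_on_imp_continuous_on[OF camp_holomorphic] contz zball]) auto
    qed
    define d where "d = exp (- saddle_action R h) / h ^ p"
    have d: "d > 0" using h by (simp add: d_def)
    define c where "c = (- 1) ^ k * \<i> ^ j * complex_of_real d"
    have nc: "norm c = d" using d by (simp add: c_def norm_mult norm_power)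
    define I where "I = integral {-pi..pi} (\<lambda>t. of_real (exp (- (M * (1 - cos t)))) * exp (w t) * F t * cis (- (real p * t)))"
    have "loop_integral n k j R T h v =
       integral {-pi..pi} (\<lambda>t. c * (of_real (exp (- (M * (1 - cos t)))) * exp (w t) * F t * cis (- (real p * t))))"
      unfolding T_def circle_integrand_eq[OF n v h(1) h1]
      unfolding T_def[symmetric] c_def d_def p_def w_def F_def z_def M_def ..
    also have "\<dots> = c * I" unfolding I_def by (rule integral_mult_right)
    finally have "loop_integral n k j R T h v - c * of_real (A * g0 * sqrt (2 * pi / M))
       = c * (I - F0 * of_real (sqrt (2 * pi / M)))"
      by (simp add: F0_def algebra_simps)
    also have "norm \<dots> \<le> d * ((48 * \<eta> + \<delta> + (24 * (real p)\<^sup>2 + 97) / M) * B * sqrt (48 * pi / M))"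
      unfolding norm_mult nc I_def using d
      by (intro mult_left_mono laplace_circle[OF M \<eta> \<delta> w_bd F_near F_bd F0_bd cont_w cont_F]) auto
    also have "\<dots> \<le> d * ((L * (h + 1 / T + 1 / M)) * B * sqrt (48 * pi / M))"
    proof -
      have "48 * \<eta> + \<delta> + (24 * (real p)\<^sup>2 + 97) / M \<le> L * (h + 1 / T + 1 / M)"
      proof -
        have 1: "48 * \<eta> + h \<le> L * h"
          unfolding \<eta>_def L_def using h by (simp add: algebra_simps)
        have "1 \<le> L" using Ck by (simp add: L_def)
        then have 2: "1 / T \<le> L * (1 / T)" using T mult_right_mono[of 1 L "1 / T"] by simp
        have "24 * (real p)\<^sup>2 + 97 \<le> L" using Ck by (simp add: L_def)
        then have 3: "(24 * (real p)\<^sup>2 + 97) / M \<le> L / M" using M by (intro divide_right_mono) auto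
        have "L * (h + 1 / T + 1 / M) = L * h + L * (1 / T) + L / M" by (simp add: distrib_left)
        then show ?thesis using add_mono[OF add_mono[OF 1 2] 3] unfolding \<delta>_def by (simp only: add.assoc)
      qed
      then show ?thesis using d CB E M by (intro mult_left_mono mult_right_mono) (auto simp: B_def)
    qed
    also have "\<dots> = C * d * (h + 1 / T + 1 / M) * E / sqrt M"
      by (simp add: C_def B_def real_sqrt_divide)
    finally show "norm (loop_integral n k j R T h v
        - inner_main n k j R T M h v)
      \<le> inner_err n k C R T M h v"
      unfolding c_def d_def p_def A_def g0_def E_def by (simp only: mult.assoc)
  qed
qed

section \<open>The inner integral\<close>

text \<open>The decay is exp(-T Y) at height Y, and the point of the constants is that 32/25 exceeds
  1: the rate beats pi T, which bounds d^2 / 4, while enough decay in sqrt(T v) is kept.\<close>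

lemma line_estimate:
  assumes n: "n \<ge> 1"
  obtains C D where "C > 0" "D > 0"
    "\<And>R T v. R \<ge> 0 \<Longrightarrow> T \<ge> 1 \<Longrightarrow> v \<ge> 0 \<Longrightarrow>
      norm (LINT x|lborel. kerG T R (n + k) k j v (Complex x (sqrt ((3 * pi / 2)\<^sup>2 + v))))
        \<le> C * exp (D * R) * exp (- (32 / 25 * pi * T)) * exp (- (sqrt (T * v) / 4))"
proof (rule norm_kerF_le_parabola[OF n, of k], goal_cases)
  case hyps: (1 C D)
  note CD = hyps(2-)
  \<comment> \<open>The rate 1/20 lets l^j be absorbed at the price of replacing T by T - 1/20,
    which is at least 19/20 T.\<close>
  define K where "K = (real (Suc j) / (1/20)) ^ j"
  have K: "K > 0" by (simp add: K_def)
  show thesis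
  proof (rule that[of "8 * C * K" D])
    show "8 * C * K > 0" "D > 0" using CD K by auto
    fix R T v :: real assume R: "R \<ge> 0" and T: "T \<ge> 1" and v: "v \<ge> 0"
    define Y where "Y = sqrt ((3 * pi / 2)\<^sup>2 + v)"
    define G where "G x = kerG T R (n + k) k j v (Complex x Y)" for x
    have Y2: "Y\<^sup>2 = (3 * pi / 2)\<^sup>2 + v" using v by (simp add: Y_def)
    have Y0: "Y \<ge> 3 * pi / 2" unfolding Y_def using v by (intro real_le_rsqrt) simp
    have Yp: "Y \<ge> 0" using Y0 pi_gt_zero by linarith
    \<comment> \<open>Cauchy-Schwarz with the vector (9/10, 4/10), of squared length 97/100. After
      multiplication by 19/20 this gives 513/400 >= 32/25 in front of pi T, and 38/100 >= 1/4 in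
      front of T sqrt v.\<close>
    have Y1: "Y \<ge> 9 / 10 * (3 * pi / 2) + 4 / 10 * sqrt v"
      unfolding Y_def
    proof (rule real_le_rsqrt)
      have id: "(9 / 10 * a + 4 / 10 * b)\<^sup>2 = 97 / 100 * (a\<^sup>2 + b\<^sup>2) - (4 / 10 * a - 9 / 10 * b)\<^sup>2" for a b :: real
        by (simp add: power2_eq_square field_simps)
      have aux: "97 / 100 * X - Z \<le> X" if "X \<ge> 0" "Z \<ge> 0" for X Z :: real using that by linarith
      have "(9 / 10 * (3 * pi / 2) + 4 / 10 * sqrt v)\<^sup>2 \<le> (3 * pi / 2)\<^sup>2 + (sqrt v)\<^sup>2"
        unfolding id by (intro aux add_nonneg_nonneg zero_le_power2)
      then show "(9 / 10 * (3 * pi / 2) + 4 / 10 * sqrt v)\<^sup>2 \<le> (3 * pi / 2)\<^sup>2 + v"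
        using v by simp
    qed
    define B where "B = C * exp (D * R) * K * exp (- ((T - 1 / 20) * Y))"
    have B: "B > 0" using CD K by (simp add: B_def)
    have pt: "norm (G x) \<le> B * exp (- (1/4 * \<bar>x\<bar>))" for x
    proof -
      let ?l = "Complex x Y"
      have "Re (?l\<^sup>2 + of_real v) = \<bar>x\<bar>\<^sup>2 - (3 * pi / 2)\<^sup>2" using Y2 by (simp add: Re_power2)
      moreover have "\<bar>Im (?l\<^sup>2 + of_real v)\<bar> \<ge> 3 * pi * \<bar>x\<bar>"
      proof -
        have "3 * pi * \<bar>x\<bar> \<le> 2 * Y * \<bar>x\<bar>" using Y0 by (intro mult_right_mono) auto
        also have "\<dots> = \<bar>Im (?l\<^sup>2 + of_real v)\<bar>" using Yp by (simp add: Im_power2 abs_mult)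
        finally show ?thesis .
      qed
      ultimately have 1: "norm (kerF R (n + k) k (?l\<^sup>2 + of_real v)) \<le> C * exp (D * R) * exp (- \<bar>x\<bar> / 2)"
        using R by (intro CD) auto
      have 2: "norm (exp (\<i> * of_real T * ?l)) \<le> exp (- (T * Y))" by (simp add: norm_exp_eq_Re)
      have "norm ?l \<le> \<bar>x\<bar> + Y" using cmod_le[of ?l] Yp by simp
      then have "norm (?l ^ j) \<le> (\<bar>x\<bar> + Y) ^ j" by (simp add: norm_power power_mono)
      also have "\<dots> \<le> K * exp (1/20 * (\<bar>x\<bar> + Y))"
        unfolding K_def using Yp by (intro exp_ge_power) auto
      finally have "norm (G x) \<le> (exp (- (T * Y)) * (C * exp (D * R) * exp (- \<bar>x\<bar> / 2))) * (K * exp (1/20 * (\<bar>x\<bar> + Y)))"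
        unfolding G_def kerG_def by (intro norm_mult_mono 1 2)
      also have "\<dots> = C * exp (D * R) * K * (exp (- (T * Y)) * exp (- \<bar>x\<bar> / 2) * exp (1/20 * (\<bar>x\<bar> + Y)))" by simp
      also have "\<dots> \<le> C * exp (D * R) * K * (exp (- ((T - 1 / 20) * Y)) * exp (- (1/4 * \<bar>x\<bar>)))"
      proof (rule mult_left_mono)
        have "- (T * Y) + - \<bar>x\<bar> / 2 + 1/20 * (\<bar>x\<bar> + Y) \<le> - ((T - 1 / 20) * Y) + - (1/4 * \<bar>x\<bar>)"
          by (simp add: algebra_simps)
        then show "exp (- (T * Y)) * exp (- \<bar>x\<bar> / 2) * exp (1/20 * (\<bar>x\<bar> + Y)) \<le> exp (- ((T - 1 / 20) * Y)) * exp (- (1/4 * \<bar>x\<bar>))"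
          unfolding exp_add[symmetric] exp_le_cancel_iff .
      qed (use CD K in auto)
      finally show ?thesis by (simp add: B_def mult_ac)
    qed
    have gi: "has_bochner_integral lborel (\<lambda>x. B * exp (- (1/4 * \<bar>x\<bar>))) (B * (2 / (1/4)))"
      by (intro has_bochner_integral_mult_right has_bochner_integral_exp_abs) auto
    have "norm (LINT x|lborel. G x) \<le> 8 * B"
    proof (cases "integrable lborel G")
      case True
      have "norm (LINT x|lborel. G x) \<le> (LINT x|lborel. norm (G x))" by (rule integral_norm_bound)
      also have "\<dots> \<le> (LINT x|lborel. B * exp (- (1/4 * \<bar>x\<bar>)))"
        by (rule integral_mono) (use True gi pt in \<open>auto simp: has_bochner_integral_iff\<close>)
      also have "\<dots> = 8 * B" using gi by (simp add: has_bochner_integral_iff)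
      finally show ?thesis .
    next
      case False
      \<comment> \<open>A non-integrable function has integral 0 by convention, and \<open>B\<close>
        is positive.\<close>
      then show ?thesis using B by (simp add: not_integrable_integral_eq)
    qed
    also have "8 * B \<le> 8 * (C * exp (D * R) * K * (exp (- (32 / 25 * pi * T)) * exp (- (sqrt (T * v) / 4))))"
      unfolding B_def
    proof (intro mult_left_mono)
      have "sqrt (T * v) = sqrt T * sqrt v" by (rule real_sqrt_mult)
      also have "\<dots> \<le> T * sqrt v"
      proof (rule mult_right_mono)
        show "sqrt T \<le> T" using T by (intro real_le_lsqrt) (auto simp: power2_eq_square)
      qed (use v in auto)
      finally have 1: "sqrt (T * v) \<le> T * sqrt v" .
      have "(T - 1/20) * Y \<ge> (19 / 20 * T) * Y" using T Yp by (intro mult_right_mono) auto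
      moreover have "(19 / 20 * T) * Y \<ge> (19 / 20 * T) * (9 / 10 * (3 * pi / 2) + 4 / 10 * sqrt v)"
        using T Y1 by (intro mult_left_mono) auto
      moreover have "(19 / 20 * T) * (9 / 10 * (3 * pi / 2) + 4 / 10 * sqrt v) = 513 / 400 * (pi * T) + 38 / 100 * (T * sqrt v)"
        by (simp add: algebra_simps)
      moreover have "pi * T \<ge> 0" "T * sqrt v \<ge> 0" using T v by auto
      ultimately have "(T - 1/20) * Y \<ge> 32 / 25 * pi * T + sqrt (T * v) / 4" using 1 by linarith
      then show "exp (- ((T - 1/20) * Y)) \<le> exp (- (32 / 25 * pi * T)) * exp (- (sqrt (T * v) / 4))"
        unfolding exp_add[symmetric] exp_le_cancel_iff by linarith
    qed (use CD K in auto)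
    finally show "norm (LINT x|lborel. kerG T R (n + k) k j v (Complex x (sqrt ((3 * pi / 2)\<^sup>2 + v))))
        \<le> 8 * C * K * exp (D * R) * exp (- (32 / 25 * pi * T)) * exp (- (sqrt (T * v) / 4))"
      by (simp add: G_def Y_def mult_ac)
  qed
qed

text \<open>All three follow from the sizes of the two positive terms of
  \<open>saddle_omega\<close>. They serve to discard the shifted line: the first tames exp(D R), the
  second compares the line with the saddle value, the third trades a power of 1/T for
  M^(-1/2).\<close>

lemma saddle_size:
  fixes h R :: real
  assumes h: "0 < h" "h < 1" and R: "R > 0"
  defines "T \<equiv> R * saddle_omega h"
  shows "R \<le> T * h\<^sup>2 / 2" "saddle_action R h \<le> pi * T" "2 * pi * R / h \<le> 4 * T"
proof -
  have s: "sin h > 0" using h pi_gt3 by (intro sin_gt_zero) auto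
  have c: "cos h > 0" using h pi_gt3 by (intro cos_gt_zero) auto
  have se: "(sin h)\<^sup>2 \<le> h\<^sup>2" using s h sin_x_le_x[of h] by (intro power_mono) auto
  have "2 / h\<^sup>2 \<le> (pi - h) / (sin h)\<^sup>2" using se s h pi_gt3 by (intro frac_le) auto
  then have "2 / h\<^sup>2 \<le> saddle_omega h" using divide_pos_pos[OF c s] by linarith
  then have 0: "R * (2 / h\<^sup>2) \<le> T" unfolding T_def using R by (intro mult_left_mono) auto
  have T: "T \<ge> 0" by (rule order_trans[OF _ 0]) (use R in simp)
  from 0 show 1: "R \<le> T * h\<^sup>2 / 2" using h by (simp add: field_simps)
  have "(pi - h)\<^sup>2 / (sin h)\<^sup>2 \<le> pi * (pi - h) / (sin h)\<^sup>2"
    using h pi_gt3 by (intro divide_right_mono) (auto simp: power2_eq_square)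
  also have "\<dots> \<le> pi * (pi - h) / (sin h)\<^sup>2 + pi * (cos h / sin h)"
  proof -
    have "0 \<le> pi * (cos h / sin h)" using c s by (intro mult_nonneg_nonneg divide_nonneg_nonneg) auto
    then show ?thesis by linarith
  qed
  also have "\<dots> = pi * saddle_omega h" by (simp add: algebra_simps)
  finally have "R * ((pi - h)\<^sup>2 / (sin h)\<^sup>2) \<le> R * (pi * saddle_omega h)"
    using R by (intro mult_left_mono) auto
  then show "saddle_action R h \<le> pi * T" by (simp add: T_def mult_ac)
  have "2 * pi * R / h \<le> 2 * pi * (T * h\<^sup>2 / 2) / h" using 1 h by (intro divide_right_mono mult_left_mono) auto
  also have "\<dots> = (pi * h) * T" using h by (simp add: power2_eq_square)
  also have "\<dots> \<le> 4 * T"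
  proof (rule mult_right_mono[OF _ T])
    show "pi * h \<le> 4" using mult_mono[of pi 4 h 1] pi_less_4 h by simp
  qed
  finally show "2 * pi * R / h \<le> 4 * T" .
qed

lemma inner_estimate:
  assumes n: "n \<ge> 1"
  obtains C h0 where "C > 0" "0 < h0" "h0 < 1"
    "\<And>R h T M v. R > 0 \<Longrightarrow> 0 < h \<Longrightarrow> h < h0 \<Longrightarrow>
      T = R * saddle_omega h \<Longrightarrow> M = 2 * pi * R / h \<Longrightarrow> T \<ge> 1 \<Longrightarrow> v \<ge> 0 \<Longrightarrow>
      norm ((LINT x|lborel. kerG T R (n + k) k j v (of_real x))
        - inner_main n k j R T M h v)
      \<le> inner_err n k C R T M h v"
proof (rule circle_estimate[OF n, of k j], goal_cases)
  case hyps: (1 C h0)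
  note C = hyps(2-)
  show thesis
  proof (rule line_estimate[OF n, of k j], goal_cases)
  case C': (1 C' D)
  \<comment> \<open>With D h <= 1/10, the bound R <= T h^2 / 2 gives D R <= T / 20.\<close>
  define h1 where "h1 = min h0 (1 / (10 * D))"
  show thesis
  proof (rule that[of "C + 50 * C'" h1])
    show "C + 50 * C' > 0" "0 < h1" "h1 < 1" using C C' by (auto simp: h1_def)
    fix R h T M v :: real
    assume R: "R > 0" and h: "0 < h" "h < h1" and T_def: "T = R * saddle_omega h"
      and M_def: "M = 2 * pi * R / h" and T: "T \<ge> 1" and v: "v \<ge> 0"
    have h': "h < h0" "h < 1" "h * D \<le> 1 / 10"
      using h C C' by (auto simp: h1_def field_simps)
    have M: "M > 0" using R h by (simp add: M_def)
    note ss = saddle_size[OF h(1) h'(2) R, folded T_def]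
    define E where "E = exp (- (sqrt (T * v) / 4))"
    define d where "d = saddle_action R h"
    define Q where "Q = (exp (- d) / h ^ (n + k - 1)) * (h + 1 / T + 1 / M) * E / sqrt M"
    define L where "L = (LINT x|lborel. kerG T R (n + k) k j v (Complex x (sqrt ((3 * pi / 2)\<^sup>2 + v))))"
    define I where "I = loop_integral n k j R T h v"
    define P where "P = (- 1) ^ k * \<i> ^ j * of_real (exp (- d) / h ^ (n + k - 1)) *
          complex_of_real (pi ^ (n + k + 1) * (pi ^ j / pi) * exp (- (T * v / (2 * pi))) * sqrt (2 * pi / M))"
    have J: "(LINT x|lborel. kerG T R (n + k) k j v (of_real x)) = L + I"
      using kerG_shift[OF n _ _ v h(1) h'(2), of T R k j] T R
      unfolding L_def I_def complex_of_real_def by simp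
    have Ib: "norm (I - P) \<le> C * Q"
      using C(4)[OF R h(1) h'(1) T_def M_def T v] unfolding I_def P_def Q_def d_def E_def by (simp add: mult.assoc)
    have "norm L \<le> C' * exp (D * R) * exp (- (32 / 25 * pi * T)) * E"
      unfolding L_def E_def using R T v by (intro C') auto
    also have "\<dots> = C' * (exp (D * R) * exp (- (32 / 25 * pi * T))) * E" by simp
    also have "\<dots> \<le> C' * (exp (- d) * (25 / T\<^sup>2)) * E"
    proof (intro mult_right_mono mult_left_mono)
      have "D * R \<le> D * (T * h\<^sup>2 / 2)" using ss(1) C' by (intro mult_left_mono) auto
      also have "\<dots> = (h * D) * h / 2 * T" by (simp add: power2_eq_square)
      also have "\<dots> \<le> (1 / 10 * 1 / 2) * T" using h h' C' T by (intro mult_right_mono divide_right_mono mult_mono) auto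
      finally have DR: "D * R \<le> 1 / 20 * T" by simp
      \<comment> \<open>The surplus of the line is (32/25 - 1) pi T >= 84/100 T; after paying T / 20
        for D R at least 3/5 T remains.\<close>
      have "3 * T \<le> pi * T" using pi_gt3 T by (intro mult_right_mono) auto
      then have "D * R + - (32 / 25 * pi * T) \<le> - d + - (3 / 5 * T)"
        using DR ss(2) T unfolding d_def by linarith
      then have 1: "exp (D * R) * exp (- (32 / 25 * pi * T)) \<le> exp (- d) * exp (- (3 / 5 * T))"
        unfolding exp_add[symmetric] exp_le_cancel_iff .
      have "T\<^sup>2 \<le> (real (Suc 2) / (3 / 5))\<^sup>2 * exp (3 / 5 * T)" using T by (intro exp_ge_power) auto
      then have "exp (- (3 / 5 * T)) \<le> 25 / T\<^sup>2" using T by (simp add: exp_minus field_simps power2_eq_square)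
      then have "exp (- d) * exp (- (3 / 5 * T)) \<le> exp (- d) * (25 / T\<^sup>2)" by (intro mult_left_mono) auto
      with 1 show "exp (D * R) * exp (- (32 / 25 * pi * T)) \<le> exp (- d) * (25 / T\<^sup>2)" by linarith
    qed (use C' in \<open>auto simp: E_def\<close>)
    also have "\<dots> \<le> C' * (exp (- d) * (50 * ((1 / T) / sqrt M))) * E"
    proof (intro mult_right_mono mult_left_mono)
      have "sqrt M \<le> 2 * T"
      proof (rule real_le_lsqrt)
        have "4 * T \<le> 4 * T * T" using T by simp
        then show "M \<le> (2 * T)\<^sup>2" using ss(3) by (simp add: M_def power2_eq_square)
      qed (use T in auto)
      then have "25 * sqrt M \<le> 50 * T" by simp
      then show "25 / T\<^sup>2 \<le> 50 * ((1 / T) / sqrt M)" using T M by (simp add: field_simps power2_eq_square)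
    qed (use C' in \<open>auto simp: E_def\<close>)
    also have "\<dots> = 50 * C' * (exp (- d) / 1 * (1 / T) * E / sqrt M)" by simp
    also have "\<dots> \<le> 50 * C' * Q"
      unfolding Q_def
    proof (intro mult_left_mono divide_right_mono mult_right_mono mult_mono divide_left_mono)
      show "h ^ (n + k - 1) \<le> 1" using h h' by (intro power_le_one) auto
    qed (use C' h T M in \<open>auto simp: E_def\<close>)
    finally have "norm L \<le> 50 * C' * Q" .
    then have "norm (L + I - P) \<le> (C + 50 * C') * Q"
      using Ib norm_triangle_ineq[of L "I - P"] by (simp add: algebra_simps)
    moreover have "(C + 50 * C') * Q = (C + 50 * C') * (exp (- d) / h ^ (n + k - 1)) * (h + 1 / T + 1 / M) * E / sqrt M"
      by (simp add: Q_def)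
    ultimately have "norm (L + I - P) \<le> (C + 50 * C') * (exp (- d) / h ^ (n + k - 1)) * (h + 1 / T + 1 / M) * E / sqrt M"
      by (simp only:)
    then show "norm ((LINT x|lborel. kerG T R (n + k) k j v (of_real x))
        - inner_main n k j R T M h v)
      \<le> inner_err n k (C + 50 * C') R T M h v"
      unfolding J P_def d_def E_def .
  qed
  qed
qed

section \<open>Integration over the transverse variables\<close>

lemma continuous_on_kerF_real:
  assumes "continuous_on S f" "\<And>x. x \<in> S \<Longrightarrow> f x \<ge> 0"
  shows "continuous_on S (\<lambda>x. kerF R N k (of_real (f x)))"
  unfolding kerF_def using shc_nonneg_real_nonzero assms
  by (intro continuous_intros) auto

interpretation lborel_product: product_sigma_finite "\<lambda>_. lborel :: real measure"
  by standard (rule lborel.sigma_finite_countable)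

lemma has_bochner_integral_prod_PiM:
  fixes f :: "real \<Rightarrow> real"
  assumes "finite I" "has_bochner_integral lborel f a"
  shows "has_bochner_integral (Pi\<^sub>M I (\<lambda>_. lborel)) (\<lambda>x. \<Prod>b\<in>I. f (x b)) (a ^ card I)"
  using assms lborel_product.product_integrable_prod[of I "\<lambda>_. f"]
    lborel_product.product_integral_prod[of I "\<lambda>_. f"]
  by (auto simp: has_bochner_integral_iff)

text \<open>The sum of the |a b| is at most \<open>card I * r\<close>. The \<open>+ 1\<close> keeps
  the rate defined for empty \<open>I\<close>, which occurs when the transverse space is
  trivial.\<close>

lemma exp_neg_le_prod:
  fixes a :: "'i \<Rightarrow> real"
  assumes "finite I" "c \<ge> 0" "\<And>b. b \<in> I \<Longrightarrow> \<bar>a b\<bar> \<le> r" "r \<ge> 0"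
  shows "exp (- (c * r)) \<le> (\<Prod>b\<in>I. exp (- (c / (card I + 1) * \<bar>a b\<bar>)))"
proof -
  have "(\<Sum>b\<in>I. \<bar>a b\<bar>) \<le> (\<Sum>b\<in>I. r)" by (intro sum_mono assms)
  also have "\<dots> \<le> (card I + 1) * r" using assms(4) by (simp add: algebra_simps)
  finally have "c / (card I + 1) * (\<Sum>b\<in>I. \<bar>a b\<bar>) \<le> c / (card I + 1) * ((card I + 1) * r)"
    using assms(2) by (intro mult_left_mono) auto
  also have "\<dots> = c * r" by (simp add: add_eq_0_iff_both_eq_0)
  finally have "exp (- (c * r)) \<le> exp (\<Sum>b\<in>I. - (c / (card I + 1) * \<bar>a b\<bar>))"
    by (simp add: sum_negf sum_distrib_left)
  then show ?thesis using assms(1) by (simp add: exp_sum)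
qed

lemma integrable_exp_neg_norm:
  assumes "c > 0"
  shows "integrable lborel (\<lambda>l::'b::euclidean_space. exp (- (c * norm l)))"
proof (rule Bochner_Integration.integrable_bound)
  let ?d = "c / (card (Basis :: 'b set) + 1)"
  have "integrable (Pi\<^sub>M (Basis :: 'b set) (\<lambda>_. lborel)) (\<lambda>x. \<Prod>b\<in>Basis. exp (- (?d * \<bar>x b\<bar>)))"
    using has_bochner_integral_prod_PiM[OF finite_Basis has_bochner_integral_exp_abs[of ?d]] assms
    by (auto simp: has_bochner_integral_iff)
  moreover have "((\<Sum>b\<in>Basis. x b *\<^sub>R b) \<bullet> b) = x b" if "b \<in> Basis" for x :: "'b \<Rightarrow> real" and b
    using that by simp
  ultimately show "integrable lborel (\<lambda>l::'b. \<Prod>b\<in>Basis. exp (- (?d * \<bar>l \<bullet> b\<bar>)))"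
    unfolding lborel_eq[where 'a = 'b] by (subst integrable_distr_eq) (auto cong: prod.cong)
  show "AE l in lborel. norm (exp (- (c * norm l))) \<le> norm (\<Prod>b\<in>Basis. exp (- (?d * \<bar>(l::'b) \<bullet> b\<bar>)))"
  proof (rule AE_I2)
    fix l :: 'b
    have "exp (- (c * norm l)) \<le> (\<Prod>b\<in>Basis. exp (- (?d * \<bar>l \<bullet> b\<bar>)))"
      by (rule exp_neg_le_prod) (use assms Basis_le_norm in auto)
    then show "norm (exp (- (c * norm l))) \<le> norm (\<Prod>b\<in>Basis. exp (- (?d * \<bar>l \<bullet> b\<bar>)))"
      by (simp add: abs_prod)
  qed
qed auto

lemma integrable_kerF_norm:
  fixes u :: "'b::euclidean_space"
  assumes n: "n \<ge> 1" and R: "R \<ge> 0" and u: "u \<in> Basis"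
  shows "integrable lborel (\<lambda>l. exp (\<i> * of_real (T * (l \<bullet> u))) * kerF R (n + k) k (of_real ((norm l)\<^sup>2)) * of_real (l \<bullet> u) ^ j)"
    (is "integrable lborel ?f")
proof -
  obtain C where C: "C > 0" "\<And>R x. x \<ge> 0 \<Longrightarrow> R \<ge> 0 \<Longrightarrow>
     norm (kerF R (n + k) k (of_real (x\<^sup>2))) \<le> C * exp (- x / 2)"
    using norm_kerF_le_real[OF n] by metis
  define K where "K = (real (Suc j) / (1/4)) ^ j"
  have K: "K > 0" by (simp add: K_def)
  show ?thesis
  proof (rule Bochner_Integration.integrable_bound)
    show "integrable lborel (\<lambda>l::'b. C * K * exp (- (1/4 * norm l)))"
      by (intro integrable_mult_right integrable_exp_neg_norm) auto
    have "continuous_on UNIV ?f"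
      by (intro continuous_intros continuous_on_kerF_real) auto
    then show "?f \<in> borel_measurable lborel" by (simp add: borel_measurable_continuous_onI)
    show "AE l in lborel. norm (?f l) \<le> norm (C * K * exp (- (1/4 * norm l)))"
    proof (rule AE_I2)
      fix l :: 'b
      have "norm (of_real (l \<bullet> u) ^ j :: complex) = \<bar>l \<bullet> u\<bar> ^ j" by (simp add: norm_power)
      also have "\<dots> \<le> norm l ^ j" using Basis_le_norm[OF u, of l] by (intro power_mono) auto
      also have "\<dots> \<le> K * exp (1/4 * norm l)" unfolding K_def by (intro exp_ge_power) auto
      finally have "norm (?f l) \<le> (1 * (C * exp (- norm l / 2))) * (K * exp (1/4 * norm l))"
        using R by (intro norm_mult_mono C) (auto simp: norm_exp_eq_Re)
      also have "\<dots> = C * K * (exp (- norm l / 2) * exp (1/4 * norm l))" by simp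
      also have "exp (- norm l / 2) * exp (1/4 * norm l) = exp (- (1/4 * norm l))"
        unfolding exp_add[symmetric] by simp
      finally show "norm (?f l) \<le> norm (C * K * exp (- (1/4 * norm l)))" using C K by (simp add: abs_mult)
    qed
  qed
qed

text \<open>As \<open>u\<close> is a basis vector, the inner product with \<open>u\<close> is a
  coordinate, and Lebesgue measure is the image of a product measure from which this coordinate can
  be split off.\<close>

lemma kerF_norm_Fubini:
  fixes u :: "'b::euclidean_space"
  assumes n: "n \<ge> 1" and R: "R \<ge> 0" and u: "u \<in> Basis"
  shows "(LINT l|lborel. exp (\<i> * of_real (T * (l \<bullet> u))) * kerF R (n + k) k (of_real ((norm l)\<^sup>2)) * of_real (l \<bullet> u) ^ j)
     = (LINT x|Pi\<^sub>M (Basis - {u}) (\<lambda>_. lborel). LINT y|lborel. kerG T R (n + k) k j (\<Sum>b\<in>Basis - {u}. (x b)\<^sup>2) (of_real y))"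
proof -
  define f where "f l = exp (\<i> * of_real (T * (l \<bullet> u))) * kerF R (n + k) k (of_real ((norm l)\<^sup>2)) * of_real (l \<bullet> u) ^ j" for l :: 'b
  define g where "g x = (\<Sum>b\<in>Basis. x b *\<^sub>R b)" for x :: "'b \<Rightarrow> real"
  have fi: "integrable lborel f" unfolding f_def by (rule integrable_kerF_norm[OF assms])
  have gm: "g \<in> measurable (Pi\<^sub>M Basis (\<lambda>_. lborel)) borel" unfolding g_def by measurable
  have fm: "f \<in> borel_measurable borel" using borel_measurable_integrable[OF fi] by simp
  have Bas: "insert u (Basis - {u}) = Basis" using u by auto
  have "(LINT l|lborel. f l) = (LINT x|Pi\<^sub>M Basis (\<lambda>_. lborel). f (g x))"
    unfolding lborel_eq[where 'a = 'b] g_def[symmetric, abs_def] using gm fm by (rule integral_distr)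
  also have "\<dots> = (LINT x|Pi\<^sub>M (insert u (Basis - {u})) (\<lambda>_. lborel). f (g x))" unfolding Bas ..
  also have "\<dots> = (LINT x|Pi\<^sub>M (Basis - {u}) (\<lambda>_. lborel). LINT y|lborel. f (g (x(u := y))))"
  proof (rule lborel_product.product_integral_insert)
    have "integrable (distr (Pi\<^sub>M Basis (\<lambda>_. lborel)) borel g) f" using fi unfolding lborel_eq[where 'a = 'b] g_def[abs_def] .
    then show "integrable (Pi\<^sub>M (insert u (Basis - {u})) (\<lambda>_. lborel)) (\<lambda>x. f (g x))"
      unfolding Bas integrable_distr_eq[OF gm fm] .
  qed auto
  also have "\<dots> = (LINT x|Pi\<^sub>M (Basis - {u}) (\<lambda>_. lborel). LINT y|lborel. kerG T R (n + k) k j (\<Sum>b\<in>Basis - {u}. (x b)\<^sup>2) (of_real y))"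
  proof (intro Bochner_Integration.integral_cong refl)
    fix x :: "'b \<Rightarrow> real" and y :: real
    have gb: "g (x(u := y)) \<bullet> b = (if b = u then y else x b)" if "b \<in> Basis" for b
      using that by (simp add: g_def)
    have "(norm (g (x(u := y))))\<^sup>2 = (\<Sum>b\<in>Basis. (g (x(u := y)) \<bullet> b)\<^sup>2)"
      unfolding power2_norm_eq_inner by (subst euclidean_inner) (simp add: power2_eq_square)
    also have "\<dots> = (\<Sum>b\<in>insert u (Basis - {u}). (if b = u then y else x b)\<^sup>2)"
      unfolding Bas by (intro sum.cong refl) (simp add: gb)
    also have "\<dots> = y\<^sup>2 + (\<Sum>b\<in>Basis - {u}. (x b)\<^sup>2)"
      by (subst sum.insert) (auto intro!: sum.cong)
    finally show "f (g (x(u := y))) = kerG T R (n + k) k j (\<Sum>b\<in>Basis - {u}. (x b)\<^sup>2) (of_real y)"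
      unfolding f_def kerG_def gb[OF u] by (simp add: mult.assoc)
  qed
  finally show ?thesis unfolding f_def .
qed

text \<open>The Gaussian and the majorant exp(-sqrt(T v) / 4) both integrate to a constant times
  T^(-1/2) per transverse coordinate, so the relative error survives the integration. The majorant
  is first bounded by a product over the coordinates.\<close>

lemma outer_estimate:
  fixes I :: "'i set"
  assumes n: "n \<ge> 1" and I: "finite I"
  obtains C h0 where "C > 0" "0 < h0" "h0 < 1"
    "\<And>R h T M. R > 0 \<Longrightarrow> 0 < h \<Longrightarrow> h < h0 \<Longrightarrow>
      T = R * saddle_omega h \<Longrightarrow> M = 2 * pi * R / h \<Longrightarrow> T \<ge> 1 \<Longrightarrow>
      norm ((LINT x|Pi\<^sub>M I (\<lambda>_. lborel). LINT y|lborel. kerG T R (n + k) k j (\<Sum>b\<in>I. (x b)\<^sup>2) (of_real y))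
        - (- 1) ^ k * \<i> ^ j * of_real (exp (- saddle_action R h) / h ^ (n + k - 1) *
           (pi ^ (n + k + 1) * (pi ^ j / pi) * sqrt (2 * pi / M) * sqrt (2 * pi\<^sup>2 / T) ^ card I)))
      \<le> C * (exp (- saddle_action R h) / h ^ (n + k - 1)) * (h + 1 / T + 1 / M) / sqrt M / sqrt T ^ card I"
proof (rule inner_estimate[OF n, of k j], goal_cases)
  case hyps: (1 C h0)
  note C = hyps(2-)
  define c where "c = 1 / 4 / (card I + 1 :: real)"
  have c: "c > 0" by (simp add: c_def add_pos_nonneg)
  show thesis
  proof (rule that[of "C * (2 / c) ^ card I" h0])
    show "C * (2 / c) ^ card I > 0" "0 < h0" "h0 < 1" using C c by auto
    fix R h T M :: real
    assume R: "R > 0" and h: "0 < h" "h < h0" and T_def: "T = R * saddle_omega h"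
      and M_def: "M = 2 * pi * R / h" and T: "T \<ge> 1"
    have M: "M > 0" using R h by (simp add: M_def)
    let ?P = "Pi\<^sub>M I (\<lambda>_. lborel :: real measure)"
    define v where "v x = (\<Sum>b\<in>I. (x b)\<^sup>2)" for x :: "'i \<Rightarrow> real"
    define d where "d = exp (- saddle_action R h) / h ^ (n + k - 1)"
    define a where "a = pi ^ (n + k + 1) * (pi ^ j / pi) * sqrt (2 * pi / M)"
    define J where "J x = (LINT y|lborel. kerG T R (n + k) k j (v x) (of_real y))" for x
    define G where "G x = (\<Prod>b\<in>I. exp (- (T / (2 * pi) * (x b)\<^sup>2)))" for x :: "'i \<Rightarrow> real"
    define H where "H x = (\<Prod>b\<in>I. exp (- ((sqrt T * c) * \<bar>x b\<bar>)))" for x :: "'i \<Rightarrow> real"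
    define z where "z = (- 1) ^ k * \<i> ^ j * complex_of_real (d * a)"
    define B where "B = C * d * (h + 1 / T + 1 / M) / sqrt M"
    have d: "d > 0" using h by (simp add: d_def)
    have B: "B \<ge> 0" using C d h T M by (simp add: B_def)
    have v0: "v x \<ge> 0" for x by (simp add: v_def sum_nonneg)
    have G: "has_bochner_integral ?P G (sqrt (2 * pi\<^sup>2 / T) ^ card I)"
      using has_bochner_integral_prod_PiM[OF I has_bochner_integral_gaussian[of "T / (2 * pi)"]] T
      by (simp add: G_def[abs_def] power2_eq_square mult_ac)
    have H: "has_bochner_integral ?P H ((2 / (sqrt T * c)) ^ card I)"
      using has_bochner_integral_prod_PiM[OF I has_bochner_integral_exp_abs[of "sqrt T * c"]] T c
      by (simp add: H_def[abs_def])
    have GE: "exp (- (T * v x / (2 * pi))) = G x" for x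
      unfolding G_def exp_sum[OF I, symmetric] by (simp add: v_def sum_distrib_left sum_negf sum_divide_distrib)
    have HE: "exp (- (sqrt (T * v x) / 4)) \<le> H x" for x
    proof -
      have "\<bar>x b\<bar> \<le> sqrt (v x)" if "b \<in> I" for b
      proof (rule real_le_rsqrt)
        show "\<bar>x b\<bar>\<^sup>2 \<le> v x" using member_le_sum[of b I "\<lambda>b. (x b)\<^sup>2"] that I by (simp add: v_def)
      qed
      then have "exp (- (sqrt T / 4 * sqrt (v x))) \<le> (\<Prod>b\<in>I. exp (- (sqrt T / 4 / (card I + 1) * \<bar>x b\<bar>)))"
        using T v0 by (intro exp_neg_le_prod[OF I]) auto
      then show ?thesis by (simp add: H_def c_def real_sqrt_mult)
    qed
    have pt: "norm (J x - z * of_real (G x)) \<le> B * H x" for x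
    proof -
      have "norm (J x - (- 1) ^ k * \<i> ^ j * of_real d * of_real (pi ^ (n + k + 1) * (pi ^ j / pi) * G x * sqrt (2 * pi / M)))
         \<le> C * d * (h + 1 / T + 1 / M) * exp (- (sqrt (T * v x) / 4)) / sqrt M"
        using C(4)[OF R h T_def M_def T v0[of x]] unfolding GE d_def J_def .
      also have "\<dots> = B * exp (- (sqrt (T * v x) / 4))" by (simp add: B_def)
      also have "\<dots> \<le> B * H x" using HE B by (intro mult_left_mono) auto
      finally show ?thesis by (simp add: z_def a_def mult_ac)
    qed
    have Jm: "J \<in> borel_measurable ?P"
    proof -
      \<comment> \<open>The absolute value keeps the argument of \<open>kerF\<close> nonnegative,
        where it is continuous; it disappears again because \<open>v x >= 0\<close>.\<close>
      have m1: "(\<lambda>p. exp (\<i> * of_real T * of_real (fst p)) * kerF R (n + k) k (of_real ((fst p)\<^sup>2 + \<bar>snd p\<bar>)) * of_real (fst p) ^ j) \<in> borel_measurable (borel \<Otimes>\<^sub>M borel :: (real \<times> real) measure)"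
        unfolding borel_prod
        by (intro borel_measurable_continuous_onI continuous_intros continuous_on_kerF_real) auto
      have m2: "(\<lambda>p. (snd p, v (fst p))) \<in> measurable (?P \<Otimes>\<^sub>M lborel) (borel \<Otimes>\<^sub>M borel)"
        unfolding v_def by measurable
      have "(\<lambda>p. exp (\<i> * of_real T * of_real (snd p)) * kerF R (n + k) k (of_real ((snd p)\<^sup>2 + \<bar>v (fst p)\<bar>)) * of_real (snd p) ^ j)
          \<in> borel_measurable (?P \<Otimes>\<^sub>M lborel)"
        using measurable_compose[OF m2 m1] unfolding fst_conv snd_conv .
      then have "(\<lambda>(x, y). kerG T R (n + k) k j (v x) (of_real y)) \<in> borel_measurable (?P \<Otimes>\<^sub>M lborel)"
        unfolding kerG_def using v0 by (simp add: case_prod_unfold)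
      then show ?thesis unfolding J_def[abs_def] by (rule lborel.borel_measurable_lebesgue_integral)
    qed
    have zG: "has_bochner_integral ?P (\<lambda>x. z * of_real (G x)) (z * of_real (sqrt (2 * pi\<^sup>2 / T) ^ card I))"
      by (intro has_bochner_integral_mult_right has_bochner_integral_of_real G)
    have BH: "has_bochner_integral ?P (\<lambda>x. B * H x) (B * (2 / (sqrt T * c)) ^ card I)"
      by (intro has_bochner_integral_mult_right H)
    have diff: "integrable ?P (\<lambda>x. J x - z * of_real (G x))"
    proof (rule Bochner_Integration.integrable_bound)
      show "integrable ?P (\<lambda>x. B * H x)" using BH by (simp add: has_bochner_integral_iff)
      show "(\<lambda>x. J x - z * of_real (G x)) \<in> borel_measurable ?P"
        using Jm zG by (intro borel_measurable_diff) (auto simp: has_bochner_integral_iff)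
      show "AE x in ?P. norm (J x - z * of_real (G x)) \<le> norm (B * H x)"
        by (intro AE_I2 order_trans[OF pt]) simp
    qed
    have "(LINT x|?P. J x) = (LINT x|?P. J x - z * of_real (G x)) + (LINT x|?P. z * of_real (G x))"
      using zG diff by (subst Bochner_Integration.integral_add[symmetric]) (auto simp: has_bochner_integral_iff)
    then have "(LINT x|?P. J x) - z * of_real (sqrt (2 * pi\<^sup>2 / T) ^ card I) = (LINT x|?P. J x - z * of_real (G x))"
      using zG by (simp add: has_bochner_integral_iff)
    also have "norm \<dots> \<le> (LINT x|?P. norm (J x - z * of_real (G x)))" by (rule integral_norm_bound)
    also have "\<dots> \<le> (LINT x|?P. B * H x)"
      by (rule integral_mono) (use diff BH pt in \<open>auto simp: has_bochner_integral_iff\<close>)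
    also have "\<dots> = B * (2 / (sqrt T * c)) ^ card I" using BH by (simp add: has_bochner_integral_iff)
    also have "\<dots> = C * (2 / c) ^ card I * d * (h + 1 / T + 1 / M) / sqrt M / sqrt T ^ card I"
      by (simp add: B_def power_divide power_mult_distrib mult_ac)
    finally have fin: "norm ((LINT x|?P. J x) - z * of_real (sqrt (2 * pi\<^sup>2 / T) ^ card I))
       \<le> C * (2 / c) ^ card I * d * (h + 1 / T + 1 / M) / sqrt M / sqrt T ^ card I" .
    have zeq: "z * of_real (sqrt (2 * pi\<^sup>2 / T) ^ card I) =
        (- 1) ^ k * \<i> ^ j * of_real (d * (pi ^ (n + k + 1) * (pi ^ j / pi) * sqrt (2 * pi / M) * sqrt (2 * pi\<^sup>2 / T) ^ card I))"
      unfolding z_def a_def of_real_mult by (simp only: mult.assoc)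
    show "norm ((LINT x|?P. LINT y|lborel. kerG T R (n + k) k j (\<Sum>b\<in>I. (x b)\<^sup>2) (of_real y))
        - (- 1) ^ k * \<i> ^ j * of_real (exp (- saddle_action R h) / h ^ (n + k - 1) *
           (pi ^ (n + k + 1) * (pi ^ j / pi) * sqrt (2 * pi / M) * sqrt (2 * pi\<^sup>2 / T) ^ card I)))
      \<le> C * (2 / c) ^ card I * (exp (- saddle_action R h) / h ^ (n + k - 1)) * (h + 1 / T + 1 / M) / sqrt M / sqrt T ^ card I"
      using fin unfolding zeq unfolding J_def v_def d_def .
  qed
qed

section \<open>The saddle point equation\<close>

lemma theta_reflect:
  assumes "0 < h" "h < pi"
  shows "theta (pi - h) = saddle_omega h"
proof -
  have s: "sin h > 0" using assms by (intro sin_gt_zero)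
  have "sin (2 * (pi - h)) = - (2 * sin h * cos h)"
    unfolding sin_double by simp
  then have "theta (pi - h) = (2 * (pi - h) + 2 * sin h * cos h) / (2 * (sin h)\<^sup>2)"
    using assms by (simp add: theta_def)
  then show ?thesis using s by (simp add: field_simps power2_eq_square)
qed

lemma theta_nonpos:
  assumes "y \<le> 0"
  shows "theta y \<le> 0"
proof -
  have "sin (- (2 * y)) \<le> - (2 * y)" using assms by (intro sin_x_le_x) auto
  then show ?thesis by (auto simp: theta_def intro: divide_nonpos_nonneg)
qed

lemma mult_cos_less_sin:
  assumes "0 < y" "y < pi"
  shows "y * cos y < sin y"
proof -
  have "\<exists>d. DERIV (\<lambda>y. sin y - y * cos y) x :> d \<and> d > 0" if "0 < x" "x < y" for x
  proof (intro exI conjI)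
    show "DERIV (\<lambda>y. sin y - y * cos y) x :> x * sin x"
      by (auto intro!: derivative_eq_intros)
    show "x * sin x > 0" using that assms by (intro mult_pos_pos sin_gt_zero) auto
  qed
  then have "sin 0 - 0 * cos 0 < sin y - y * cos y"
    using assms by (intro DERIV_pos_imp_increasing_open[of 0 y "\<lambda>y. sin y - y * cos y"] continuous_intros) auto
  then show ?thesis by simp
qed

text \<open>The numerator of the derivative is 8 sin y (sin y - y cos y), which is positive on (0,
  pi).\<close>

lemma theta_strict_mono:
  assumes "0 < a" "a < b" "b < pi"
  shows "theta a < theta b"
proof -
  define f where "f y = (2 * y - sin (2 * y)) / (2 * (sin y)\<^sup>2)" for y :: real
  have "f a < f b"
  proof (rule DERIV_pos_imp_increasing[OF assms(2)])
    fix y assume y: "a \<le> y" "y \<le> b"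
    have s: "sin y > 0" using y assms by (intro sin_gt_zero) auto
    have "DERIV f y :> ((2 - cos (2 * y) * 2) * (2 * (sin y)\<^sup>2) - (2 * y - sin (2 * y)) * (4 * sin y * cos y)) / (2 * (sin y)\<^sup>2 * (2 * (sin y)\<^sup>2))"
      unfolding f_def[abs_def] using s by (auto intro!: derivative_eq_intros)
    moreover have "((2 - cos (2 * y) * 2) * (2 * (sin y)\<^sup>2) - (2 * y - sin (2 * y)) * (4 * sin y * cos y)) / (2 * (sin y)\<^sup>2 * (2 * (sin y)\<^sup>2)) > 0"
    proof (rule divide_pos_pos)
      have c2: "(cos y)\<^sup>2 = 1 - (sin y)\<^sup>2" by (simp add: cos_squared_eq)
      have "(2 - cos (2 * y) * 2) * (2 * (sin y)\<^sup>2) - (2 * y - sin (2 * y)) * (4 * sin y * cos y)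
         = 8 * sin y * ((sin y)\<^sup>2 * sin y + sin y * (cos y)\<^sup>2 - y * cos y)"
        unfolding cos_double_sin sin_double by (simp add: algebra_simps power2_eq_square)
      also have "(sin y)\<^sup>2 * sin y + sin y * (cos y)\<^sup>2 - y * cos y = sin y - y * cos y"
        unfolding c2 by (simp add: algebra_simps)
      finally show "(2 - cos (2 * y) * 2) * (2 * (sin y)\<^sup>2) - (2 * y - sin (2 * y)) * (4 * sin y * cos y) > 0"
        using s mult_cos_less_sin[of y] y assms by simp
    qed (use s in simp)
    ultimately show "\<exists>d. DERIV f y :> d \<and> d > 0" by blast
  qed
  then show ?thesis using assms by (simp add: theta_def f_def)
qed

text \<open>A positive value of \<open>theta\<close> forces y > 0, and on (0, pi) strict
  monotonicity leaves one candidate.\<close>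

lemma theta_inverse_eq:
  assumes "0 < h" "h < pi" "theta (pi - h) = \<omega>" "\<omega> > 0"
  shows "(THE y. - pi < y \<and> y < pi \<and> theta y = \<omega>) = pi - h"
proof (rule the_equality)
  fix y assume y: "- pi < y \<and> y < pi \<and> theta y = \<omega>"
  then have "y > 0" using theta_nonpos[of y] assms(4) by fastforce
  then show "y = pi - h"
    using theta_strict_mono[of y "pi - h"] theta_strict_mono[of "pi - h" y] y assms
    by (cases y "pi - h" rule: linorder_cases) auto
qed (use assms in auto)

text \<open>\<open>saddle_omega h >= 2 / h^2\<close> is unbounded near 0, so the intermediate value
  theorem applies between a small \<open>a\<close> and e / 2.\<close>

lemma saddle_exists:
  assumes e: "0 < e" "e < 1"
  obtains \<omega>0 where "\<omega>0 > 0"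
    "\<And>\<omega>. \<omega> > \<omega>0 \<Longrightarrow> \<exists>h. 0 < h \<and> h < e \<and> saddle_omega h = \<omega>"
proof -
  define f where "f h = saddle_omega h" for h :: real
  have s: "sin h > 0" if "0 < h" "h < 1" for h :: real using that pi_gt3 by (intro sin_gt_zero) auto
  show thesis
  proof (rule that[of "max 1 (f (e / 2))"])
    fix \<omega> assume \<omega>: "\<omega> > max 1 (f (e / 2))"
    \<comment> \<open>Chosen to give \<omega> <= 1 / a <= 2 / a^2 <= f a.\<close>
    define a where "a = min (e / 2) (1 / \<omega>)"
    have a: "0 < a" "a \<le> e / 2" "a \<le> 1 / \<omega>" "a < 1" using e \<omega> by (auto simp: a_def)
    have "\<omega> \<le> 1 / a" using a \<omega> by (simp add: field_simps)
    also have "\<dots> \<le> 2 / a\<^sup>2" using a by (simp add: field_simps power2_eq_square)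
    also have "\<dots> \<le> f a"
      using saddle_size(1)[OF a(1,4), of 1] a by (simp add: f_def field_simps)
    finally have "\<omega> \<le> f a" .
    moreover have "continuous_on {a..e / 2} f"
    proof -
      have "sin x \<noteq> 0" if "x \<in> {a..e / 2}" for x using s[of x] that a e by force
      then show ?thesis unfolding f_def[abs_def] by (intro continuous_intros) auto
    qed
    ultimately obtain h where "a \<le> h" "h \<le> e / 2" "f h = \<omega>"
      using IVT2'[of f "e / 2" \<omega> a] \<omega> a by auto
    then show "\<exists>h. 0 < h \<and> h < e \<and> saddle_omega h = \<omega>"
      using a e by (intro exI[of _ h]) (auto simp: f_def)
  qed simp
qed

section \<open>Comparing the saddle h with pi * delta\<close>

text \<open>Here q will be pi * delta / h; the equation for q^2 restates delta^2 = R / (pi |t|). As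
  \<open>saddle_omega h * h^2 / pi\<close> is 1 + O(h), so is q.\<close>

lemma saddle_ratio:
  assumes h: "0 < h" "h \<le> 1 / 8" and q: "q > 0"
    "q\<^sup>2 * (saddle_omega h * h\<^sup>2) = pi"
  shows "\<bar>q - 1\<bar> \<le> 4 * h"
proof -
  define s where "s = saddle_omega h * h\<^sup>2 / pi"
  define r where "r = h / sin h"
  have sp: "sin h > 0" using h pi_gt3 by (intro sin_gt_zero) auto
  have cp: "cos h > 0" using h pi_gt3 by (intro cos_gt_zero) auto
  have "sin h \<ge> h - h ^ 3 / 6"
  proof -
    have "(\<Sum>m<3. sin_coeff m * h ^ m) = h"
    proof -
      have "{..<3} = {0, 1, 2 :: nat}" by auto
      then show ?thesis by (simp add: sin_coeff_def)
    qed
    then have "\<bar>sin h - h\<bar> \<le> inverse (fact 3) * \<bar>h\<bar> ^ 3" using Maclaurin_sin_bound[of h 3] by simp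
    then have "\<bar>sin h - h\<bar> \<le> h ^ 3 / 6" using h by (simp add: fact_numeral)
    then show ?thesis by linarith
  qed
  moreover have "h ^ 3 \<le> h * h * (1 / 8)" using h by (simp add: power3_eq_cube mult_left_mono)
  ultimately have sl: "sin h \<ge> h - h * h / 48" by simp
  have r1: "r \<ge> 1" using sp sin_x_le_x[of h] h by (simp add: r_def)
  have r2: "r \<le> 1 + h / 24"
  proof -
    have "h * 1 \<le> h * ((1 + h / 24) * (1 - h / 48))"
    proof (rule mult_left_mono)
      have "(1 + h / 24) * (1 - h / 48) = 1 + h * (1 / 48 - h / 1152)" by (simp add: field_simps)
      moreover have "h * (1 / 48 - h / 1152) \<ge> 0" using h by (intro mult_nonneg_nonneg) auto
      ultimately show "1 \<le> (1 + h / 24) * (1 - h / 48)" by simp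
    qed (use h in simp)
    also have "\<dots> = (1 + h / 24) * (h - h * h / 48)" by (simp add: field_simps)
    also have "\<dots> \<le> (1 + h / 24) * sin h" using sl h by (intro mult_left_mono) auto
    finally show ?thesis using sp by (simp add: r_def field_simps)
  qed
  have r3: "r\<^sup>2 \<le> 1 + h / 8"
  proof -
    have "r\<^sup>2 \<le> (1 + h / 24)\<^sup>2" using r1 r2 by (intro power_mono) auto
    also have "\<dots> = 1 + h * (1 / 12 + h / 576)" by (simp add: field_simps power2_eq_square)
    also have "h * (1 / 12 + h / 576) \<le> h * (1 / 8)" using h by (intro mult_left_mono) auto
    finally show ?thesis by simp
  qed
  \<comment> \<open>With r = h / sin h = 1 + O(h), the first term is 1 + O(h) and the second is
    O(h).\<close>
  have s_eq: "s = (1 - h / pi) * r\<^sup>2 + h * (r * cos h) / pi"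
    using sp by (simp add: s_def r_def field_simps power2_eq_square)
  have "h / pi \<le> h / 3" using h pi_gt3 by (intro divide_left_mono) auto
  then have e3: "1 - h / pi \<ge> 1 - h / 3" by simp
  have e4: "0 \<le> 1 - h / pi" using e3 h by linarith
  have rc: "0 \<le> r * cos h" "r * cos h \<le> 2"
  proof -
    have "r \<le> 2" using r2 h by simp
    then have "r * cos h \<le> 2 * 1" using r1 cp by (intro mult_mono) auto
    then show "r * cos h \<le> 2" by simp
  qed (use r1 cp in auto)
  have s_lo: "s \<ge> 1 - h / 3"
  proof -
    have a: "(1 - h / 3) * 1 \<le> (1 - h / pi) * r\<^sup>2" using e3 e4 r1 h by (intro mult_mono) auto
    have b: "0 \<le> h * (r * cos h) / pi" using rc h by simp
    show ?thesis using add_mono[OF a b] unfolding s_eq by (simp only: mult_1_right add_0_right)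
  qed
  have s_hi: "s \<le> 1 + h"
  proof -
    have a: "(1 - h / pi) * r\<^sup>2 \<le> 1 * (1 + h / 8)" using r3 h by (intro mult_mono) auto
    have b: "h * (r * cos h) / pi \<le> h * 2 / 3" using rc h pi_gt3 by (intro frac_le mult_left_mono) auto
    have "s \<le> 1 * (1 + h / 8) + h * 2 / 3" unfolding s_eq by (rule add_mono[OF a b])
    then have "s \<le> 1 + 19 / 24 * h" by simp
    then show ?thesis using h by linarith
  qed
  have qs: "q\<^sup>2 * s = 1" using q(2) by (simp add: s_def field_simps)
  have "\<bar>q - 1\<bar> * 1 \<le> \<bar>q - 1\<bar> * (q + 1)" using q(1) by (intro mult_left_mono) auto
  also have "\<dots> = \<bar>q\<^sup>2 - 1\<bar>" 
  proof -
    have "\<bar>q\<^sup>2 - 1\<bar> = \<bar>(q - 1) * (q + 1)\<bar>" by (simp add: power2_eq_square algebra_simps)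
    then show ?thesis using q(1) by (simp add: abs_mult)
  qed
  also have "q\<^sup>2 - 1 = q\<^sup>2 * (1 - s)" using qs by (simp add: algebra_simps)
  also have "\<bar>q\<^sup>2 * (1 - s)\<bar> = q\<^sup>2 * \<bar>1 - s\<bar>" by (simp add: abs_mult)
  also have "\<dots> \<le> 2 * h"
  proof (rule mult_mono)
    show "q\<^sup>2 \<le> 2"
    proof -
      have "q\<^sup>2 * (1 / 2) \<le> q\<^sup>2 * s" using s_lo h by (intro mult_left_mono) auto
      then show ?thesis using qs by simp
    qed
    show "\<bar>1 - s\<bar> \<le> h" using s_lo s_hi h by (simp add: abs_le_iff)
  qed auto
  finally show ?thesis using h by simp
qed

text \<open>This quotient is the exact discrepancy between the saddle form and the main term: q^p
  from h against pi * delta, and sqrt q from \<open>M\<close> against kappa.\<close>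

lemma power_div_sqrt_near_1:
  assumes q: "1 / 2 \<le> q" "q \<le> 2"
  shows "\<bar>q ^ p / sqrt q - 1\<bar> \<le> (2 * real p * 2 ^ p + 2) * \<bar>q - 1\<bar>"
proof -
  have s: "sqrt q \<ge> 1 / 2" using q by (intro real_le_rsqrt) (auto simp: power2_eq_square)
  have 1: "\<bar>q ^ p - 1\<bar> \<le> real p * 2 ^ p * \<bar>q - 1\<bar>"
    using norm_power_diff_le[of q 2 1 p] q by simp
  have 2: "\<bar>1 / sqrt q - 1\<bar> \<le> 2 * \<bar>q - 1\<bar>"
  proof -
    have "\<bar>1 - sqrt q\<bar> * 1 \<le> \<bar>1 - sqrt q\<bar> * (1 + sqrt q)" using q by (intro mult_left_mono) auto
    also have "\<dots> = \<bar>(1 - sqrt q) * (1 + sqrt q)\<bar>" using s q by (simp add: abs_mult)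
    also have "(1 - sqrt q) * (1 + sqrt q) = 1 - q" using q by (simp add: algebra_simps)
    finally have "\<bar>1 - sqrt q\<bar> \<le> \<bar>q - 1\<bar>" by simp
    moreover have "\<bar>1 / sqrt q - 1\<bar> = \<bar>1 - sqrt q\<bar> / sqrt q"
    proof -
      have "1 / sqrt q - 1 = (1 - sqrt q) / sqrt q" using q by (simp add: diff_divide_distrib)
      then show ?thesis using q by (simp add: abs_divide)
    qed
    moreover have "\<bar>1 - sqrt q\<bar> / sqrt q \<le> \<bar>1 - sqrt q\<bar> / (1 / 2)" using s q by (intro divide_left_mono) auto
    ultimately show ?thesis by simp
  qed
  have i: "0 \<le> 1 / sqrt q" "1 / sqrt q \<le> 2" using s q by (auto simp: divide_simps)
  have "q ^ p / sqrt q - 1 = (q ^ p - 1) * (1 / sqrt q) + (1 / sqrt q - 1)" by (simp add: algebra_simps)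
  also have "\<bar>\<dots>\<bar> \<le> \<bar>q ^ p - 1\<bar> * (1 / sqrt q) + \<bar>1 / sqrt q - 1\<bar>"
    using i by (intro order_trans[OF abs_triangle_ineq]) (simp add: abs_mult)
  also have "\<dots> \<le> (real p * 2 ^ p * \<bar>q - 1\<bar>) * 2 + 2 * \<bar>q - 1\<bar>"
    using i by (intro add_mono mult_mono 1 2) auto
  finally show ?thesis by (simp add: algebra_simps)
qed

section \<open>The kernel, the main term and the final comparison\<close>

lemma p1_eq_Fubini:
  fixes u :: "'b::euclidean_space" and x :: "'a::real_normed_vector" and t :: 'b
  assumes n: "n \<ge> 1" and u: "u \<in> Basis"
  shows "p1 n k j u x t = ((-1)^k * \<i>^j / complex_of_real ((4*pi)^n * (2*pi)^DIM('b))) *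
    (LINT y|Pi\<^sub>M (Basis - {u}) (\<lambda>_. lborel). LINT z|lborel. kerG (norm t) (Rof x) (n + k) k j (\<Sum>b\<in>Basis - {u}. (y b)\<^sup>2) (of_real z))"
proof -
  define R where "R = Rof x"
  have R: "R \<ge> 0" by (simp add: R_def Rof_def)
  \<comment> \<open>At l = 0 the integrand of \<open>p1\<close> is 0, because division by 0 yields
    0, whereas \<open>kerF\<close> takes its limiting value there. The two therefore agree off the
    null set {0}, which the indicator below records.\<close>
  define f where "f l = exp (\<i> * of_real (norm t * (l \<bullet> u))) * kerF R (n + k) k (of_real ((norm l)\<^sup>2)) * of_real (l \<bullet> u) ^ j" for l :: 'b
  have fi: "integrable lborel f" unfolding f_def by (rule integrable_kerF_norm[OF n R u])
  have eq: "exp (\<i> * complex_of_real (norm t * (l \<bullet> u))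
             - complex_of_real ((norm x)^2 / 4 * norm l * cosh (norm l) / sinh (norm l)))
        * complex_of_real (norm l ^ (n+k) * cosh (norm l) ^ k / sinh (norm l) ^ (n+k))
        * complex_of_real ((l \<bullet> u) ^ j) = indicator (- {0}) l *\<^sub>R f l" for l :: 'b
  proof (cases "l = 0")
    case True
    then show ?thesis using n by simp
  next
    case False
    define s where "s = norm l"
    have s: "s > 0" using False by (simp add: s_def)
    have sh: "sinh (complex_of_real s) = of_real (sinh s)" "cosh (complex_of_real s) = of_real (cosh s)"
      by (rule sinh_complex_of_real cosh_complex_of_real)+
    have s0: "sinh (complex_of_real s) \<noteq> 0" using s by (simp add: sh)
    have "kerF R (n + k) k (of_real (s\<^sup>2)) = exp (- of_real (R * (s * cosh s / sinh s))) * of_real (s ^ (n+k) * cosh s ^ k / sinh s ^ (n+k))"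
      using kerF_of_square[OF s0, of R "n + k" k] by (simp add: sh)
    moreover have "exp (\<i> * complex_of_real (norm t * (l \<bullet> u)) - complex_of_real (R * s * cosh s / sinh s))
      = exp (\<i> * complex_of_real (norm t * (l \<bullet> u))) * exp (- of_real (R * (s * cosh s / sinh s)))"
      unfolding exp_add[symmetric] by (simp add: mult.assoc)
    ultimately show ?thesis using False
      unfolding f_def s_def[symmetric] Rof_def[of x, folded R_def, symmetric]
      by (simp add: mult.assoc)
  qed
  have "(LINT l|lborel. indicator (- {0}) l *\<^sub>R f l) = (LINT l|lborel. f l)"
  proof (rule integral_cong_AE)
    show "(\<lambda>l. indicator (- {0}) l *\<^sub>R f l) \<in> borel_measurable lborel" "f \<in> borel_measurable lborel"
      using fi by (auto intro!: borel_measurable_scaleR)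
    show "AE l in lborel. indicator (- {0}) l *\<^sub>R f l = f l"
      using AE_lborel_singleton[of 0] by eventually_elim (simp add: indicator_def)
  qed
  also have "\<dots> = (LINT y|Pi\<^sub>M (Basis - {u}) (\<lambda>_. lborel). LINT z|lborel. kerG (norm t) R (n + k) k j (\<Sum>b\<in>Basis - {u}. (y b)\<^sup>2) (of_real z))"
    unfolding f_def by (rule kerF_norm_Fubini[OF n R u])
  finally show ?thesis unfolding p1_def eq R_def by (rule arg_cong)
qed

lemma dCC_square:
  fixes x :: "'a::real_normed_vector" and t :: "'b::real_normed_vector"
  assumes x: "x \<noteq> 0" and t: "t \<noteq> 0" and h: "0 < h" "h < 1"
    and T: "norm t = Rof x * saddle_omega h"
  shows "(dCC x t)\<^sup>2 / 4 = saddle_action (Rof x) h"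
proof -
  have R: "Rof x > 0" using x by (simp add: Rof_def)
  have w: "theta (pi - h) = norm t / Rof x"
    using theta_reflect[of h] h pi_gt3 R T by simp
  have "(THE y. - pi < y \<and> y < pi \<and> theta y = norm t / Rof x) = pi - h"
    using h pi_gt3 w R t by (intro theta_inverse_eq) auto
  then have "dCC x t = norm x * (pi - h) / sin h" using x t by (simp add: dCC_def Let_def)
  then show ?thesis by (simp add: Rof_def power_divide power_mult_distrib)
qed

lemma kappaof_eq:
  fixes x :: "'a::real_normed_vector" and t :: "'b::real_normed_vector"
  assumes "t \<noteq> 0"
  shows "kappaof x t = 2 * pi * norm t * deltaof x t"
proof -
  define a where "a = pi * norm t"
  have a: "a > 0" using assms by (simp add: a_def)
  have "a * deltaof x t = sqrt (a\<^sup>2) * sqrt (Rof x / a)" using a by (simp add: deltaof_def a_def)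
  also have "\<dots> = sqrt (a\<^sup>2 * (Rof x / a))" by (rule real_sqrt_mult[symmetric])
  also have "a\<^sup>2 * (Rof x / a) = a * Rof x" using a by (simp add: power2_eq_square)
  finally show ?thesis by (simp add: kappaof_def a_def mult.assoc)
qed

text \<open>An exact identity: substitute h = pi * delta / q, M = kappa * q and 2 pi^2 / |t| = (2
  pi)^2 * pi * delta / kappa. The last one yields the half-integer part of the power of pi *
  delta.\<close>

lemma mainterm_saddle_form:
  fixes x :: "'a::real_normed_vector" and t :: "'b::euclidean_space"
  assumes x: "x \<noteq> 0" and t: "t \<noteq> 0" and h: "0 < h" "h < 1" and N: "n \<ge> 1"
    and T: "norm t = Rof x * saddle_omega h"
  defines "q \<equiv> pi * deltaof x t / h" and "M \<equiv> 2 * pi * Rof x / h"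
  shows "(- 1) ^ j / ((4*pi)^n * (2*pi)^DIM('b)) * (exp (- saddle_action (Rof x) h) / h ^ (n + k - 1) *
      (pi ^ (n + k + 1) * (pi ^ j / pi) * sqrt (2 * pi / M) * sqrt (2 * pi\<^sup>2 / norm t) ^ (DIM('b) - 1)))
    = mainterm n k j x t * (q ^ (n + k - 1) / sqrt q)"
proof -
  define p where "p = n + k - 1"
  define m where "m = DIM('b) - 1"
  define X where "X = pi * deltaof x t"
  define \<kappa> where "\<kappa> = kappaof x t"
  define d where "d = exp (- saddle_action (Rof x) h)"
  have nk: "n + k = Suc p" using N by (simp add: p_def)
  have Dm: "DIM('b) = Suc m" using DIM_positive[where 'a='b] by (simp add: m_def)
  have R: "Rof x > 0" using x by (simp add: Rof_def)
  have nt: "norm t > 0" using t by simp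
  have dpos: "deltaof x t > 0" using R nt by (simp add: deltaof_def)
  have X: "X > 0" using R nt by (simp add: X_def deltaof_def)
  have \<kappa>: "\<kappa> > 0" using R nt by (simp add: \<kappa>_def kappaof_def)
  have q: "q > 0" "h = X / q" using X h by (auto simp: q_def X_def)
  have kd: "\<kappa> * deltaof x t = 2 * Rof x"
  proof -
    have "\<kappa> * deltaof x t = 2 * (sqrt (pi * norm t * Rof x) * sqrt (Rof x / (pi * norm t)))"
      unfolding \<kappa>_def kappaof_def deltaof_def by (rule mult.assoc)
    also have "\<dots> = 2 * sqrt ((pi * norm t * Rof x) * (Rof x / (pi * norm t)))"
      unfolding real_sqrt_mult[symmetric] ..
    also have "(pi * norm t * Rof x) * (Rof x / (pi * norm t)) = Rof x ^ 2"
      using nt by (simp add: field_simps power2_eq_square)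
    finally show ?thesis using R by simp
  qed
  have kd2: "\<kappa> = 2 * pi * norm t * deltaof x t"
    unfolding \<kappa>_def using kappaof_eq[OF t] .
  have M: "M = \<kappa> * q"
    using kd h by (simp add: M_def q_def field_simps)
  have sT: "sqrt (2 * pi\<^sup>2 / norm t) = 2 * pi * sqrt X / sqrt \<kappa>"
  proof -
    have "2 * pi\<^sup>2 / norm t = (2 * pi)\<^sup>2 * X / \<kappa>"
      unfolding kd2 X_def using nt dpos by (simp add: field_simps power2_eq_square)
    then show ?thesis by (simp add: real_sqrt_divide real_sqrt_mult)
  qed
  have sM: "sqrt (2 * pi / M) = sqrt (2 * pi) / (sqrt \<kappa> * sqrt q)"
    by (simp add: M real_sqrt_divide real_sqrt_mult)
  have pw: "X powr (real (n + k) - (real DIM('b) + 1) / 2) = X ^ p / sqrt X ^ m"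
  proof -
    \<comment> \<open>The local \<open>m\<close> is DIM('b) - 1 and \<open>p\<close> is n + k - 1,
      so the exponent becomes p - m / 2.\<close>
    have "real (n + k) - (real DIM('b) + 1) / 2 = real p - real m / 2"
      unfolding nk Dm by (simp add: field_simps)
    moreover have "X powr (real m / 2) = sqrt X ^ m"
      using X by (simp add: powr_half_sqrt[symmetric] powr_powr flip: powr_realpow)
    ultimately show ?thesis using X by (simp add: powr_diff powr_realpow)
  qed
  have s2: "sqrt (2 * pi * \<kappa> ^ DIM('b)) = sqrt (2 * pi) * sqrt \<kappa> ^ Suc m"
    by (simp add: Dm real_sqrt_mult real_sqrt_power)
  have "mainterm n k j x t = (- 1) ^ j * pi ^ (k + j) / (4 ^ n * (X ^ p / sqrt X ^ m) * (sqrt (2 * pi) * sqrt \<kappa> ^ Suc m)) * d"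
    unfolding mainterm_def X_def[symmetric] pw \<kappa>_def[symmetric] s2 d_def
    using dCC_square[OF x t h T] by simp
  moreover have "pi ^ (n + k + 1) * (pi ^ j / pi) = pi ^ n * pi ^ (k + j)" by (simp add: power_add)
  moreover have "(4 * pi) ^ n * (2 * pi) ^ DIM('b) = 4 ^ n * pi ^ n * (sqrt (2 * pi) * sqrt (2 * pi) * (2 * pi) ^ m)"
    unfolding Dm by (simp add: power_mult_distrib)
  moreover have "S / (f * P * (a * a * b)) * (E / (Y / Q) * (P * P' * (a / (K * r)) * (b * y / w))) = S * P' / (f * (Y / y) * (a * (K * w))) * E * (Q / r)"
    if "f \<noteq> 0" "P \<noteq> 0" "a \<noteq> 0" "b \<noteq> 0" "Y \<noteq> 0" "y \<noteq> 0" "Q \<noteq> 0" "K \<noteq> 0" "r \<noteq> 0" "w \<noteq> 0"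
    for S f P a b E Y Q P' K r y w :: real
    using that by (simp add: field_simps)
  note this[of "4 ^ n" "pi ^ n" "sqrt (2 * pi)" "(2 * pi) ^ m" "X ^ p" "sqrt X ^ m" "q ^ p" "sqrt \<kappa>" "sqrt q" "sqrt \<kappa> ^ m" "(- 1) ^ j" d "pi ^ (k + j)"]
  moreover have "(2 * pi * sqrt X / sqrt \<kappa>) ^ m = (2 * pi) ^ m * sqrt X ^ m / sqrt \<kappa> ^ m" by (simp add: power_mult_distrib power_divide)
  ultimately show ?thesis
    unfolding sT sM d_def[symmetric] p_def[symmetric] m_def[symmetric]
    using X \<kappa> q by (simp add: power_divide)
qed

theorem theorem4p13:
  fixes n k1 k2 :: nat and u :: "'b::euclidean_space"
  assumes "n \<ge> 1" and "DIM('a::euclidean_space) = 2 * n" and "u \<in> Basis"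
  shows "\<exists>C \<delta>0 \<kappa>0. C > 0 \<and> \<delta>0 > 0 \<and>
           (\<forall>(x::'a) (t::'b). x \<noteq> 0 \<and> t \<noteq> 0 \<and> deltaof x t < \<delta>0 \<and> kappaof x t > \<kappa>0 \<longrightarrow>
              norm (p1 n k1 k2 u x t - complex_of_real (mainterm n k1 k2 x t))
                \<le> C * (deltaof x t + 1 / kappaof x t) * \<bar>mainterm n k1 k2 x t\<bar>)"
proof (rule outer_estimate[OF assms(1), of "Basis - {u}" k1 k2], goal_cases)
  case 1
  show ?case by simp
next
  case C: (2 C h0)
  let ?p = "n + k1 - 1" and ?I = "Basis - {u}"
  have cI: "card ?I = DIM('b) - 1" using assms(3) by simp
  \<comment> \<open>With h < 1/16 the deviation |q - 1| <= 4 h is below 1/4, so q lies in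
    [1/2, 2].\<close>
  define e where "e = min h0 (1 / 16)"
  have e: "0 < e" "e < 1" using C by (auto simp: e_def)
  obtain \<omega>0 where \<omega>0: "\<omega>0 > 0"
    "\<And>\<omega>. \<omega> > \<omega>0 \<Longrightarrow> \<exists>h. 0 < h \<and> h < e \<and> saddle_omega h = \<omega>"
    using saddle_exists[OF e] by metis
  define c0 where "c0 = pi ^ (n + k1 + 1) * (pi ^ k2 / pi) * sqrt (2 * pi) * sqrt (2 * pi\<^sup>2) ^ card ?I"
  have c0: "c0 > 0" by (simp add: c0_def)
  define A where "A = 2 * real ?p * 2 ^ ?p + 2"
  have A: "A > 0" by (simp add: A_def add_nonneg_pos)
  \<comment> \<open>The 8 bounds \<open>h + 1/T + 1/M\<close> by 8 (delta + 1/kappa); the 28 is 4 *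
    7, from |g - 1| <= 4 A h and h <= 7 delta.\<close>
  define C1 where "C1 = C / c0 * (1 + A) * 8 + 28 * A"
  have C1: "C1 > 0" using C c0 A by (simp add: C1_def add_pos_pos)
  \<comment> \<open>By delta^2 = R / (pi |t|), delta < \<delta>0 means |t| / R > \<omega>0 +
    1.\<close>
  define \<delta>0 where "\<delta>0 = 1 / sqrt (pi * \<omega>0 + pi)"
  show ?thesis
  proof (rule exI[of _ C1], rule exI[of _ "min 1 \<delta>0"], rule exI[of _ "10 :: real"], intro conjI allI impI C1)
    show "min 1 \<delta>0 > 0" using \<omega>0 by (simp add: \<delta>0_def add_nonneg_pos)
    fix x :: 'a and t :: 'b
    assume "x \<noteq> 0 \<and> t \<noteq> 0 \<and> deltaof x t < min 1 \<delta>0 \<and> kappaof x t > 10"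
    then have x: "x \<noteq> 0" and t: "t \<noteq> 0" and \<delta>: "deltaof x t < 1" "deltaof x t < \<delta>0" and \<kappa>: "kappaof x t > 10" by auto
    define R where "R = Rof x"
    define T where "T = norm t"
    define \<delta> where "\<delta> = deltaof x t"
    define \<kappa> where "\<kappa> = kappaof x t"
    have R: "R > 0" using x by (simp add: R_def Rof_def)
    have T0: "T > 0" using t by (simp add: T_def)
    have \<delta>_eq: "\<delta>\<^sup>2 = R / (pi * T)" using R T0 by (simp add: \<delta>_def deltaof_def R_def T_def)
    have \<delta>0': "\<delta> > 0" using R T0 by (simp add: \<delta>_def deltaof_def R_def T_def)
    have "\<delta> < 1" "\<delta> < \<delta>0" "\<kappa> > 10" using \<delta> \<kappa> by (auto simp: \<delta>_def \<kappa>_def)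
    have \<kappa>T: "\<kappa> = 2 * pi * T * \<delta>"
      unfolding \<kappa>_def T_def \<delta>_def using kappaof_eq[OF t] .
    have "T / R > \<omega>0"
    proof -
      have "\<delta>\<^sup>2 < \<delta>0\<^sup>2" using \<open>\<delta> < \<delta>0\<close> \<delta>0' by (intro power_strict_mono) auto
      also have "\<delta>0\<^sup>2 = 1 / (pi * \<omega>0 + pi)" using \<omega>0 by (simp add: \<delta>0_def power_divide)
      finally have "R / (pi * T) < 1 / (pi * \<omega>0 + pi)" unfolding \<delta>_eq .
      then have "R * (pi * \<omega>0 + pi) < pi * T" using T0 \<omega>0 by (simp add: field_simps add_pos_pos)
      then have "pi * (R * (\<omega>0 + 1)) < pi * T" by (simp add: algebra_simps)
      then have "R * (\<omega>0 + 1) < T" by (simp only: mult_less_cancel_left_pos[OF pi_gt_zero])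
      then have "R * \<omega>0 + R < T" by (simp add: algebra_simps)
      then show ?thesis using R by (simp add: field_simps)
    qed
    then obtain h where h: "0 < h" "h < e" "saddle_omega h = T / R"
      using \<omega>0 by blast
    then have h': "h < h0" "h \<le> 1 / 8" "h < 1" "h < 1 / 16" by (auto simp: e_def)
    have Teq: "T = R * saddle_omega h" unfolding h(3) using R by simp
    define q where "q = pi * \<delta> / h"
    define M where "M = 2 * pi * R / h"
    have q0: "q > 0" using \<delta>0' h by (simp add: q_def)
    have q1: "\<bar>q - 1\<bar> \<le> 4 * h"
    proof (rule saddle_ratio[OF h(1) h'(2) q0])
      have "q\<^sup>2 * (T / R * h\<^sup>2) = pi\<^sup>2 * \<delta>\<^sup>2 * (T / R)" using h by (simp add: q_def power_divide power_mult_distrib)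
      also have "\<dots> = pi" unfolding \<delta>_eq using R T0 by (simp add: power2_eq_square)
      finally show "q\<^sup>2 * (saddle_omega h * h\<^sup>2) = pi" unfolding h(3) .
    qed
    then have q2: "1 / 2 \<le> q" "q \<le> 2" using h' by (auto simp: abs_le_iff)
    have h\<delta>: "h \<le> 7 * \<delta>"
    proof -
      have "h * (1 / 2) \<le> h * q" using q2 h by (intro mult_left_mono) auto
      also have "\<dots> = pi * \<delta>" using h by (simp add: q_def)
      also have "\<dots> \<le> 7 / 2 * \<delta>" using pi_approx \<delta>0' by (intro mult_right_mono) auto
      finally show ?thesis by simp
    qed
    have M_eq: "M = \<kappa> * q"
      unfolding \<kappa>T M_def q_def using \<delta>_eq T0 h by (simp add: field_simps power2_eq_square)
    have T1: "T \<ge> 1"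
    proof -
      have "10 < 2 * pi * T * \<delta>" using \<open>\<kappa> > 10\<close> \<kappa>T by simp
      also have "\<dots> \<le> 2 * pi * T * 1" using \<open>\<delta> < 1\<close> T0 by (intro mult_left_mono) auto
      also have "\<dots> \<le> 8 * T" using pi_less_4 T0 by simp
      finally show ?thesis by simp
    qed
    \<comment> \<open>kappa = 2 pi T delta > 10 > 2 pi gives T delta >= 1; the threshold 10 also
      yields \<open>T >= 1\<close> because 2 pi <= 8 and delta < 1.\<close>
    have invT: "1 / T \<le> \<delta>"
    proof -
      have "1 \<le> \<kappa> / 10" using \<open>\<kappa> > 10\<close> by simp
      also have "\<dots> = (pi / 5) * (T * \<delta>)" unfolding \<kappa>T by simp
      also have "\<dots> \<le> 1 * (T * \<delta>)" using pi_less_4 T0 \<delta>0' by (intro mult_right_mono) auto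
      finally show ?thesis using T0 by (simp add: field_simps)
    qed
    have invM: "1 / M \<le> 2 * (1 / \<kappa>)"
    proof -
      have "\<kappa> * (1 / 2) \<le> M" unfolding M_eq using q2 \<open>\<kappa> > 10\<close> by (intro mult_left_mono) auto
      then have "1 / M \<le> 1 / (\<kappa> * (1 / 2))" using \<open>\<kappa> > 10\<close> by (intro divide_left_mono mult_pos_pos) (auto simp: M_eq q0)
      then show ?thesis by simp
    qed
    have M0: "M > 0" using R h by (simp add: M_def)
    define d where "d = exp (- saddle_action R h) / h ^ ?p"
    define X where "X = d * (pi ^ (n + k1 + 1) * (pi ^ k2 / pi) * sqrt (2 * pi / M) * sqrt (2 * pi\<^sup>2 / T) ^ card ?I)"
    define J where "J = (LINT x|Pi\<^sub>M ?I (\<lambda>_. lborel). LINT y|lborel. kerG T R (n + k1) k1 k2 (\<Sum>b\<in>?I. (x b)\<^sup>2) (of_real y))"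
    define F where "F = (4*pi)^n * (2*pi)^DIM('b)"
    have F: "F > 0" by (simp add: F_def)
    have d: "d > 0" using h by (simp add: d_def)
    have X0: "X > 0" using d M0 T0 by (simp add: X_def)
    have X_eq: "X = d / sqrt M / sqrt T ^ card ?I * c0"
      by (simp add: X_def c0_def real_sqrt_divide power_divide)
    define r where "r = h + 1 / T + 1 / M"
    have r: "r \<le> 8 * (\<delta> + 1 / \<kappa>)"
    proof -
      have "1 / \<kappa> > 0" using \<open>\<kappa> > 10\<close> by simp
      then show ?thesis unfolding r_def distrib_left using h\<delta> invT invM by linarith
    qed
    have J: "norm (J - (- 1) ^ k1 * \<i> ^ k2 * of_real X) \<le> C / c0 * X * r"
    proof -
      have "norm (J - (- 1) ^ k1 * \<i> ^ k2 * of_real X) \<le> C * d * r / sqrt M / sqrt T ^ card ?I"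
        using C(4)[OF R h(1) h'(1) Teq M_def T1] unfolding J_def X_def d_def r_def .
      also have "\<dots> = C / c0 * X * r" unfolding X_eq using c0 by simp
      finally show ?thesis .
    qed
    define m where "m = mainterm n k1 k2 x t"
    define g where "g = q ^ ?p / sqrt q"
    have mg: "(- 1) ^ k2 / F * X = m * g"
      using mainterm_saddle_form[OF x t h(1) h'(3) assms(1), of k2 k1] Teq
      unfolding m_def g_def F_def X_def d_def cI q_def M_def \<delta>_def T_def R_def by simp
    have p1: "p1 n k1 k2 u x t = ((- 1) ^ k1 * \<i> ^ k2 / of_real F) * J"
      unfolding p1_eq_Fubini[OF assms(1,3)] J_def T_def R_def F_def ..
    \<comment> \<open>The phase from the prefactor of \<open>p1\<close> meets the same phase from
      the loop integral: the (-1)^k1 cancel, and i^k2 squared is the sign (-1)^k2 of the main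
      term.\<close>
    have phase: "((- 1) ^ k1 * \<i> ^ k2 / of_real F) * ((- 1) ^ k1 * \<i> ^ k2 * of_real X) = complex_of_real (m * g)"
    proof -
      have "((- 1) ^ k1 * \<i> ^ k2 / of_real F) * ((- 1) ^ k1 * \<i> ^ k2 * of_real X) =
         ((- 1) * (- 1)) ^ k1 * (\<i> * \<i>) ^ k2 * of_real X / of_real F"
        unfolding power_mult_distrib by simp
      also have "\<dots> = complex_of_real ((- 1) ^ k2 / F * X)" by simp
      finally show ?thesis unfolding mg .
    qed
    have g1: "\<bar>g - 1\<bar> \<le> A * (4 * h)"
      unfolding g_def A_def
      by (rule order_trans[OF power_div_sqrt_near_1[OF q2] mult_left_mono[OF q1]]) simp
    have g2: "\<bar>g\<bar> \<le> 1 + A"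
    proof -
      have "A * (4 * h) \<le> A * 1" using A h' by (intro mult_left_mono) auto
      then show ?thesis using g1 by linarith
    qed
    have mgX: "\<bar>m * g\<bar> = X / F" unfolding mg[symmetric] using X0 F by (simp add: abs_mult power_abs)
    have "norm (p1 n k1 k2 u x t - of_real (m * g)) \<le> C / c0 * \<bar>m * g\<bar> * r"
    proof -
      have "p1 n k1 k2 u x t - of_real (m * g) = ((- 1) ^ k1 * \<i> ^ k2 / of_real F) * (J - (- 1) ^ k1 * \<i> ^ k2 * of_real X)"
        unfolding p1 phase[symmetric] by (simp add: algebra_simps)
      also have "norm \<dots> = 1 / F * norm (J - (- 1) ^ k1 * \<i> ^ k2 * of_real X)"
        unfolding norm_mult using F by (simp add: norm_mult norm_divide norm_power)
      also have "\<dots> \<le> 1 / F * (C / c0 * X * r)" using J F by (intro mult_left_mono) auto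
      also have "\<dots> = C / c0 * \<bar>m * g\<bar> * r" unfolding mgX by simp
      finally show ?thesis .
    qed
    also have "C / c0 * \<bar>m * g\<bar> * r \<le> C / c0 * (\<bar>m\<bar> * (1 + A)) * (8 * (\<delta> + 1 / \<kappa>))"
    proof (rule mult_mono)
      show "C / c0 * \<bar>m * g\<bar> \<le> C / c0 * (\<bar>m\<bar> * (1 + A))"
        unfolding abs_mult using C c0 g2 by (intro mult_left_mono) auto
      show "0 \<le> r" using h T0 M0 by (simp add: r_def)
      show "0 \<le> C / c0 * (\<bar>m\<bar> * (1 + A))" using C c0 A by simp
    qed (rule r)
    finally have 1: "norm (p1 n k1 k2 u x t - of_real (m * g)) \<le> C / c0 * (\<bar>m\<bar> * (1 + A)) * (8 * (\<delta> + 1 / \<kappa>))" .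
    have 2: "norm (complex_of_real (m * g) - of_real m) \<le> \<bar>m\<bar> * (28 * A * (\<delta> + 1 / \<kappa>))"
    proof -
      have "norm (complex_of_real (m * g) - of_real m) = \<bar>m\<bar> * \<bar>g - 1\<bar>"
        unfolding of_real_diff[symmetric] norm_of_real abs_mult[symmetric] by (simp add: algebra_simps)
      also have "\<dots> \<le> \<bar>m\<bar> * (A * (4 * h))" using g1 by (intro mult_left_mono) auto
      also have "\<dots> \<le> \<bar>m\<bar> * (A * (28 * (\<delta> + 1 / \<kappa>)))"
      proof (intro mult_left_mono)
        have "1 / \<kappa> > 0" using \<open>\<kappa> > 10\<close> by simp
        then show "4 * h \<le> 28 * (\<delta> + 1 / \<kappa>)" unfolding distrib_left using h\<delta> by linarith
      qed (use A in auto)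
      finally show ?thesis by (simp add: mult_ac)
    qed
    have "norm (p1 n k1 k2 u x t - of_real m) \<le> C / c0 * (\<bar>m\<bar> * (1 + A)) * (8 * (\<delta> + 1 / \<kappa>)) + \<bar>m\<bar> * (28 * A * (\<delta> + 1 / \<kappa>))"
      using norm_triangle_ineq[of "p1 n k1 k2 u x t - of_real (m * g)" "complex_of_real (m * g) - of_real m"] 1 2 by simp
    also have "\<dots> = C1 * (\<delta> + 1 / \<kappa>) * \<bar>m\<bar>"
    proof -
      have "a * (b * (1 + A)) * (8 * D) + b * (28 * A * D) = (a * (1 + A) * 8 + 28 * A) * D * b" for a b D :: real
        by (simp add: algebra_simps)
      then show ?thesis unfolding C1_def .
    qed
    finally show "norm (p1 n k1 k2 u x t - complex_of_real (mainterm n k1 k2 x t))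
                \<le> C1 * (deltaof x t + 1 / kappaof x t) * \<bar>mainterm n k1 k2 x t\<bar>"
      unfolding m_def \<delta>_def \<kappa>_def .
  qed
qed

end
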